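(* Let $\lambda>0$, $P>0$, $T>0$, $\sigma^2\ge 0$, $\eta>2$. In the single-tier downlink cellular network whose base stations (BSs) form a homogeneous Poisson point process of intensity $\lambda$ in $\mathbb{R}^2$, with Rayleigh fading, the coverage probabilities $\mathcal{C}_c$ (best connected user), $\mathcal{C}_{bk}^{(1)}$ (blackout user without BS cooperation) and $\mathcal{C}_{bk}^{(2)}$ (blackout user with BS cooperation), defined in the context, are given by $$\mathcal{C}_c = 2\pi\lambda\int_0^\infty x\exp\left(-\frac{T\sigma^2x^\eta}{P}-\pi\lambda x^2\left(1+T^{2/\eta}\int_{T^{-2/\eta}}^\infty\frac{1}{1+w^{\eta/2}}\,dw\right)\right)dx,$$ $$\mathcal{C}_{bk}^{(1)}=(2\lambda\pi)^2\int_0^\infty y\exp\left(-\frac{T\sigma^2y^\eta}{P}-\lambda\pi y^2\left(\frac{2T}{\eta-2}\,{}_2F_1\left(1,1-\tfrac{2}{\eta};2-\tfrac{2}{\eta};-T\right)+1\right)\right)\int_0^y\frac{x}{1+Ty^\eta x^{-\eta}}\,dx\,dy,$$ $$\mathcal{C}_{bk}^{(2)}=8(\pi\lambda)^3\int_0^\infty\int_{r_2}^\infty r_2r_3\exp\left(-s\sigma^2-\pi\lambda r_3^2\left(1+\frac{2sPr_3^{-\eta}}{\eta-2}\,{}_2F_1\left(1,1-\tfrac{2}{\eta};2-\tfrac{2}{\eta};-sPr_3^{-\eta}\right)\right)\right)\int_0^{r_2}\frac{r_1}{1+sPr_1^{-\eta}}\,dr_1\,dr_3\,dr_2,$$ where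 in the last formula $s=s(r_2,r_3)=\dfrac{T}{P(r_2^{-\eta}+r_3^{-\eta})}$. Moreover, in the interference-limited case $\sigma^2=0$ with $\eta=4$, $$\mathcal{C}_{bk}^{(2)}=\int_0^\infty\int_{r_2}^\infty 4(\pi\lambda)^3r_2^3r_3\left(1-\sqrt{\frac{Tr_3^4}{r_2^4+r_3^4}}\arctan\left(\sqrt{\frac{r_2^4+r_3^4}{Tr_3^4}}\right)\right)\exp\left(-\pi\lambda\left(r_3^2+\sqrt{\frac{T}{r_2^{-4}+r_3^{-4}}}\arctan\left(\sqrt{\frac{Tr_2^4}{r_2^4+r_3^4}}\right)\right)\right)dr_3\,dr_2.$$
   Context: Setting. BSs are the points of a homogeneous Poisson point process $\Phi$ of intensity $\lambda$ in $\mathbb{R}^2$; the test user is at the origin. Let $r_1\le r_2\le r_3\le\cdots$ be the increasingly ordered distances from the origin to the points of $\Phi$, and let $b_i$ be the BS at distance $r_i$. All BSs transmit with the same power $P$; path loss is $r\mapsto r^{-\eta}$; $\sigma^2$ is the noise power; $T$ is the SINR threshold. Channel power gains $h_1,h_2,h_3,\dots$ are i.i.d. exponential random variables with mean $1$, independent of $\Phi$ (Rayleigh fading with unit power). Coverage probabilities: (Best connected: served by $b_1$) $$\mathcal{C}_c=\mathbb{P}\left\{\frac{Ph_1r_1^{-\eta}}{\sum_{i\ge2}Ph_ir_i^{-\eta}+\sigma^2}>T\right\}.$$ (Blackout without cooperation: served by $b_2$, while $b_1$ interferes) $$\mathcal{C}_{bk}^{(1)}=\mathbb{P}\left\{\frac{Ph_2r_2^{-\eta}}{Ph_1r_1^{-\eta}+I_{r_1}+\sigma^2}>T\right\},\qquad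 I_{r_1}=\sum_{i\ge3}Ph_ir_i^{-\eta}.$$ (Blackout with non-coherent cooperation: jointly served by $b_2$ and $b_3$, while $b_1$ interferes) $$\mathcal{C}_{bk}^{(2)}=\mathbb{P}\left\{\frac{\left|\sqrt{P}\,g_2r_2^{-\eta/2}+\sqrt{P}\,g_3r_3^{-\eta/2}\right|^2}{Ph_1r_1^{-\eta}+I_{r_2}+\sigma^2}>T\right\},\qquad I_{r_2}=\sum_{i\ge4}Ph_ir_i^{-\eta},$$ where $g_2,g_3$ are i.i.d. complex channel coefficients distributed as circularly symmetric complex Gaussian $\mathcal{CN}(0,1)$, independent of $\Phi$ and of $h_1,h_4,h_5,\dots$. ${}_2F_1$ denotes the Gauss hypergeometric function (analytically continued to $(-\infty,0]$). *)

theory Defs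
  imports "HOL-Probability.Probability" "HOL-Complex_Analysis.Complex_Analysis"
begin

definition locally_finite_sets :: "(real^2) set set" where
  "locally_finite_sets = {S. \<forall>B. bounded B \<longrightarrow> finite (S \<inter> B)}"

definition configurations :: "(real^2) set measure" where
  "configurations = sigma locally_finite_sets
     {{S \<in> locally_finite_sets. card (S \<inter> B) = n} | B n. B \<in> sets borel \<and> bounded B}"

text \<open>
  A homogeneous Poisson process is almost surely simple, so it is modelled as a random locally
  finite set rather than as a random counting measure.
\<close>
definition poisson_process ::
  "'w measure \<Rightarrow> real \<Rightarrow> ('w \<Rightarrow> (real^2) set) \<Rightarrow> bool" where
  "poisson_process M lam \<Phi> \<longleftrightarrow>
     \<Phi> \<in> measurable M configurations \<and>
     (\<forall>B n. B \<in> sets borel \<and> bounded B \<longrightarrow>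
        measure M {\<omega> \<in> space M. card (\<Phi> \<omega> \<inter> B) = n} =
          (lam * measure lborel B) ^ n / fact n * exp (- (lam * measure lborel B))) \<and>
     (\<forall>F. finite F \<and> disjoint F \<and> (\<forall>B\<in>F. B \<in> sets borel \<and> bounded B) \<longrightarrow>
        prob_space.indep_vars M (\<lambda>_. count_space UNIV) (\<lambda>B \<omega>. card (\<Phi> \<omega> \<inter> B)) F)"

text \<open>
  The \<open>i\<close>-th smallest distance from the origin to a point of \<open>S\<close>, for \<open>i \<ge> 1\<close>, counted with
  multiplicity. If \<open>S\<close> has fewer than \<open>i\<close> points the value is irrelevant; for a Poisson process
  of positive intensity this has probability zero.
\<close>
definition ordered_dist :: "(real^2) set \<Rightarrow> nat \<Rightarrow> real" where
  "ordered_dist S i = Inf {t. 0 \<le> t \<and> i \<le> card (S \<inter> cball 0 t)}"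

lemma ordered_dist_enumeration:
  fixes b :: "nat \<Rightarrow> real^2"
  assumes S: "S \<in> locally_finite_sets" and b: "bij_betw b {1..} S"
    and mono: "\<And>j k. 1 \<le> j \<Longrightarrow> j \<le> k \<Longrightarrow> norm (b j) \<le> norm (b k)"
    and i: "1 \<le> i"
  shows "ordered_dist S i = norm (b i)"
proof -
  have fin: "finite (S \<inter> cball 0 t)" for t
    using S by (auto simp: locally_finite_sets_def)
  have inj: "inj_on b {1..}" and im: "b ` {1..} = S"
    using b by (auto simp: bij_betw_def)
  have "i \<le> card (S \<inter> cball 0 t)" if "norm (b i) \<le> t" for t
  proof -
    have "b ` {1..i} \<subseteq> S \<inter> cball 0 t"
      using im mono that by (force intro: order_trans)
    moreover have "card (b ` {1..i}) = i"
      by (subst card_image) (auto intro: inj_on_subset[OF inj])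
    ultimately show ?thesis
      using card_mono[OF fin] by metis
  qed
  moreover have "\<not> i \<le> card (S \<inter> cball 0 t)" if "t < norm (b i)" for t
  proof -
    have sub: "S \<inter> cball 0 t \<subseteq> b ` {1..<i}"
    proof
      fix x assume x: "x \<in> S \<inter> cball 0 t"
      then obtain j where j: "1 \<le> j" "x = b j" using im by auto
      have "j < i"
      proof (rule ccontr)
        assume "\<not> j < i"
        then have "norm (b i) \<le> norm (b j)" using mono i by simp
        then show False using x j that by simp
      qed
      then show "x \<in> b ` {1..<i}" using j by auto
    qed
    have "card (S \<inter> cball 0 t) \<le> card {1..<i}"
      by (rule order_trans[OF card_mono[OF _ sub] card_image_le]) auto
    then show ?thesis using i by simp
  qed
  ultimately have "{t. 0 \<le> t \<and> i \<le> card (S \<inter> cball 0 t)} = {norm (b i)..}"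
    using order_trans[OF norm_ge_zero[of "b i"]] by (auto simp del: not_le simp: not_less[symmetric])
  then show ?thesis by (simp add: ordered_dist_def)
qed

text \<open>
  The distribution \<open>CN(0,1)\<close>: \<open>E |Z|\<^sup>2 = 1\<close>, so real and imaginary part each have variance
  \<open>1/2\<close>, whereas \<^const>\<open>normal_density\<close> takes the standard deviation.
\<close>
definition std_complex_gaussian :: "'w measure \<Rightarrow> ('w \<Rightarrow> complex) \<Rightarrow> bool" where
  "std_complex_gaussian M Z \<longleftrightarrow>
     distributed M lborel (\<lambda>\<omega>. Re (Z \<omega>)) (normal_density 0 (sqrt (1/2))) \<and>
     distributed M lborel (\<lambda>\<omega>. Im (Z \<omega>)) (normal_density 0 (sqrt (1/2))) \<and>
     prob_space.indep_var M borel (\<lambda>\<omega>. Re (Z \<omega>)) borel (\<lambda>\<omega>. Im (Z \<omega>))"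

datatype source = Process | Gain nat | Coeff nat

text \<open>
  The \<open>\<sigma>\<close>-algebras on the sample space generated by the point process, by a power gain and by a
  complex channel coefficient. Indexing them by one type allows mutual independence of random
  elements with different codomains to be stated with \<^const>\<open>prob_space.indep_sets\<close>.
\<close>
fun generated_events ::
  "'w measure \<Rightarrow> ('w \<Rightarrow> (real^2) set) \<Rightarrow> (nat \<Rightarrow> 'w \<Rightarrow> real) \<Rightarrow> (nat \<Rightarrow> 'w \<Rightarrow> complex)
    \<Rightarrow> source \<Rightarrow> 'w set set" where
  "generated_events M \<Phi> h g Process = sets (vimage_algebra (space M) \<Phi> configurations)"
| "generated_events M \<Phi> h g (Gain i) = sets (vimage_algebra (space M) (h i) borel)"
| "generated_events M \<Phi> h g (Coeff i) = sets (vimage_algebra (space M) (g i) borel)"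

definition received_power ::
  "real \<Rightarrow> real \<Rightarrow> ('w \<Rightarrow> (real^2) set) \<Rightarrow> (nat \<Rightarrow> 'w \<Rightarrow> real) \<Rightarrow> nat \<Rightarrow> 'w \<Rightarrow> real" where
  "received_power P \<eta> \<Phi> h i \<omega> = P * h i \<omega> * ordered_dist (\<Phi> \<omega>) i powr (- \<eta>)"

definition interference_from ::
  "real \<Rightarrow> real \<Rightarrow> ('w \<Rightarrow> (real^2) set) \<Rightarrow> (nat \<Rightarrow> 'w \<Rightarrow> real) \<Rightarrow> nat \<Rightarrow> 'w \<Rightarrow> real" where
  "interference_from P \<eta> \<Phi> h k \<omega> = (\<Sum>i. received_power P \<eta> \<Phi> h (k + i) \<omega>)"

definition coverage_best_connected ::
  "'w measure \<Rightarrow> ('w \<Rightarrow> (real^2) set) \<Rightarrow> (nat \<Rightarrow> 'w \<Rightarrow> real)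
    \<Rightarrow> real \<Rightarrow> real \<Rightarrow> real \<Rightarrow> real \<Rightarrow> real" where
  "coverage_best_connected M \<Phi> h P \<eta> N T =
     measure M {\<omega> \<in> space M.
       received_power P \<eta> \<Phi> h 1 \<omega> / (interference_from P \<eta> \<Phi> h 2 \<omega> + N) > T}"

definition coverage_blackout ::
  "'w measure \<Rightarrow> ('w \<Rightarrow> (real^2) set) \<Rightarrow> (nat \<Rightarrow> 'w \<Rightarrow> real)
    \<Rightarrow> real \<Rightarrow> real \<Rightarrow> real \<Rightarrow> real \<Rightarrow> real" where
  "coverage_blackout M \<Phi> h P \<eta> N T =
     measure M {\<omega> \<in> space M.
       received_power P \<eta> \<Phi> h 2 \<omega> /
         (received_power P \<eta> \<Phi> h 1 \<omega> + interference_from P \<eta> \<Phi> h 3 \<omega> + N) > T}"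

definition coverage_blackout_coop ::
  "'w measure \<Rightarrow> ('w \<Rightarrow> (real^2) set) \<Rightarrow> (nat \<Rightarrow> 'w \<Rightarrow> real) \<Rightarrow> (nat \<Rightarrow> 'w \<Rightarrow> complex)
    \<Rightarrow> real \<Rightarrow> real \<Rightarrow> real \<Rightarrow> real \<Rightarrow> real" where
  "coverage_blackout_coop M \<Phi> h g P \<eta> N T =
     measure M {\<omega> \<in> space M.
       (cmod (of_real (sqrt P) * g 2 \<omega> * of_real (ordered_dist (\<Phi> \<omega>) 2 powr (- \<eta> / 2)) +
              of_real (sqrt P) * g 3 \<omega> * of_real (ordered_dist (\<Phi> \<omega>) 3 powr (- \<eta> / 2))))\<^sup>2 /
         (received_power P \<eta> \<Phi> h 1 \<omega> + interference_from P \<eta> \<Phi> h 4 \<omega> + N) > T}"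

definition slit_plane :: "complex set" where
  "slit_plane = - (complex_of_real ` {1..})"

text \<open>
  The analytic continuation of the Gauss series from the unit disc to the plane slit along
  \<open>[1, \<infinity>)\<close>. It is unique there by the identity theorem (see \<open>hyp2F1_eqI\<close>);
  outside the slit plane the value is unspecified.
\<close>
definition hyp2F1 :: "complex \<Rightarrow> complex \<Rightarrow> complex \<Rightarrow> complex \<Rightarrow> complex" where
  "hyp2F1 a b c =
     (SOME F. F holomorphic_on slit_plane \<and>
        (\<forall>z\<in>ball 0 1. F z = eval_fps (fps_hypergeo [a, b] [c] 1) z))"

lemma fps_hypergeo_Gauss:
  fixes a b c :: complex
  shows "fps_nth (fps_hypergeo [a, b] [c] 1) n =
     pochhammer a n * pochhammer b n / (pochhammer c n * fact n)"
  by simp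

lemma hyp2F1_eqI:
  assumes F: "F holomorphic_on slit_plane"
    and series: "\<And>z. z \<in> ball 0 1 \<Longrightarrow> F z = eval_fps (fps_hypergeo [a, b] [c] 1) z"
    and z: "z \<in> slit_plane"
  shows "hyp2F1 a b c z = F z"
proof -
  let ?P = "\<lambda>F. F holomorphic_on slit_plane \<and>
        (\<forall>z\<in>ball 0 1. F z = eval_fps (fps_hypergeo [a, b] [c] 1) z)"
  have H: "?P (hyp2F1 a b c)"
    unfolding hyp2F1_def by (rule someI[where P = ?P and x = F]) (use F series in blast)
  have op: "open slit_plane"
    unfolding slit_plane_def
    by (intro open_Compl closed_injective_linear_image)
       (auto intro: bounded_linear.linear bounded_linear_of_real injI)
  have ball: "ball 0 1 \<subseteq> slit_plane"
    by (auto simp: slit_plane_def)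
  have "starlike slit_plane"
    unfolding starlike_def
  proof (intro bexI[of _ 0] ballI subsetI)
    fix w u assume w: "w \<in> slit_plane" and "u \<in> closed_segment 0 w"
    then obtain t where t: "0 \<le> t" "t \<le> 1" "u = of_real t * w"
      by (auto simp: in_segment scaleR_conv_of_real)
    show "u \<in> slit_plane"
    proof (rule ccontr)
      assume "u \<notin> slit_plane"
      then obtain y where y: "1 \<le> y" "of_real t * w = complex_of_real y"
        using t by (auto simp: slit_plane_def)
      with t have "t > 0" by (cases "t = 0") auto
      with y have "w = complex_of_real (y / t)" by (simp add: field_simps)
      moreover have "1 \<le> y / t" using \<open>t > 0\<close> t y by (simp add: field_simps)
      ultimately show False using w unfolding slit_plane_def by blast
    qed
  qed (auto simp: slit_plane_def)
  then have conn: "connected slit_plane"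
    by (rule starlike_imp_connected)
  have "hyp2F1 a b c z - F z = 0"
  proof (rule analytic_continuation[of "\<lambda>z. hyp2F1 a b c z - F z" slit_plane "ball 0 1" 0])
    show "(\<lambda>z. hyp2F1 a b c z - F z) holomorphic_on slit_plane"
      using H F by (intro holomorphic_intros) auto
    show "(0::complex) islimpt ball 0 1"
      by (simp add: islimpt_ball)
  qed (use op conn ball H series z in \<open>auto simp: slit_plane_def\<close>)
  then show ?thesis by simp
qed

definition real_hyp2F1 :: "real \<Rightarrow> real \<Rightarrow> real \<Rightarrow> real \<Rightarrow> real" where
  "real_hyp2F1 a b c x = Re (hyp2F1 (of_real a) (of_real b) (of_real c) (of_real x))"

end

theory Submission
  imports Defs
begin

text \<open>
  Only the ordered distances \<open>r\<^sub>1 < r\<^sub>2 < \<dots>\<close> of the stations matter. Their joint law is identified on ordered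
  boxes, where the probability is a product of Poisson probabilities of annulus counts; it follows
  that \<open>(r\<^sub>i)\<close> is a Markov chain. Integrating out the Rayleigh gains turns each coverage probability
  into the expectation of a product of factors \<open>1 / (1 + c r\<^sub>i\<^sup>-\<^sup>\<eta>)\<close>. With
  \<open>H(x) = exp (- \<integral>\<^sub>x\<^sup>\<infinity> c v\<^sup>-\<^sup>\<eta> / (1 + c v\<^sup>-\<^sup>\<eta>) 2\<pi>\<lambda>v dv)\<close>, the partial products times \<open>H(r\<^sub>m)\<close> form a
  martingale in \<open>m\<close>, and \<open>H(r\<^sub>m) \<rightarrow> 1\<close>; hence the infinite product over the stations beyond
  \<open>r\<^sub>k\<close> may be replaced by \<open>H(r\<^sub>k)\<close>, and only the joint density of \<open>r\<^sub>1, \<dots>, r\<^sub>k\<close> is needed.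
\<close>

subsection \<open>Ordered distances\<close>

text \<open>The interference is an infinite series whose terms all depend on one configuration, and
  \<open>suminf\<close> carries no information when a series diverges. Truncation meets both
  obstacles: the expectation with \<open>n\<close> interferers beyond a fixed station, times H at
  the last radius, does not depend on \<open>n\<close>. The same identity then yields almost sure
  convergence and the limit. H is determined by a linear differential equation: averaging
  \<open>H(y) / (1 + c y^-\<eta>)\<close> over the law of the next distance \<open>y\<close>, given
  the current distance \<open>x\<close>, has to return \<open>H(x)\<close>. Laplace transforms enter
  because, given all else, the useful signal is exponential. This holds for one Rayleigh link and
  for the squared modulus of two superposed Gaussian links, whose mean is the sum of the two mean
  powers. Coverage is therefore the expectation of \<open>exp (- s (I + N))\<close>, where
  \<open>s\<close> is \<open>T\<close> divided by the mean signal power, and the constant in the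
  product factors is \<open>c = s P\<close>. The tail integral, the Gauss function and the
  arctangent of the claims are three readings of one function, \<open>power_kernel\<close>.\<close>

lemma card_cball_mono:
  assumes "S \<in> locally_finite_sets" "s \<le> t"
  shows "card (S \<inter> cball 0 s) \<le> card (S \<inter> cball 0 t)"
  using assms by (intro card_mono) (auto simp: locally_finite_sets_def)

text \<open>By local finiteness the count is right-continuous in the radius, so the infimum is
  attained. This converts statements about distances into statements about counts in balls, whose
  law is given. If no radius reached count \<open>i\<close>, the infimum would be that of the empty
  set.\<close>

lemma ordered_dist_le_iff:
  assumes S: "S \<in> locally_finite_sets" and ex: "\<exists>t. i \<le> card (S \<inter> cball 0 t)" and t: "0 \<le> t"
  shows "ordered_dist S i \<le> t \<longleftrightarrow> i \<le> card (S \<inter> cball 0 t)"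
proof -
  let ?A = "{t. 0 \<le> t \<and> i \<le> card (S \<inter> cball 0 t)}"
  obtain t0 where "i \<le> card (S \<inter> cball 0 t0)" using ex by auto
  then have "i \<le> card (S \<inter> cball 0 (max 0 t0))"
    using card_cball_mono[OF S, of t0 "max 0 t0"] by simp
  then have "max 0 t0 \<in> ?A" by simp
  then have ne: "?A \<noteq> {}" by blast
  have bdd: "bdd_below ?A" by (rule bdd_belowI[of _ 0]) auto
  show ?thesis
  proof
    assume "i \<le> card (S \<inter> cball 0 t)"
    then show "ordered_dist S i \<le> t"
      unfolding ordered_dist_def using t bdd by (intro cInf_lower) auto
  next
    assume le: "ordered_dist S i \<le> t"
    show "i \<le> card (S \<inter> cball 0 t)"
    proof (rule ccontr)
      assume not: "\<not> i \<le> card (S \<inter> cball 0 t)"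
      \<comment> \<open>\<open>N\<close> collects the norms met between \<open>t\<close> and
        \<open>t + 1\<close>; inserting \<open>t + 1\<close> keeps it nonempty. No radius below
        \<open>Min N\<close> sees a point that radius \<open>t\<close> does not, so every admissible
        radius is at least \<open>Min N\<close>, which exceeds \<open>t\<close>.\<close>
      define N where "N = insert (t + 1) (norm ` (S \<inter> cball 0 (t + 1) - cball 0 t))"
      have fin: "finite N" using S by (auto simp: N_def locally_finite_sets_def)
      have "Min N > t" using fin by (subst Min_gr_iff) (auto simp: N_def)
      have "Min N \<le> u" if u: "u \<in> ?A" for u
      proof (rule ccontr)
        assume "\<not> Min N \<le> u"
        then have less: "u < Min N" by simp
        then have u1: "u < t + 1" using fin Min_le[OF fin, of "t + 1"] by (auto simp: N_def)
        have "S \<inter> cball 0 u \<subseteq> S \<inter> cball 0 t"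
        proof
          fix x assume x: "x \<in> S \<inter> cball 0 u"
          show "x \<in> S \<inter> cball 0 t"
          proof (rule ccontr)
            assume "x \<notin> S \<inter> cball 0 t"
            then have "norm x \<in> N" using x u1 by (auto simp: N_def)
            then have "Min N \<le> norm x" using fin by simp
            then show False using less x by simp
          qed
        qed
        then have "card (S \<inter> cball 0 u) \<le> card (S \<inter> cball 0 t)"
          using S by (intro card_mono) (auto simp: locally_finite_sets_def)
        then show False using not u by simp
      qed
      then have "Min N \<le> Inf ?A" using ne by (intro cInf_greatest) auto
      then show False using \<open>Min N > t\<close> le unfolding ordered_dist_def by simp
    qed
  qed
qed

lemma ordered_dist_nonneg:
  assumes "\<exists>t. i \<le> card (S \<inter> cball 0 t)" "S \<in> locally_finite_sets"
  shows "0 \<le> ordered_dist S i"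
proof -
  obtain t0 where "i \<le> card (S \<inter> cball 0 t0)" using assms by auto
  then have "i \<le> card (S \<inter> cball 0 (max 0 t0))"
    using card_cball_mono[OF assms(2), of t0 "max 0 t0"] by simp
  then have "max 0 t0 \<in> {t. 0 \<le> t \<and> i \<le> card (S \<inter> cball 0 t)}" by simp
  then have "{t. 0 \<le> t \<and> i \<le> card (S \<inter> cball 0 t)} \<noteq> {}" by blast
  then show ?thesis
    unfolding ordered_dist_def by (rule cInf_greatest) simp
qed

lemma space_configurations: "space configurations = locally_finite_sets"
  unfolding configurations_def by (subst space_measure_of) auto

lemma measurable_card_Int:
  assumes "B \<in> sets borel" "bounded B"
  shows "(\<lambda>S. card (S \<inter> B)) \<in> measurable configurations (count_space UNIV)"
proof (subst measurable_count_space_eq2_countable)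
  show "(\<lambda>S. card (S \<inter> B)) \<in> space configurations \<rightarrow> UNIV \<and>
    (\<forall>n\<in>UNIV. (\<lambda>S. card (S \<inter> B)) -` {n} \<inter> space configurations \<in> sets configurations)"
  proof (intro conjI ballI)
    fix n
    have "(\<lambda>S. card (S \<inter> B)) -` {n} \<inter> space configurations = {S \<in> locally_finite_sets. card (S \<inter> B) = n}"
      by (auto simp: space_configurations)
    also have "\<dots> \<in> sets configurations"
      unfolding configurations_def using assms by (intro in_measure_of) auto
    finally show "(\<lambda>S. card (S \<inter> B)) -` {n} \<inter> space configurations \<in> sets configurations" .
  qed auto
qed

lemma measurable_ordered_dist [measurable]:
  "(\<lambda>S. ordered_dist S i) \<in> borel_measurable configurations"
proof (subst borel_measurable_iff_le, intro allI)
  fix t :: real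
  have [measurable]: "(\<lambda>S. card (S \<inter> cball 0 u)) \<in> measurable configurations (count_space UNIV)"
    for u :: real
    by (rule measurable_card_Int) auto
  \<comment> \<open>Integer radii turn the existence of \<open>i\<close> points into a countable
    condition. On the remaining configurations the distance is the constant
    \<open>Inf {}\<close>.\<close>
  have "{S \<in> space configurations. ordered_dist S i \<le> t} =
     {S \<in> space configurations. (\<exists>n::nat. i \<le> card (S \<inter> cball 0 (real n))) \<and> 0 \<le> t \<and> i \<le> card (S \<inter> cball 0 t)} \<union>
     {S \<in> space configurations. (\<forall>n::nat. \<not> i \<le> card (S \<inter> cball 0 (real n))) \<and> Inf {} \<le> t}" (is "?L = ?R1 \<union> ?R2")
  proof -
    have 1: "ordered_dist S i \<le> t \<longleftrightarrow> 0 \<le> t \<and> i \<le> card (S \<inter> cball 0 t)"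
      if S: "S \<in> space configurations" and n: "i \<le> card (S \<inter> cball 0 (real n))" for S n
    proof (cases "0 \<le> t")
      case True
      then show ?thesis using ordered_dist_le_iff[of S i t] S n by (auto simp: space_configurations)
    next
      case False
      have "0 \<le> ordered_dist S i"
        using n S by (intro ordered_dist_nonneg) (auto simp: space_configurations)
      then show ?thesis using False by linarith
    qed
    have 2: "ordered_dist S i = Inf {}"
      if S: "S \<in> space configurations" and n: "\<forall>n::nat. \<not> i \<le> card (S \<inter> cball 0 (real n))" for S
    proof -
      have "\<not> i \<le> card (S \<inter> cball 0 t)" for t
      proof -
        obtain n :: nat where "t \<le> real n" using real_arch_simple by blast
        then show ?thesis using n[rule_format, of n] card_cball_mono[of S t n] S
          by (auto simp: space_configurations)
      qed
      then show ?thesis by (auto simp: ordered_dist_def)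
    qed
    show ?thesis
    proof (intro set_eqI)
      fix S
      show "S \<in> ?L \<longleftrightarrow> S \<in> ?R1 \<union> ?R2"
      proof (cases "\<exists>n::nat. i \<le> card (S \<inter> cball 0 (real n))")
        case True
        then obtain n :: nat where "i \<le> card (S \<inter> cball 0 (real n))" by blast
        then show ?thesis using 1[of S n] True by blast
      next
        case False
        then show ?thesis using 2[of S] by auto
      qed
    qed
  qed
  also have "\<dots> \<in> sets configurations" by measurable
  finally show "{S \<in> space configurations. ordered_dist S i \<le> t} \<in> sets configurations" .
qed

subsection \<open>The radial intensity\<close>

text \<open>\<^const>\<open>ennreal\<close> truncates at \<open>0\<close>, so this measure lives on the positive half-line.\<close>
definition radial_intensity :: "real \<Rightarrow> real measure" where
  "radial_intensity lam = density lborel (\<lambda>v. ennreal (2 * pi * lam * v))"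

lemma sets_radial_intensity [simp, measurable_cong]: "sets (radial_intensity lam) = sets borel"
  and space_radial_intensity [simp]: "space (radial_intensity lam) = UNIV"
  by (auto simp: radial_intensity_def)

lemma sigma_finite_radial_intensity: "sigma_finite_measure (radial_intensity lam)"
  unfolding radial_intensity_def
  by (subst sigma_finite_measure.sigma_finite_iff_density_finite[OF lborel.sigma_finite_measure_axioms]) auto

lemma nn_integral_radial_intensity:
  assumes "f \<in> borel_measurable borel"
  shows "(\<integral>\<^sup>+x. f x \<partial>radial_intensity lam) = (\<integral>\<^sup>+x. ennreal (2 * pi * lam * x) * f x \<partial>lborel)"
  unfolding radial_intensity_def using assms by (subst nn_integral_density) auto

lemma nn_integral_Ioc_eq_Icc:
  "(\<integral>\<^sup>+x. f x * indicator {a<..b} x \<partial>lborel) = (\<integral>\<^sup>+x. f x * indicator {a..b::real} x \<partial>lborel)"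
  by (rule nn_integral_cong_AE, rule AE_mp[OF AE_lborel_singleton[of a]])
     (auto intro!: AE_I2 split: split_indicator)

lemma emeasure_radial_intensity:
  assumes "0 \<le> a" "a \<le> b" "lam > 0"
  shows "emeasure (radial_intensity lam) {a<..b} = ennreal (lam * pi * b\<^sup>2 - lam * pi * a\<^sup>2)"
proof -
  have "emeasure (radial_intensity lam) {a<..b} = (\<integral>\<^sup>+x. ennreal (2 * pi * lam * x) * indicator {a..b} x \<partial>lborel)"
    unfolding radial_intensity_def by (subst emeasure_density) (auto simp: nn_integral_Ioc_eq_Icc)
  also have "\<dots> = ennreal (lam * pi * b\<^sup>2 - lam * pi * a\<^sup>2)"
    using assms by (intro nn_integral_FTC_Icc) (auto intro!: derivative_eq_intros)
  finally show ?thesis .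
qed

lemma nn_integral_exp_radial_intensity:
  assumes "0 \<le> a" "a \<le> b" "lam > 0"
  shows "(\<integral>\<^sup>+x. ennreal (exp (- (lam * pi * x\<^sup>2))) * indicator {a<..b} x \<partial>radial_intensity lam) =
    ennreal (exp (- (lam * pi * a\<^sup>2)) - exp (- (lam * pi * b\<^sup>2)))"
proof -
  have "(\<integral>\<^sup>+x. ennreal (exp (- (lam * pi * x\<^sup>2))) * indicator {a<..b} x \<partial>radial_intensity lam) =
    (\<integral>\<^sup>+x. (ennreal (2 * pi * lam * x) * ennreal (exp (- (lam * pi * x\<^sup>2)))) * indicator {a<..b} x \<partial>lborel)"
    by (subst nn_integral_radial_intensity) (auto simp: mult.assoc)
  also have "\<dots> = (\<integral>\<^sup>+x. ennreal (2 * pi * lam * x * exp (- (lam * pi * x\<^sup>2))) * indicator {a..b} x \<partial>lborel)"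
    by (subst nn_integral_Ioc_eq_Icc) (simp add: ennreal_mult'')
  also have "\<dots> = ennreal ((- exp (- (lam * pi * b\<^sup>2))) - (- exp (- (lam * pi * a\<^sup>2))))"
    using assms by (intro nn_integral_FTC_Icc) (auto intro!: derivative_eq_intros)
  finally show ?thesis by simp
qed

text \<open>In the application \<open>c j\<close> counts the points in the \<open>j\<close>-th ball,
  the odd and even radii being the left and right ends of the boxes. Even steps are then gaps, which
  must be void, and odd steps are boxes, which hold one point each. The last box may hold more,
  since nothing is prescribed beyond the last distance.\<close>

lemma counts_boxes_iff:
  fixes c :: "nat \<Rightarrow> nat"
  assumes mono: "\<And>j. c j \<le> c (Suc j)" and c0: "c 0 = 0"
  shows "(\<forall>i\<le>m. c (2 * i + 1) < Suc i \<and> Suc i \<le> c (2 * i + 2)) \<longleftrightarrow>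
    (\<forall>j<2 * m + 2. c (Suc j) - c j \<in> (if even j then {0} else if j = 2 * m + 1 then {1..} else {1}))"
    (is "?L \<longleftrightarrow> ?R")
proof
  assume L: ?L
  have odd: "c (2 * i + 1) = i" if "i \<le> m" for i
  proof (cases i)
    case 0
    then show ?thesis using L that by auto
  next
    case (Suc k)
    then have "Suc k \<le> c (2 * k + 2)" using L that by auto
    also have "c (2 * k + 2) \<le> c (2 * i + 1)" using mono[of "2 * k + 2"] Suc by simp
    finally show ?thesis using L that Suc by (auto simp: less_Suc_eq_le)
  qed
  have even: "c (2 * i) = i" if "i \<le> m" for i
  proof (cases i)
    case 0
    then show ?thesis using c0 by simp
  next
    case (Suc k)
    then have "Suc k \<le> c (2 * k + 2)" using L that by auto
    moreover have "c (2 * i) \<le> c (2 * i + 1)" using mono by simp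
    ultimately show ?thesis using odd[OF that] Suc by simp
  qed
  show ?R
  proof (intro allI impI)
    fix j assume j: "j < 2 * m + 2"
    show "c (Suc j) - c j \<in> (if even j then {0} else if j = 2 * m + 1 then {1..} else {1})"
    proof (cases "even j")
      case True
      then obtain i where i: "j = 2 * i" by (auto elim: evenE)
      then show ?thesis using odd[of i] even[of i] j by simp
    next
      case False
      then obtain i where i: "j = 2 * i + 1" by (auto elim: oddE)
      show ?thesis
      proof (cases "i = m")
        case True
        then show ?thesis using odd[of i] L[rule_format, of m] i by simp
      next
        case False
        then have "Suc i \<le> m" using i j by simp
        then show ?thesis using odd[of i] even[of "Suc i"] i j False by simp
      qed
    qed
  qed
next
  assume R: ?R
  have step0: "c (2 * i + 1) = c (2 * i)" if "i \<le> m" for i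
    using R[rule_format, of "2 * i"] that mono[of "2 * i"] by simp
  have step1: "c (2 * i + 2) = Suc (c (2 * i + 1))" if "i < m" for i
    using R[rule_format, of "2 * i + 1"] that mono[of "2 * i + 1"] by simp
  have even: "c (2 * i) = i" if "i \<le> m" for i
    using that
  proof (induction i)
    case (Suc i)
    then show ?case using step0[of i] step1[of i] by simp
  qed (simp add: c0)
  show ?L
  proof (intro allI impI)
    fix i assume i: "i \<le> m"
    show "c (2 * i + 1) < Suc i \<and> Suc i \<le> c (2 * i + 2)"
    proof (cases "i = m")
      case True
      then show ?thesis using R[rule_format, of "2 * m + 1"] even[of i] step0[of i] by simp
    next
      case False
      then show ?thesis using i even[of i] step0[of i] step1[of i] by simp
    qed
  qed
qed

text \<open>With \<open>u\<close> the mean counts of the balls, even factors are void probabilities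
  of gaps and odd factors are probabilities of exactly one point. The exponentials
  telescope.\<close>

lemma prod_exp_differences:
  fixes u :: "nat \<Rightarrow> real"
  assumes "u 0 = 0"
  shows "(\<Prod>j<2 * m. if even j then exp (- (u (Suc j) - u j))
      else (u (Suc j) - u j) * exp (- (u (Suc j) - u j))) =
    (\<Prod>i<m. u (2 * i + 2) - u (2 * i + 1)) * exp (- u (2 * m))"
  by (induction m) (simp_all add: assms exp_diff exp_minus field_simps)

text \<open>Open inside and closed outside, so that consecutive annuli are disjoint and match the
  intervals \<open>{a<..b}\<close> of distances. For \<open>t j < 0\<close> the inner ball is empty
  and the annulus is a full ball, origin included.\<close>

definition annulus :: "(nat \<Rightarrow> real) \<Rightarrow> nat \<Rightarrow> (real^2) set" where
  "annulus t j = cball 0 (t (Suc j)) - cball 0 (t j)"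

lemma measure_cball_real2: "measure lborel (cball (0::real^2) r) = pi * (max 0 r)\<^sup>2"
proof (cases "0 \<le> r")
  case True
  then show ?thesis by (simp add: content_cball unit_ball_vol_2)
qed (simp add: max_def)

lemma measure_annulus:
  assumes "t j \<le> t (Suc j)"
  shows "measure lborel (annulus t j) = pi * (max 0 (t (Suc j)))\<^sup>2 - pi * (max 0 (t j))\<^sup>2"
proof -
  have "measure lborel (annulus t j) =
    measure lborel (cball (0::real^2) (t (Suc j))) - measure lborel (cball (0::real^2) (t j))"
    unfolding annulus_def using assms
    using emeasure_lborel_cball_finite[of "0::real^2" "t (Suc j)"]
    by (intro measure_Diff) auto
  then show ?thesis by (simp add: measure_cball_real2)
qed

lemma annulus_eq: "annulus t j = {x. t j < norm x \<and> norm x \<le> t (Suc j)}"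
  by (auto simp: annulus_def)

lemma disjoint_annuli:
  assumes mono: "\<And>j. j < n \<Longrightarrow> t j < t (Suc j)" and "i < n" "j < n" "i \<noteq> j"
  shows "annulus t i \<inter> annulus t j = {}"
proof -
  have le: "t (Suc i) \<le> t j" if "i < j" "j < n" for i j
    using that
  proof (induction j)
    case (Suc j)
    then show ?case using mono[of j] by (cases "i = j") auto
  qed simp
  from \<open>i \<noteq> j\<close> consider "i < j" | "j < i" by linarith
  then show ?thesis
  proof cases
    case 1 then show ?thesis using le[of i j] assms by (force simp: annulus_eq)
  next
    case 2 then show ?thesis using le[of j i] assms by (force simp: annulus_eq)
  qed
qed

text \<open>\<open>poisson_process\<close> indexes independence by the sets themselves, so a product
  over annuli becomes a product over indices only when distinct indices give distinct sets.
  Nonnegative outer radii make every annulus nonempty, and disjointness does the rest.\<close>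

lemma inj_on_annulus:
  assumes mono: "\<And>j. j < n \<Longrightarrow> t j < t (Suc j)" and pos: "\<And>j. j < n \<Longrightarrow> 0 \<le> t (Suc j)"
  shows "inj_on (annulus t) {..<n}"
proof (rule inj_onI)
  fix i j assume ij: "i \<in> {..<n}" "j \<in> {..<n}" "annulus t i = annulus t j"
  obtain x :: "real^2" where "norm x = t (Suc i)" using vector_choose_size pos ij by (metis lessThan_iff)
  then have "x \<in> annulus t i" using mono[of i] ij(1) unfolding annulus_eq by simp
  then show "i = j" using disjoint_annuli[of n t i j] mono ij by auto
qed

locale poisson_network = prob_space M for M :: "'w measure" +
  fixes \<Phi> :: "'w \<Rightarrow> (real^2) set" and lam :: real
  assumes lam_pos: "lam > 0" and poisson: "poisson_process M lam \<Phi>"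
begin

lemma \<Phi>_measurable [measurable]: "\<Phi> \<in> measurable M configurations"
  using poisson by (auto simp: poisson_process_def)

lemma \<Phi>_locally_finite: "\<omega> \<in> space M \<Longrightarrow> \<Phi> \<omega> \<in> locally_finite_sets"
  using measurable_space[OF \<Phi>_measurable] by (auto simp: space_configurations)

lemma measurable_count [measurable]:
  "B \<in> sets borel \<Longrightarrow> bounded B \<Longrightarrow> (\<lambda>\<omega>. card (\<Phi> \<omega> \<inter> B)) \<in> measurable M (count_space UNIV)"
  by (rule measurable_compose[OF \<Phi>_measurable measurable_card_Int])

lemma prob_count:
  "B \<in> sets borel \<Longrightarrow> bounded B \<Longrightarrow> prob {\<omega> \<in> space M. card (\<Phi> \<omega> \<inter> B) = n} =
    (lam * measure lborel B) ^ n / fact n * exp (- (lam * measure lborel B))"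
  using poisson by (auto simp: poisson_process_def)

text \<open>Fewer than \<open>i\<close> points in a ball has probability at most a finite sum of
  terms \<open>u ^ j / exp u\<close>, where \<open>u\<close> is the mean count, and this vanishes as
  the radius grows.\<close>

lemma AE_infinitely_many: "AE \<omega> in M. \<forall>i. \<exists>t. i \<le> card (\<Phi> \<omega> \<inter> cball 0 t)"
proof -
  have [measurable]: "(\<lambda>\<omega>. card (\<Phi> \<omega> \<inter> cball 0 u)) \<in> measurable M (count_space UNIV)" for u
    by (rule measurable_count) auto
  have "AE \<omega> in M. \<exists>n::nat. i \<le> card (\<Phi> \<omega> \<inter> cball 0 (real n))" for i
  proof -
    let ?B = "{\<omega> \<in> space M. \<forall>n::nat. card (\<Phi> \<omega> \<inter> cball 0 (real n)) < i}"
    have le: "prob ?B \<le> (\<Sum>j<i. (lam * (pi * (real n)\<^sup>2)) ^ j / exp (lam * (pi * (real n)\<^sup>2)))" for n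
    proof -
      have "prob ?B \<le> prob (\<Union>j<i. {\<omega> \<in> space M. card (\<Phi> \<omega> \<inter> cball 0 (real n)) = j})"
        by (intro finite_measure_mono) auto
      also have "\<dots> \<le> (\<Sum>j<i. prob {\<omega> \<in> space M. card (\<Phi> \<omega> \<inter> cball 0 (real n)) = j})"
        by (intro finite_measure_subadditive_finite) auto
      also have "\<dots> \<le> (\<Sum>j<i. (lam * (pi * (real n)\<^sup>2)) ^ j / exp (lam * (pi * (real n)\<^sup>2)))"
      proof (intro sum_mono)
        fix j
        let ?u = "lam * (pi * (real n)\<^sup>2)"
        have "prob {\<omega> \<in> space M. card (\<Phi> \<omega> \<inter> cball 0 (real n)) = j} = ?u ^ j / exp ?u / fact j"
          by (subst prob_count) (auto simp: measure_cball_real2 exp_minus field_simps)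
        also have "\<dots> \<le> ?u ^ j / exp ?u / 1"
          using lam_pos by (intro divide_left_mono) (auto intro!: divide_nonneg_pos simp: fact_ge_1)
        finally show "prob {\<omega> \<in> space M. card (\<Phi> \<omega> \<inter> cball 0 (real n)) = j} \<le> ?u ^ j / exp ?u" by simp
      qed
      finally show ?thesis .
    qed
    have lim: "filterlim (\<lambda>n. lam * (pi * (real n)\<^sup>2)) at_top sequentially"
      using lam_pos by real_asymp
    have "(\<lambda>n. \<Sum>j<i. (lam * (pi * (real n)\<^sup>2)) ^ j / exp (lam * (pi * (real n)\<^sup>2))) \<longlonglongrightarrow> (\<Sum>j<i. 0)"
      by (intro tendsto_sum filterlim_compose[OF tendsto_power_div_exp_0 lim])
    then have "prob ?B \<le> 0"
      using le by (intro LIMSEQ_le_const) auto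
    then have "prob ?B = 0" by (simp add: measure_le_0_iff)
    then have "AE \<omega> in M. \<not> (\<forall>n::nat. card (\<Phi> \<omega> \<inter> cball 0 (real n)) < i)"
      by (intro AE_I[where N = ?B]) (auto simp: emeasure_eq_measure)
    then show ?thesis by eventually_elim (auto simp: not_less)
  qed
  then have "AE \<omega> in M. \<forall>i. \<exists>n::nat. i \<le> card (\<Phi> \<omega> \<inter> cball 0 (real n))"
    by (subst AE_all_countable) auto
  then show ?thesis by eventually_elim blast
qed

text \<open>Distances are indexed from \<open>0\<close>: \<open>dist_seq \<omega> i\<close> is the paper's \<open>r\<^sub>i\<^sub>+\<^sub>1\<close>.\<close>
abbreviation dist_seq :: "'w \<Rightarrow> nat \<Rightarrow> real" where
  "dist_seq \<omega> i \<equiv> ordered_dist (\<Phi> \<omega>) (Suc i)"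

text \<open>The radii interleave the ends of the boxes. The negative \<open>t 0\<close> is an
  artificial start: it turns the first annulus into the ball of radius \<open>t 1\<close>, so that
  the gap before the first box is treated like the others.\<close>

lemma prob_boxes:
  assumes mono: "\<And>j. j < 2 * m + 2 \<Longrightarrow> t j < t (Suc j)" and t0: "t 0 < 0" and t1: "0 \<le> t 1"
  shows "prob {\<omega> \<in> space M. \<forall>i\<le>m. t (2 * i + 1) < dist_seq \<omega> i \<and> dist_seq \<omega> i \<le> t (2 * i + 2)} =
    (\<Prod>i<m. lam * pi * (t (2 * i + 2))\<^sup>2 - lam * pi * (t (2 * i + 1))\<^sup>2) *
    (exp (- (lam * pi * (t (2 * m + 1))\<^sup>2)) - exp (- (lam * pi * (t (2 * m + 2))\<^sup>2)))"
proof -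
  let ?n = "2 * m + 2"
  define C where "C j = (if even j then {0::nat} else if j = 2 * m + 1 then {1..} else {1})" for j
  \<comment> \<open>The mean count in the ball of radius \<open>t j\<close>; \<open>max 0\<close>
    gives \<open>u 0 = 0\<close> at the negative start.\<close>
  define u where "u j = lam * pi * (max 0 (t j))\<^sup>2" for j
  have mono': "t i \<le> t j" if "i \<le> j" "j \<le> ?n" for i j
    using that
  proof (induction j)
    case (Suc j)
    then show ?case using mono[of j] by (cases "i = Suc j") auto
  qed simp
  have pos: "0 \<le> t (Suc j)" if "j < ?n" for j
    using mono'[of 1 "Suc j"] t1 that by simp
  have bor: "annulus t j \<in> sets borel" "bounded (annulus t j)" for j
    by (auto simp: annulus_def intro: bounded_subset[of "cball 0 (t (Suc j))"])
  have vol: "lam * measure lborel (annulus t j) = u (Suc j) - u j" if "j < ?n" for j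
    using measure_annulus[of t j] mono[OF that] by (simp add: u_def right_diff_distrib mult.assoc)
  have inj: "inj_on (annulus t) {..<?n}" using mono pos by (rule inj_on_annulus)
  have "disjoint (annulus t ` {..<?n})"
  proof (rule disjointI)
    fix A B assume "A \<in> annulus t ` {..<?n}" "B \<in> annulus t ` {..<?n}" "A \<noteq> B"
    then obtain i j where "i < ?n" "j < ?n" "i \<noteq> j" "A = annulus t i" "B = annulus t j" by blast
    then show "A \<inter> B = {}" using disjoint_annuli[of ?n t i j] mono by simp
  qed
  then have "indep_vars (\<lambda>_. count_space UNIV) (\<lambda>B \<omega>. card (\<Phi> \<omega> \<inter> B)) (annulus t ` {..<?n})"
    using poisson bor unfolding poisson_process_def by auto
  note ind = this
  \<comment> \<open>The independent family is indexed by annuli, so the prescribed count of an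
    annulus is looked up through its index.\<close>
  let ?D = "\<lambda>B. C (the_inv_into {..<?n} (annulus t) B)"
  have inv: "?D (annulus t j) = C j" if "j \<in> {..<?n}" for j
    using the_inv_into_f_f[OF inj that] by simp
  have "prob (\<Inter>B\<in>annulus t ` {..<?n}. (\<lambda>\<omega>. card (\<Phi> \<omega> \<inter> B)) -` ?D B \<inter> space M) =
    (\<Prod>B\<in>annulus t ` {..<?n}. prob ((\<lambda>\<omega>. card (\<Phi> \<omega> \<inter> B)) -` ?D B \<inter> space M))"
    by (rule indep_varsD_finite[OF ind]) (auto simp: lessThan_empty_iff)
  also have "(\<Inter>B\<in>annulus t ` {..<?n}. (\<lambda>\<omega>. card (\<Phi> \<omega> \<inter> B)) -` ?D B \<inter> space M) =
    (\<Inter>j\<in>{..<?n}. (\<lambda>\<omega>. card (\<Phi> \<omega> \<inter> annulus t j)) -` C j \<inter> space M)"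
    unfolding image_image by (rule INF_cong[OF refl]) (simp only: inv)
  also have "(\<Prod>B\<in>annulus t ` {..<?n}. prob ((\<lambda>\<omega>. card (\<Phi> \<omega> \<inter> B)) -` ?D B \<inter> space M)) =
    (\<Prod>j<?n. prob ((\<lambda>\<omega>. card (\<Phi> \<omega> \<inter> annulus t j)) -` C j \<inter> space M))"
    unfolding prod.reindex[OF inj] o_def by (rule prod.cong[OF refl]) (simp only: inv)
  finally have indep: "prob (\<Inter>j\<in>{..<?n}. (\<lambda>\<omega>. card (\<Phi> \<omega> \<inter> annulus t j)) -` C j \<inter> space M) =
    (\<Prod>j<?n. prob ((\<lambda>\<omega>. card (\<Phi> \<omega> \<inter> annulus t j)) -` C j \<inter> space M))" .
  have count: "card (\<Phi> \<omega> \<inter> annulus t j) = card (\<Phi> \<omega> \<inter> cball 0 (t (Suc j))) - card (\<Phi> \<omega> \<inter> cball 0 (t j))"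
    if "\<omega> \<in> space M" "j < ?n" for \<omega> j
  proof -
    have "\<Phi> \<omega> \<inter> annulus t j = \<Phi> \<omega> \<inter> cball 0 (t (Suc j)) - \<Phi> \<omega> \<inter> cball 0 (t j)"
      by (auto simp: annulus_def)
    moreover have "finite (\<Phi> \<omega> \<inter> cball 0 (t j))"
      using \<Phi>_locally_finite[OF that(1)] by (simp add: locally_finite_sets_def)
    moreover have "\<Phi> \<omega> \<inter> cball 0 (t j) \<subseteq> \<Phi> \<omega> \<inter> cball 0 (t (Suc j))"
      using mono[OF that(2)] by auto
    ultimately show ?thesis by (simp only: card_Diff_subset)
  qed
  have ev: "(\<forall>i\<le>m. t (2 * i + 1) < dist_seq \<omega> i \<and> dist_seq \<omega> i \<le> t (2 * i + 2)) \<longleftrightarrow>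
      (\<forall>j<?n. card (\<Phi> \<omega> \<inter> annulus t j) \<in> C j)"
    if \<omega>: "\<omega> \<in> space M" and ex: "\<forall>i. \<exists>t. i \<le> card (\<Phi> \<omega> \<inter> cball 0 t)" for \<omega>
  proof -
    \<comment> \<open>\<open>min\<close> freezes the count beyond the last radius, which makes
      \<open>c\<close> monotone on all indices as \<open>counts_boxes_iff\<close> demands.\<close>
    define c where "c j = card (\<Phi> \<omega> \<inter> cball 0 (t (min j ?n)))" for j
    have le_iff: "dist_seq \<omega> i \<le> t j \<longleftrightarrow> Suc i \<le> c j" if "0 < j" "j \<le> ?n" for i j
      using ordered_dist_le_iff[OF \<Phi>_locally_finite[OF \<omega>] ex[rule_format], of "t j" "Suc i"]
        pos[of "j - 1"] that by (simp add: c_def)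
    have "(\<forall>i\<le>m. t (2 * i + 1) < dist_seq \<omega> i \<and> dist_seq \<omega> i \<le> t (2 * i + 2)) \<longleftrightarrow>
      (\<forall>i\<le>m. c (2 * i + 1) < Suc i \<and> Suc i \<le> c (2 * i + 2))"
    proof (intro all_cong)
      fix i assume "i \<le> m"
      then show "t (2 * i + 1) < dist_seq \<omega> i \<and> dist_seq \<omega> i \<le> t (2 * i + 2) \<longleftrightarrow>
          c (2 * i + 1) < Suc i \<and> Suc i \<le> c (2 * i + 2)"
        using le_iff[of "2 * i + 1" i] le_iff[of "2 * i + 2" i] by (simp, linarith)
    qed
    also have "\<dots> \<longleftrightarrow> (\<forall>j<?n. c (Suc j) - c j \<in> (if even j then {0} else if j = 2 * m + 1 then {1..} else {1}))"
    proof (rule counts_boxes_iff)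
      show "c j \<le> c (Suc j)" for j
        unfolding c_def by (intro card_cball_mono[OF \<Phi>_locally_finite[OF \<omega>]] mono') auto
      show "c 0 = 0" using t0 by (simp add: c_def)
    qed
    also have "\<dots> \<longleftrightarrow> (\<forall>j<?n. card (\<Phi> \<omega> \<inter> annulus t j) \<in> C j)"
      using \<omega> by (intro all_cong) (simp add: C_def count c_def)
    finally show ?thesis .
  qed
  have [measurable]: "(\<lambda>\<omega>. card (\<Phi> \<omega> \<inter> annulus t j)) \<in> measurable M (count_space UNIV)" for j
    by (rule measurable_count) fact+
  have p0: "prob ((\<lambda>\<omega>. card (\<Phi> \<omega> \<inter> annulus t j)) -` {k} \<inter> space M) =
     (u (Suc j) - u j) ^ k / fact k * exp (- (u (Suc j) - u j))" if "j < ?n" for j k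
  proof -
    have "(\<lambda>\<omega>. card (\<Phi> \<omega> \<inter> annulus t j)) -` {k} \<inter> space M = {\<omega> \<in> space M. card (\<Phi> \<omega> \<inter> annulus t j) = k}"
      by auto
    then show ?thesis using prob_count[OF bor, of j k] vol[OF that] by simp
  qed
  have p1: "prob ((\<lambda>\<omega>. card (\<Phi> \<omega> \<inter> annulus t j)) -` {1..} \<inter> space M) = 1 - exp (- (u (Suc j) - u j))"
    if "j < ?n" for j
  proof -
    have "(\<lambda>\<omega>. card (\<Phi> \<omega> \<inter> annulus t j)) -` {1..} \<inter> space M =
      space M - (\<lambda>\<omega>. card (\<Phi> \<omega> \<inter> annulus t j)) -` {0} \<inter> space M" by auto
    then show ?thesis using p0[OF that, of 0] by (simp add: prob_compl)
  qed
  have "prob {\<omega> \<in> space M. \<forall>i\<le>m. t (2 * i + 1) < dist_seq \<omega> i \<and> dist_seq \<omega> i \<le> t (2 * i + 2)} =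
    prob (\<Inter>j\<in>{..<?n}. (\<lambda>\<omega>. card (\<Phi> \<omega> \<inter> annulus t j)) -` C j \<inter> space M)"
  \<comment> \<open>The translation into counts presupposes infinitely many points, so the two
    events are compared almost surely.\<close>
  proof (rule measure_eq_AE)
    show "AE \<omega> in M. (\<omega> \<in> {\<omega> \<in> space M. \<forall>i\<le>m. t (2 * i + 1) < dist_seq \<omega> i \<and> dist_seq \<omega> i \<le> t (2 * i + 2)}) =
      (\<omega> \<in> (\<Inter>j\<in>{..<?n}. (\<lambda>\<omega>. card (\<Phi> \<omega> \<inter> annulus t j)) -` C j \<inter> space M))"
    proof (rule AE_mp[OF AE_infinitely_many], intro AE_I2 impI)
      fix \<omega> assume \<omega>: "\<omega> \<in> space M" and ex: "\<forall>i. \<exists>t. i \<le> card (\<Phi> \<omega> \<inter> cball 0 t)"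
      have "\<omega> \<in> (\<Inter>j\<in>{..<?n}. (\<lambda>\<omega>. card (\<Phi> \<omega> \<inter> annulus t j)) -` C j \<inter> space M) \<longleftrightarrow>
        (\<forall>j<?n. card (\<Phi> \<omega> \<inter> annulus t j) \<in> C j)"
        using \<omega> by auto
      then show "(\<omega> \<in> {\<omega> \<in> space M. \<forall>i\<le>m. t (2 * i + 1) < dist_seq \<omega> i \<and> dist_seq \<omega> i \<le> t (2 * i + 2)}) =
        (\<omega> \<in> (\<Inter>j\<in>{..<?n}. (\<lambda>\<omega>. card (\<Phi> \<omega> \<inter> annulus t j)) -` C j \<inter> space M))"
        using ev[OF \<omega> ex] \<omega> by simp
    qed
    have "{..<?n} \<noteq> {}" by (auto simp: lessThan_empty_iff)
    then show "(\<Inter>j\<in>{..<?n}. (\<lambda>\<omega>. card (\<Phi> \<omega> \<inter> annulus t j)) -` C j \<inter> space M) \<in> sets M"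
      by (intro sets.finite_INT) auto
  qed measurable
  also have "\<dots> = (\<Prod>j<?n. prob ((\<lambda>\<omega>. card (\<Phi> \<omega> \<inter> annulus t j)) -` C j \<inter> space M))"
    by (rule indep)
  also have "\<dots> = (\<Prod>j<2 * m. if even j then exp (- (u (Suc j) - u j))
      else (u (Suc j) - u j) * exp (- (u (Suc j) - u j))) *
      (exp (- (u (2 * m + 1) - u (2 * m))) * (1 - exp (- (u (2 * m + 2) - u (2 * m + 1)))))"
  proof -
    have "(\<Prod>j<2 * m. prob ((\<lambda>\<omega>. card (\<Phi> \<omega> \<inter> annulus t j)) -` C j \<inter> space M)) =
      (\<Prod>j<2 * m. if even j then exp (- (u (Suc j) - u j))
      else (u (Suc j) - u j) * exp (- (u (Suc j) - u j)))"
      by (intro prod.cong refl) (auto simp: C_def p0)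
    moreover have "prob ((\<lambda>\<omega>. card (\<Phi> \<omega> \<inter> annulus t (2 * m))) -` C (2 * m) \<inter> space M) =
        exp (- (u (2 * m + 1) - u (2 * m)))"
      by (simp add: C_def p0)
    moreover have "prob ((\<lambda>\<omega>. card (\<Phi> \<omega> \<inter> annulus t (2 * m + 1))) -` C (2 * m + 1) \<inter> space M) =
        1 - exp (- (u (2 * m + 2) - u (2 * m + 1)))"
      using p1[of "2 * m + 1"] by (simp add: C_def)
    ultimately show ?thesis by simp
  qed
  also have "\<dots> = (\<Prod>i<m. u (2 * i + 2) - u (2 * i + 1)) * (exp (- u (2 * m + 1)) - exp (- u (2 * m + 2)))"
    using t0 by (subst prod_exp_differences) (auto simp: u_def exp_diff exp_minus field_simps)
  also have "\<dots> = (\<Prod>i<m. lam * pi * (t (2 * i + 2))\<^sup>2 - lam * pi * (t (2 * i + 1))\<^sup>2) *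
    (exp (- (lam * pi * (t (2 * m + 1))\<^sup>2)) - exp (- (lam * pi * (t (2 * m + 2))\<^sup>2)))"
    using pos by (simp add: u_def max_def)
  finally show ?thesis .
qed

end

subsection \<open>The law of the ordered distances\<close>

abbreviation borel_product :: "'i set \<Rightarrow> ('i \<Rightarrow> real) measure" where
  "borel_product I \<equiv> PiM I (\<lambda>_. borel)"

definition increasing_seqs :: "nat \<Rightarrow> (nat \<Rightarrow> real) set" where
  "increasing_seqs m = {x \<in> extensional {..m}. 0 < x 0 \<and> (\<forall>i<m. x i < x (Suc i))}"

definition ordered_box :: "nat \<Rightarrow> (nat \<Rightarrow> real) \<Rightarrow> (nat \<Rightarrow> real) \<Rightarrow> (nat \<Rightarrow> real) set" where
  "ordered_box m a b = PiE {..m} (\<lambda>i. {a i<..b i})"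

text \<open>The strict gaps between consecutive sides put every box inside the increasing sequences.
  Leaving \<open>a i\<close> and \<open>b i\<close> unrelated admits empty boxes, which closes the
  family under intersection.\<close>

definition ordered_bounds :: "nat \<Rightarrow> (nat \<Rightarrow> real) \<Rightarrow> (nat \<Rightarrow> real) \<Rightarrow> bool" where
  "ordered_bounds m a b \<longleftrightarrow> (\<forall>i\<le>m. 0 \<le> a i) \<and> (\<forall>i<m. b i < a (Suc i))"

lemma ordered_box_subset: "ordered_bounds m a b \<Longrightarrow> ordered_box m a b \<subseteq> increasing_seqs m"
proof
  fix x assume bd: "ordered_bounds m a b" and x: "x \<in> ordered_box m a b"
  have ab: "a i < x i" "x i \<le> b i" if "i \<le> m" for i
    using x that by (auto simp: ordered_box_def)
  have "0 < x 0" using ab[of 0] bd by (auto simp: ordered_bounds_def intro: le_less_trans)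
  moreover have "x i < x (Suc i)" if "i < m" for i
    using ab[of i] ab[of "Suc i"] bd that by (force simp: ordered_bounds_def)
  ultimately show "x \<in> increasing_seqs m"
    using x by (auto simp: increasing_seqs_def ordered_box_def PiE_def)
qed

lemma sets_increasing_seqs [measurable]: "increasing_seqs m \<in> sets (borel_product {..m})"
proof -
  have "increasing_seqs m = {x \<in> space (borel_product {..m}). 0 < x 0 \<and> (\<forall>i\<in>{..<m}. x i < x (Suc i))}"
    by (auto simp: increasing_seqs_def space_PiM PiE_def)
  also have "\<dots> \<in> sets (borel_product {..m})" by measurable
  finally show ?thesis .
qed

lemma sets_ordered_box [measurable]: "ordered_box m a b \<in> sets (borel_product {..m})"
  unfolding ordered_box_def by (intro sets_PiM_I_finite) auto

text \<open>Rational ends, undefined beyond \<open>m\<close>, make the family countable, so unions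
  of such boxes are measurable.\<close>

definition rational_boxes :: "nat \<Rightarrow> ((nat \<Rightarrow> real) \<times> (nat \<Rightarrow> real)) set" where
  "rational_boxes m = {(a, b) \<in> PiE {..m} (\<lambda>_. \<rat>) \<times> PiE {..m} (\<lambda>_. \<rat>). ordered_bounds m a b}"

lemma countable_rational_boxes: "countable (rational_boxes m)"
proof (rule countable_subset)
  show "rational_boxes m \<subseteq> PiE {..m} (\<lambda>_. \<rat>) \<times> PiE {..m} (\<lambda>_. \<rat>)"
    by (auto simp: rational_boxes_def)
  show "countable (PiE {..m} (\<lambda>_. \<rat> :: real set) \<times> PiE {..m} (\<lambda>_. \<rat> :: real set))"
    by (intro countable_SIGMA countable_PiE) (auto simp: countable_rat)
qed

text \<open>Right ends are chosen first, each below both the bound and the next coordinate; then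
  left ends fit between a right end and the next coordinate. The free bounds \<open>U\<close> let
  boxes exhaust half-spaces.\<close>

lemma rational_box_exists:
  assumes x: "x \<in> increasing_seqs m" and U: "\<And>i. i \<le> m \<Longrightarrow> x i < U i"
  shows "\<exists>(a, b)\<in>rational_boxes m. x \<in> ordered_box m a b \<and> (\<forall>i\<le>m. b i < U i)"
proof -
  have inc: "x i < x (Suc i)" if "i < m" for i using x that by (auto simp: increasing_seqs_def)
  have "\<exists>q\<in>\<rat>. i \<le> m \<longrightarrow> x i < q \<and> q < U i \<and> (i < m \<longrightarrow> q < x (Suc i))" for i
  proof (cases "i \<le> m")
    case True
    then have "x i < min (U i) (if i < m then x (Suc i) else U i)" using U inc by auto
    from Rats_dense_in_real[OF this] show ?thesis using True by auto
  next
    case False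
    then show ?thesis by (auto intro: bexI[of _ 0])
  qed
  then obtain b where b: "\<And>i. b i \<in> \<rat>" "\<And>i. i \<le> m \<Longrightarrow> x i < b i" "\<And>i. i \<le> m \<Longrightarrow> b i < U i"
    "\<And>i. i < m \<Longrightarrow> b i < x (Suc i)"
    by (metis less_imp_le)
  have "\<exists>q\<in>\<rat>. i < m \<longrightarrow> b i < q \<and> q < x (Suc i)" for i
    using Rats_dense_in_real[OF b(4), of i] by (cases "i < m") (auto intro: bexI[of _ 0])
  then obtain a where a: "\<And>i. a i \<in> \<rat>" "\<And>i. i < m \<Longrightarrow> b i < a i" "\<And>i. i < m \<Longrightarrow> a i < x (Suc i)"
    by metis
  \<comment> \<open>\<open>a i\<close> was chosen below \<open>x (Suc i)\<close>, so the left ends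
    are shifted by one; the first box starts at 0.\<close>
  define a' where "a' i = (case i of 0 \<Rightarrow> 0 | Suc j \<Rightarrow> a j)" for i
  have xpos: "0 < x i" if "i \<le> m" for i
    using that
  proof (induction i)
    case 0
    then show ?case using x by (simp add: increasing_seqs_def)
  next
    case (Suc i)
    then show ?case using inc[of i] by simp
  qed
  have a'0: "0 \<le> a' i \<and> a' i < x i" if "i \<le> m" for i
  proof (cases i)
    case 0
    then show ?thesis using xpos that by (simp add: a'_def)
  next
    case (Suc j)
    then have "j < m" using that by simp
    then have "0 < x j" "x j < b j" "b j < a j" "a j < x i" using Suc xpos b a by auto
    then show ?thesis using Suc by (simp add: a'_def)
  qed
  have "(restrict a' {..m}, restrict b {..m}) \<in> rational_boxes m"
    unfolding rational_boxes_def ordered_bounds_def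
  proof (safe, goal_cases)
    case (1 i)
    then show ?case using a(1) by (cases i) (auto simp: a'_def)
  next
    case (3 i)
    then show ?case using b(1) by simp
  next
    case (5 i)
    then show ?case using a'0 by simp
  next
    case (6 i)
    then show ?case using a(2) by (simp add: a'_def)
  qed (auto split: if_splits)
  moreover have "x \<in> ordered_box m (restrict a' {..m}) (restrict b {..m})"
    unfolding ordered_box_def
  proof (rule PiE_I)
    fix i assume "i \<in> {..m}"
    then show "x i \<in> {restrict a' {..m} i<..restrict b {..m} i}"
      using a'0[of i] b(2)[of i] by simp
  next
    fix i assume "i \<notin> {..m}"
    then show "x i = undefined" using x by (auto simp: increasing_seqs_def extensional_def)
  qed
  moreover have "\<forall>i\<le>m. restrict b {..m} i < U i" using b(3) by simp
  ultimately show ?thesis by blast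
qed

text \<open>A half-space \<open>x i < t\<close>, cut to the increasing sequences, is a countable
  union of rational boxes. Hence the coordinates are measurable for the generated sigma-algebra, and
  with them the identity map into the product space.\<close>

lemma sets_increasing_seqs_generated:
  "sets (restrict_space (borel_product {..m}) (increasing_seqs m)) =
    sigma_sets (increasing_seqs m) {ordered_box m a b | a b. ordered_bounds m a b}"
    (is "?L = sigma_sets ?O ?E")
proof
  have sub: "?E \<subseteq> Pow ?O" using ordered_box_subset by auto
  show "sigma_sets ?O ?E \<subseteq> ?L"
  proof -
    have "sigma_sets (space (restrict_space (borel_product {..m}) ?O)) ?E \<subseteq> ?L"
      by (intro sets.sigma_sets_subset)
         (auto simp: sets_restrict_space_iff sets_increasing_seqs ordered_box_subset[THEN subsetD])
    moreover have "space (restrict_space (PiM {..m} (\<lambda>_. borel :: real measure)) ?O) = ?O"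
      using sets.sets_into_space[OF sets_increasing_seqs] by (auto simp: space_restrict_space)
    ultimately show ?thesis by simp
  qed
  let ?S = "sigma ?O ?E"
  have S: "space ?S = ?O" "sets ?S = sigma_sets ?O ?E" using sub by auto
  have comp: "(\<lambda>x. x i) \<in> borel_measurable ?S" if i: "i \<le> m" for i
  proof (subst borel_measurable_iff_less, intro allI)
    fix t
    let ?I = "{(a, b) \<in> rational_boxes m. b i < t}"
    have "{x \<in> ?O. x i < t} = (\<Union>(a, b)\<in>?I. ordered_box m a b)"
    proof (intro set_eqI iffI)
      fix x assume x: "x \<in> {x \<in> ?O. x i < t}"
      \<comment> \<open>The bound is \<open>t\<close> in coordinate \<open>i\<close> and an
        arbitrary larger number elsewhere.\<close>
      then have "\<exists>(a, b)\<in>rational_boxes m. x \<in> ordered_box m a b \<and> (\<forall>j\<le>m. b j < (if j = i then t else x j + 1))"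
        by (intro rational_box_exists) auto
      then obtain a b where ab: "(a, b) \<in> rational_boxes m" "x \<in> ordered_box m a b"
        "\<forall>j\<le>m. b j < (if j = i then t else x j + 1)" by blast
      then have "b i < t" using i by (metis (full_types))
      then show "x \<in> (\<Union>(a, b)\<in>?I. ordered_box m a b)" using ab by blast
    next
      fix x assume "x \<in> (\<Union>(a, b)\<in>?I. ordered_box m a b)"
      then obtain a b where ab: "(a, b) \<in> rational_boxes m" "b i < t" "x \<in> ordered_box m a b" by blast
      then have "x \<in> ?O" using ordered_box_subset[of m a b] by (auto simp: rational_boxes_def)
      moreover have "x i \<le> b i" using ab(3) i by (auto simp: ordered_box_def)
      ultimately show "x \<in> {x \<in> ?O. x i < t}" using ab(2) by simp
    qed
    also have "\<dots> \<in> sets ?S"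
    proof (rule sets.countable_UN'')
      show "countable ?I"
        by (rule countable_subset[OF _ countable_rational_boxes]) auto
      show "(case p of (a, b) \<Rightarrow> ordered_box m a b) \<in> sets ?S" if "p \<in> ?I" for p
        using that S(2) by (auto simp: rational_boxes_def)
    qed
    finally show "{x \<in> space ?S. x i < t} \<in> sets ?S" using S by simp
  qed
  have id: "(\<lambda>x. x) \<in> measurable ?S (borel_product {..m})"
  proof (rule measurable_PiM_single')
    show "(\<lambda>x i. x i) \<in> space ?S \<rightarrow> (\<Pi>\<^sub>E i\<in>{..m}. space borel)"
      using S by (auto simp: increasing_seqs_def PiE_def)
  qed (use comp in auto)
  show "?L \<subseteq> sigma_sets ?O ?E"
  proof
    fix A assume "A \<in> ?L"
    then obtain B where B: "B \<in> sets (borel_product {..m})" "A = ?O \<inter> B"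
      by (auto simp: sets_restrict_space)
    have "(\<lambda>x. x) -` B \<inter> space ?S \<in> sets ?S" using id B(1) by (rule measurable_sets)
    then show "A \<in> sigma_sets ?O ?E" using B S by (simp add: Int_commute)
  qed
qed

text \<open>Relative to the product of the radial intensities, the joint density of the
  \<open>m + 1\<close> smallest distances is a mere void probability: stations at
  \<open>x 0\<close>, ..., \<open>x m\<close> and no further one within radius
  \<open>x m\<close>.\<close>

definition ordered_density :: "real \<Rightarrow> nat \<Rightarrow> (nat \<Rightarrow> real) \<Rightarrow> ennreal" where
  "ordered_density lam m x = indicator (increasing_seqs m) x * ennreal (exp (- (lam * pi * (x m)\<^sup>2)))"

abbreviation radial_product :: "real \<Rightarrow> nat \<Rightarrow> (nat \<Rightarrow> real) measure" where
  "radial_product lam m \<equiv> PiM {..m} (\<lambda>_. radial_intensity lam)"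

lemma measurable_ordered_density [measurable]:
  "ordered_density lam m \<in> borel_measurable (borel_product {..m})"
  unfolding ordered_density_def by measurable

lemma sets_PiM_radial: "sets (PiM I (\<lambda>_. radial_intensity lam)) = sets (PiM I (\<lambda>_. borel))"
  by (intro sets_PiM_cong) auto

lemma measurable_PiM_radial:
  "f \<in> borel_measurable (PiM I (\<lambda>_. radial_intensity lam)) \<longleftrightarrow> f \<in> borel_measurable (PiM I (\<lambda>_. borel))"
  unfolding measurable_cong_sets[OF sets_PiM_radial refl] ..

lemma increasing_seqs_upd:
  assumes "x \<in> space (PiM {..m} (\<lambda>_. N))"
  shows "x(Suc m := y) \<in> increasing_seqs (Suc m) \<longleftrightarrow> x \<in> increasing_seqs m \<and> x m < y"
  using assms
  by (auto simp: increasing_seqs_def space_PiM PiE_def extensional_def less_Suc_eq)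

interpretation radial: product_sigma_finite "\<lambda>_::nat. radial_intensity lam"
  by (simp add: product_sigma_finite_def sigma_finite_radial_intensity)

text \<open>Factoring \<open>exp (- (lam * pi * y\<^sup>2))\<close> through the value at
  \<open>x m\<close> splits off the density for one station fewer. What remains is the transition
  kernel of the chain: the annulus between \<open>x m\<close> and \<open>y\<close> is void and a
  station sits at \<open>y\<close>.\<close>

lemma nn_integral_ordered_density_Suc:
  assumes f: "f \<in> borel_measurable (borel_product {..Suc m})"
  shows "(\<integral>\<^sup>+x. ordered_density lam (Suc m) x * f x \<partial>radial_product lam (Suc m)) =
    (\<integral>\<^sup>+x. ordered_density lam m x *
      (\<integral>\<^sup>+y. indicator {x m<..} y * ennreal (exp (lam * pi * (x m)\<^sup>2 - lam * pi * y\<^sup>2)) * f (x(Suc m := y))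
        \<partial>radial_intensity lam) \<partial>radial_product lam m)"
proof -
  have "(\<integral>\<^sup>+x. ordered_density lam (Suc m) x * f x \<partial>PiM (insert (Suc m) {..m}) (\<lambda>_. radial_intensity lam)) =
    (\<integral>\<^sup>+x. (\<integral>\<^sup>+y. ordered_density lam (Suc m) (x(Suc m := y)) * f (x(Suc m := y))
        \<partial>radial_intensity lam) \<partial>radial_product lam m)"
    using f by (intro radial.product_nn_integral_insert)
       (auto simp: measurable_PiM_radial atMost_Suc[symmetric])
  also have "\<dots> = (\<integral>\<^sup>+x. ordered_density lam m x *
      (\<integral>\<^sup>+y. indicator {x m<..} y * ennreal (exp (lam * pi * (x m)\<^sup>2 - lam * pi * y\<^sup>2)) * f (x(Suc m := y))
        \<partial>radial_intensity lam) \<partial>radial_product lam m)"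
  proof (rule nn_integral_cong)
    fix x assume x: "x \<in> space (radial_product lam m)"
    have [measurable]: "(\<lambda>y. f (x(Suc m := y))) \<in> borel_measurable borel"
    proof -
      have "(\<lambda>y. x(Suc m := y)) \<in> measurable borel (PiM (insert (Suc m) {..m}) (\<lambda>_. borel))"
        using x by (intro measurable_component_update) (auto simp: space_PiM)
      then show ?thesis using f by (simp add: atMost_Suc)
    qed
    have "(\<integral>\<^sup>+y. ordered_density lam (Suc m) (x(Suc m := y)) * f (x(Suc m := y)) \<partial>radial_intensity lam) =
      (\<integral>\<^sup>+y. ordered_density lam m x * (indicator {x m<..} y * ennreal (exp (lam * pi * (x m)\<^sup>2 - lam * pi * y\<^sup>2))
         * f (x(Suc m := y))) \<partial>radial_intensity lam)"
    proof (intro nn_integral_cong)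
      fix y
      have "ennreal (exp (- (lam * pi * y\<^sup>2))) =
        ennreal (exp (- (lam * pi * (x m)\<^sup>2))) * ennreal (exp (lam * pi * (x m)\<^sup>2 - lam * pi * y\<^sup>2))"
        by (simp add: ennreal_mult''[symmetric] mult_exp_exp)
      then show "ordered_density lam (Suc m) (x(Suc m := y)) * f (x(Suc m := y)) =
        ordered_density lam m x * (indicator {x m<..} y * ennreal (exp (lam * pi * (x m)\<^sup>2 - lam * pi * y\<^sup>2))
         * f (x(Suc m := y)))"
        using increasing_seqs_upd[OF x, of y]
        by (auto simp: ordered_density_def mult_ac split: split_indicator)
    qed
    also have "\<dots> = ordered_density lam m x *
      (\<integral>\<^sup>+y. indicator {x m<..} y * ennreal (exp (lam * pi * (x m)\<^sup>2 - lam * pi * y\<^sup>2)) * f (x(Suc m := y))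
        \<partial>radial_intensity lam)"
      by (intro nn_integral_cmult) measurable
    finally show "(\<integral>\<^sup>+y. ordered_density lam (Suc m) (x(Suc m := y)) * f (x(Suc m := y)) \<partial>radial_intensity lam) =
      ordered_density lam m x *
      (\<integral>\<^sup>+y. indicator {x m<..} y * ennreal (exp (lam * pi * (x m)\<^sup>2 - lam * pi * y\<^sup>2)) * f (x(Suc m := y))
        \<partial>radial_intensity lam)" .
  qed
  finally show ?thesis by (simp add: atMost_Suc)
qed

text \<open>The kernel is the derivative of
  \<open>- exp (lam * pi * a\<^sup>2 - lam * pi * y\<^sup>2)\<close>, which rises from -1 to 0: from
  every radius there is almost surely a next station.\<close>

lemma nn_integral_exp_tail:
  assumes "0 \<le> a" "lam > 0"
  shows "(\<integral>\<^sup>+y. indicator {a<..} y * ennreal (exp (lam * pi * a\<^sup>2 - lam * pi * y\<^sup>2)) \<partial>radial_intensity lam) = 1"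
proof -
  have "(\<integral>\<^sup>+y. indicator {a<..} y * ennreal (exp (lam * pi * a\<^sup>2 - lam * pi * y\<^sup>2)) \<partial>radial_intensity lam) =
    (\<integral>\<^sup>+y. ennreal (2 * pi * lam * y * exp (lam * pi * a\<^sup>2 - lam * pi * y\<^sup>2)) * indicator {a..} y \<partial>lborel)"
    by (subst nn_integral_radial_intensity, simp, rule nn_integral_cong_AE,
        rule AE_mp[OF AE_lborel_singleton[of a]])
       (auto intro!: AE_I2 split: split_indicator simp: ennreal_mult'')
  also have "\<dots> = ennreal (0 - (- exp (lam * pi * a\<^sup>2 - lam * pi * a\<^sup>2)))"
  proof (rule nn_integral_FTC_atLeast[where F = "\<lambda>y. - exp (lam * pi * a\<^sup>2 - lam * pi * y\<^sup>2)"])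
    show "((\<lambda>y. - exp (lam * pi * a\<^sup>2 - lam * pi * y\<^sup>2)) \<longlongrightarrow> 0) at_top"
      using assms by real_asymp
  qed (use assms in \<open>auto intro!: derivative_eq_intros\<close>)
  finally show ?thesis by simp
qed

text \<open>Each further coordinate integrates to one by \<open>nn_integral_exp_tail\<close>. Full
  mass on the increasing sequences is what later forces the law of the distances to live
  there.\<close>

lemma nn_integral_ordered_density:
  assumes "lam > 0"
  shows "(\<integral>\<^sup>+x. ordered_density lam m x \<partial>radial_product lam m) = 1"
proof (induction m)
  case 0
  have "(\<integral>\<^sup>+x. ordered_density lam 0 x \<partial>PiM {..0} (\<lambda>_. radial_intensity lam)) =
    (\<integral>\<^sup>+x. indicator {0<..} (x 0) * ennreal (exp (lam * pi * 0\<^sup>2 - lam * pi * (x 0)\<^sup>2)) \<partial>PiM {0::nat} (\<lambda>_. radial_intensity lam))"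
    unfolding atMost_0
    by (intro nn_integral_cong)
       (auto simp: ordered_density_def increasing_seqs_def space_PiM PiE_def split: split_indicator)
  also have "\<dots> = (\<integral>\<^sup>+y. indicator {0<..} y * ennreal (exp (lam * pi * 0\<^sup>2 - lam * pi * y\<^sup>2)) \<partial>radial_intensity lam)"
    by (rule radial.product_nn_integral_singleton) measurable
  finally show ?case using nn_integral_exp_tail[of 0 lam] assms by simp
next
  case (Suc m)
  have "(\<integral>\<^sup>+x. ordered_density lam (Suc m) x * 1 \<partial>radial_product lam (Suc m)) =
    (\<integral>\<^sup>+x. ordered_density lam m x *
      (\<integral>\<^sup>+y. indicator {x m<..} y * ennreal (exp (lam * pi * (x m)\<^sup>2 - lam * pi * y\<^sup>2)) * 1
        \<partial>radial_intensity lam) \<partial>radial_product lam m)"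
    by (rule nn_integral_ordered_density_Suc) auto
  also have "\<dots> = (\<integral>\<^sup>+x. ordered_density lam m x \<partial>radial_product lam m)"
  proof (rule nn_integral_cong)
    fix x
    have "0 \<le> x m" if x: "x \<in> increasing_seqs m"
    proof -
      have "0 < x i" if "i \<le> m" for i
        using that x
      proof (induction i)
        case (Suc i)
        then have "x i < x (Suc i)" by (simp add: increasing_seqs_def)
        then show ?case using Suc by simp
      qed (simp add: increasing_seqs_def)
      then show ?thesis by (simp add: less_imp_le)
    qed
    then show "ordered_density lam m x *
      (\<integral>\<^sup>+y. indicator {x m<..} y * ennreal (exp (lam * pi * (x m)\<^sup>2 - lam * pi * y\<^sup>2)) * 1
        \<partial>radial_intensity lam) = ordered_density lam m x"
      using nn_integral_exp_tail[of "x m" lam] assms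
      by (auto simp: ordered_density_def split: split_indicator)
  qed
  finally show ?case using Suc by simp
qed


text \<open>On an ordered box the ordering constraint holds automatically, so the integrand is a
  product over the coordinates, with an exponential in the last one only. The value is the one found
  in \<open>prob_boxes\<close>.\<close>

lemma emeasure_ordered_density_box:
  assumes bd: "ordered_bounds m a b" and ab: "\<And>i. i \<le> m \<Longrightarrow> a i < b i" and lam: "lam > 0"
  shows "emeasure (density (radial_product lam m) (ordered_density lam m)) (ordered_box m a b) =
    ennreal ((\<Prod>i<m. lam * pi * (b i)\<^sup>2 - lam * pi * (a i)\<^sup>2) *
    (exp (- (lam * pi * (a m)\<^sup>2)) - exp (- (lam * pi * (b m)\<^sup>2))))"
proof -
  let ?f = "\<lambda>i y. indicator {a i<..b i} y * (if i = m then ennreal (exp (- (lam * pi * y\<^sup>2))) else 1)"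
  have a0: "0 \<le> a i" if "i \<le> m" for i using bd that by (simp add: ordered_bounds_def)
  have "emeasure (density (radial_product lam m) (ordered_density lam m)) (ordered_box m a b) =
    (\<integral>\<^sup>+x. ordered_density lam m x * indicator (ordered_box m a b) x \<partial>radial_product lam m)"
    by (rule emeasure_density) (simp_all add: measurable_PiM_radial sets_PiM_radial measurable_ordered_density sets_ordered_box)
  also have "\<dots> = (\<integral>\<^sup>+x. (\<Prod>i\<in>{..m}. ?f i (x i)) \<partial>radial_product lam m)"
  proof (rule nn_integral_cong)
    fix x assume x: "x \<in> space (radial_product lam m)"
    have "(\<Prod>i\<in>{..m}. ?f i (x i)) = (\<Prod>i\<in>{..m}. indicator {a i<..b i} (x i)) * (\<Prod>i\<in>{..m}. if i = m then ennreal (exp (- (lam * pi * (x i)\<^sup>2))) else 1)"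
      by (rule prod.distrib)
    also have "(\<Prod>i\<in>{..m}. if i = m then ennreal (exp (- (lam * pi * (x i)\<^sup>2))) else 1) = ennreal (exp (- (lam * pi * (x m)\<^sup>2)))"
      by simp
    also have "(\<Prod>i\<in>{..m}. indicator {a i<..b i} (x i) :: ennreal) = indicator (ordered_box m a b) x"
    proof (cases "x \<in> ordered_box m a b")
      case True
      then show ?thesis by (auto simp: ordered_box_def PiE_iff intro!: prod.neutral)
    next
      case False
      then obtain i where "i \<le> m" "x i \<notin> {a i<..b i}"
        using x by (auto simp: ordered_box_def space_PiM PiE_iff)
      then have "(\<Prod>i\<in>{..m}. indicator {a i<..b i} (x i) :: ennreal) = 0"
        by (intro prod_zero bexI[of _ i]) auto
      then show ?thesis using False by simp
    qed
    finally show "ordered_density lam m x * indicator (ordered_box m a b) x = (\<Prod>i\<in>{..m}. ?f i (x i))"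
      using ordered_box_subset[OF bd] by (auto simp: ordered_density_def split: split_indicator)
  qed
  also have "\<dots> = (\<Prod>i\<in>{..m}. \<integral>\<^sup>+y. ?f i y \<partial>radial_intensity lam)"
    by (rule radial.product_nn_integral_prod) auto
  also have "\<dots> = (\<Prod>i<m. \<integral>\<^sup>+y. ?f i y \<partial>radial_intensity lam) * (\<integral>\<^sup>+y. ?f m y \<partial>radial_intensity lam)"
    by (simp add: lessThan_Suc_atMost[symmetric] mult.commute)
  also have "(\<Prod>i<m. \<integral>\<^sup>+y. ?f i y \<partial>radial_intensity lam) = (\<Prod>i<m. ennreal (lam * pi * (b i)\<^sup>2 - lam * pi * (a i)\<^sup>2))"
    using a0 ab lam by (intro prod.cong refl) (simp add: emeasure_radial_intensity less_imp_le)
  also have "(\<integral>\<^sup>+y. ?f m y \<partial>radial_intensity lam) = ennreal (exp (- (lam * pi * (a m)\<^sup>2)) - exp (- (lam * pi * (b m)\<^sup>2)))"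
    using a0 ab lam by (subst nn_integral_exp_radial_intensity[symmetric]) (auto simp: less_imp_le mult.commute)
  also have "(\<Prod>i<m. ennreal (lam * pi * (b i)\<^sup>2 - lam * pi * (a i)\<^sup>2)) = ennreal (\<Prod>i<m. lam * pi * (b i)\<^sup>2 - lam * pi * (a i)\<^sup>2)"
    using a0 ab lam by (intro prod_ennreal) (simp add: power_mono less_imp_le)
  finally show ?thesis
    using a0 ab lam by (subst ennreal_mult) (auto intro!: prod_nonneg simp: power_mono less_imp_le)
qed

context poisson_network
begin

lemma measurable_dist_seq [measurable]: "(\<lambda>\<omega>. dist_seq \<omega> i) \<in> borel_measurable M"
  by (rule measurable_compose[OF \<Phi>_measurable measurable_ordered_dist])

abbreviation nearest :: "nat \<Rightarrow> 'w \<Rightarrow> nat \<Rightarrow> real" where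
  "nearest m \<omega> \<equiv> restrict (dist_seq \<omega>) {..m}"

lemma measurable_restrict_dist_seq [measurable]:
  "(\<lambda>\<omega>. restrict (dist_seq \<omega>) I) \<in> measurable M (PiM I (\<lambda>_. borel))"
  by (rule measurable_restrict) (rule measurable_dist_seq)

text \<open>Ordered boxes generate only the trace on the increasing sequences, so uniqueness of
  measures gives equality there. The density already has mass one on that set, hence so does the
  law, and the equality extends to the whole product space.\<close>

lemma distr_dist_seq:
  "distr M (borel_product {..m}) (\<lambda>\<omega>. nearest m \<omega>) =
    density (radial_product lam m) (ordered_density lam m)" (is "?P = ?Q")
proof -
  let ?O = "increasing_seqs m"
  let ?E = "{ordered_box m a b | a b. ordered_bounds m a b}"
  let ?X = "\<lambda>\<omega>. nearest m \<omega>"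
  have setsQ: "sets ?Q = sets (borel_product {..m})" by (simp add: sets_PiM_radial)
  then have spaceQ: "space ?Q = space (PiM {..m} (\<lambda>_. borel :: real measure))" by (rule sets_eq_imp_space_eq)
  interpret P: prob_space ?P by (rule prob_space_distr) measurable
  have box: "emeasure ?P (ordered_box m a b) = emeasure ?Q (ordered_box m a b)"
    if bd: "ordered_bounds m a b" for a b
  proof (cases "\<forall>i\<le>m. a i < b i")
    case False
    then have "ordered_box m a b = {}" by (auto simp: ordered_box_def PiE_eq_empty_iff)
    then show ?thesis by simp
  next
    case ab: True
    \<comment> \<open>The interleaving of the ends that \<open>prob_boxes\<close> expects, with -1
      as the negative start.\<close>
    define t where "t j = (if j = 0 then - 1 else if odd j then a (j div 2) else b (j div 2 - 1))" for j
    have t_odd: "t (2 * i + 1) = a i" and t_even: "t (2 * i + 2) = b i" for i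
      by (simp_all add: t_def)
    have "t j < t (Suc j)" if j: "j < 2 * m + 2" for j
    proof (cases "even j")
      case True
      then obtain i where i: "j = 2 * i" by (auto elim: evenE)
      show ?thesis
      proof (cases i)
        case 0
        then show ?thesis using bd i t_odd[of 0] by (simp add: t_def[of 0] ordered_bounds_def less_le_trans[of "-1" 0])
      next
        case (Suc k)
        then show ?thesis using bd i t_odd[of i] t_even[of k] j by (simp add: ordered_bounds_def)
      qed
    next
      case False
      then obtain i where "j = 2 * i + 1" by (auto elim: oddE)
      then show ?thesis using ab t_odd[of i] t_even[of i] j by simp
    qed
    moreover have "t 0 < 0" "0 \<le> t 1" using bd t_odd[of 0] by (simp_all add: t_def[of 0] ordered_bounds_def)
    ultimately have prob: "prob {\<omega> \<in> space M. \<forall>i\<le>m. a i < dist_seq \<omega> i \<and> dist_seq \<omega> i \<le> b i} =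
      (\<Prod>i<m. lam * pi * (b i)\<^sup>2 - lam * pi * (a i)\<^sup>2) *
      (exp (- (lam * pi * (a m)\<^sup>2)) - exp (- (lam * pi * (b m)\<^sup>2)))"
      using prob_boxes[of m t] unfolding t_odd t_even by simp
    have "emeasure ?P (ordered_box m a b) = emeasure M (?X -` ordered_box m a b \<inter> space M)"
      by (rule emeasure_distr) measurable
    also have "?X -` ordered_box m a b \<inter> space M = {\<omega> \<in> space M. \<forall>i\<le>m. a i < dist_seq \<omega> i \<and> dist_seq \<omega> i \<le> b i}"
      by (auto simp: ordered_box_def PiE_iff)
    also have "emeasure M \<dots> = emeasure ?Q (ordered_box m a b)"
      using ab by (simp add: emeasure_eq_measure prob emeasure_ordered_density_box[OF bd _ lam_pos])
    finally show ?thesis .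
  qed
  have restr: "restrict_space ?P ?O = restrict_space ?Q ?O"
  proof (rule measure_eqI_generator_eq_countable)
    show "Int_stable ?E"
    proof (rule Int_stableI, clarify)
      fix a b a' b' assume "ordered_bounds m a b" "ordered_bounds m a' b'"
      then have "ordered_bounds m (\<lambda>i. max (a i) (a' i)) (\<lambda>i. min (b i) (b' i))"
        by (auto simp: ordered_bounds_def)
      moreover have "ordered_box m a b \<inter> ordered_box m a' b' = ordered_box m (\<lambda>i. max (a i) (a' i)) (\<lambda>i. min (b i) (b' i))"
        by (simp add: ordered_box_def PiE_Int)
      ultimately show "\<exists>a'' b''. ordered_box m a b \<inter> ordered_box m a' b' = ordered_box m a'' b'' \<and> ordered_bounds m a'' b''"
        by blast
    qed
    show "?E \<subseteq> Pow ?O" using ordered_box_subset by auto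
    show "emeasure (restrict_space ?P ?O) X = emeasure (restrict_space ?Q ?O) X" if "X \<in> ?E" for X
      using that ordered_box_subset box
      by (auto simp: emeasure_restrict_space setsQ sets_increasing_seqs Int_absorb2
          sets.sets_into_space[OF sets_increasing_seqs] spaceQ sets_PiM_radial)
    show "sets (restrict_space ?P ?O) = sigma_sets ?O ?E"
      using sets_increasing_seqs_generated[of m] by (simp add: sets_restrict_space)
    show "sets (restrict_space ?Q ?O) = sigma_sets ?O ?E"
      using sets_increasing_seqs_generated[of m] by (simp add: sets_restrict_space sets_PiM_radial)
    show "(\<lambda>(a, b). ordered_box m a b) ` rational_boxes m \<subseteq> ?E"
      by (auto simp: rational_boxes_def)
    show "countable ((\<lambda>(a, b). ordered_box m a b) ` rational_boxes m)"
      by (intro countable_image countable_rational_boxes)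
    show "\<Union>((\<lambda>(a, b). ordered_box m a b) ` rational_boxes m) = ?O"
    proof (intro equalityI subsetI)
      fix x assume x: "x \<in> ?O"
      have "\<exists>(a, b)\<in>rational_boxes m. x \<in> ordered_box m a b \<and> (\<forall>j\<le>m. b j < x j + 1)"
        by (rule rational_box_exists[OF x]) simp
      then show "x \<in> \<Union>((\<lambda>(a, b). ordered_box m a b) ` rational_boxes m)" by blast
    next
      fix x assume "x \<in> \<Union>((\<lambda>(a, b). ordered_box m a b) ` rational_boxes m)"
      then show "x \<in> ?O" using ordered_box_subset by (fastforce simp: rational_boxes_def)
    qed
    show "emeasure (restrict_space ?P ?O) A \<noteq> \<infinity>"
      if "A \<in> (\<lambda>(a, b). ordered_box m a b) ` rational_boxes m" for A
      using that ordered_box_subset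
      by (auto simp: emeasure_restrict_space sets_increasing_seqs P.emeasure_eq_measure rational_boxes_def
          sets.sets_into_space[OF sets_increasing_seqs] Int_absorb2)
  qed
  have onO: "emeasure ?P (A \<inter> ?O) = emeasure ?Q (A \<inter> ?O)" if A: "A \<in> sets (borel_product {..m})" for A
  proof -
    have "emeasure (restrict_space ?P ?O) (A \<inter> ?O) = emeasure (restrict_space ?Q ?O) (A \<inter> ?O)"
      by (simp only: restr)
    then show ?thesis
      using A by (simp add: emeasure_restrict_space setsQ sets_increasing_seqs spaceQ
          sets.sets_into_space[OF sets_increasing_seqs] sets_PiM_radial)
  qed
  have emQ: "emeasure ?Q B = (\<integral>\<^sup>+x. ordered_density lam m x * indicator B x \<partial>radial_product lam m)"
    if "B \<in> sets (borel_product {..m})" for B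
    using that by (intro emeasure_density) (simp_all add: measurable_PiM_radial sets_PiM_radial measurable_ordered_density)
  have QO: "emeasure ?Q A = emeasure ?Q (A \<inter> ?O)" if A: "A \<in> sets (borel_product {..m})" for A
    using A sets_increasing_seqs[of m]
    by (auto intro!: nn_integral_cong simp: emQ ordered_density_def split: split_indicator)
  have Q1: "emeasure ?Q (space (borel_product {..m})) = 1"
    unfolding emQ[OF sets.top] nn_integral_ordered_density[OF lam_pos, of m, symmetric]
    using spaceQ by (intro nn_integral_cong) (simp split: split_indicator)
  have "emeasure ?P ?O = 1"
    using onO[of "space (borel_product {..m})"] QO[of "space (borel_product {..m})"] Q1
      sets.sets_into_space[OF sets_increasing_seqs, of m] by (simp add: Int_absorb1)
  then have "AE x in ?P. x \<in> ?O"
    by (intro P.AE_prob_1) (simp add: P.emeasure_eq_measure)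
  then have PO: "emeasure ?P A = emeasure ?P (A \<inter> ?O)" if A: "A \<in> sets (borel_product {..m})" for A
    using A by (intro emeasure_eq_AE) (auto simp: sets_increasing_seqs)
  show ?thesis
  proof (rule measure_eqI)
    fix A assume "A \<in> sets ?P"
    then have A: "A \<in> sets (borel_product {..m})" by simp
    show "emeasure ?P A = emeasure ?Q A"
      by (simp only: PO[OF A] QO[OF A] onO[OF A])
  qed (simp add: sets_PiM_radial)
qed

lemma nn_integral_dist_seq:
  assumes "f \<in> borel_measurable (borel_product {..m})"
  shows "(\<integral>\<^sup>+\<omega>. f (nearest m \<omega>) \<partial>M) =
    (\<integral>\<^sup>+x. ordered_density lam m x * f x \<partial>radial_product lam m)"
proof -
  have "(\<integral>\<^sup>+\<omega>. f (nearest m \<omega>) \<partial>M) =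
    (\<integral>\<^sup>+x. f x \<partial>distr M (borel_product {..m}) (\<lambda>\<omega>. nearest m \<omega>))"
    using assms by (subst nn_integral_distr) auto
  also have "\<dots> = (\<integral>\<^sup>+x. ordered_density lam m x * f x \<partial>radial_product lam m)"
    unfolding distr_dist_seq using assms
    by (subst nn_integral_density) (auto simp: measurable_PiM_radial measurable_ordered_density)
  finally show ?thesis .
qed

text \<open>The Markov property: the conditional law of the next distance depends on the past only
  through \<open>dist_seq \<omega> m\<close>. The density of the first \<open>m + 1\<close>
  distances is folded back into an expectation, so later arguments can work with the kernel
  alone.\<close>

lemma nn_integral_dist_seq_markov:
  assumes f: "f \<in> borel_measurable (borel_product {..Suc m})"
  shows "(\<integral>\<^sup>+\<omega>. f (nearest (Suc m) \<omega>) \<partial>M) =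
    (\<integral>\<^sup>+\<omega>. (\<integral>\<^sup>+y. indicator {dist_seq \<omega> m<..} y *
        ennreal (exp (lam * pi * (dist_seq \<omega> m)\<^sup>2 - lam * pi * y\<^sup>2)) *
        f ((nearest m \<omega>)(Suc m := y)) \<partial>radial_intensity lam) \<partial>M)"
proof -
  have [measurable]: "(\<lambda>(x, y). f (x(Suc m := y))) \<in> borel_measurable (borel_product {..m} \<Otimes>\<^sub>M borel)"
  proof -
    have "(\<lambda>(x, y). x(Suc m := y)) \<in> measurable (borel_product {..m} \<Otimes>\<^sub>M borel) (PiM (insert (Suc m) {..m}) (\<lambda>_. borel))"
      by (rule measurable_add_dim)
    then show ?thesis using f measurable_compose[of "\<lambda>(x, y). x(Suc m := y)" _ _ f]
      by (simp add: atMost_Suc split_beta')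
  qed
  \<comment> \<open>The set \<open>{x m<..}\<close> varies with \<open>x\<close>, so joint
    measurability is shown for the condition \<open>x m < y\<close> on the pair and then carried
    over to the indicator.\<close>
  have "(\<lambda>(x, y). (if x m < y then 1 else 0) * ennreal (exp (lam * pi * (x m)\<^sup>2 - lam * pi * y\<^sup>2)) * f (x(Suc m := y)))
    \<in> borel_measurable (borel_product {..m} \<Otimes>\<^sub>M borel)"
    by measurable
  also have "(\<lambda>(x, y). (if x m < y then 1 else 0) * ennreal (exp (lam * pi * (x m)\<^sup>2 - lam * pi * y\<^sup>2)) * f (x(Suc m := y))) =
    (\<lambda>(x, y). indicator {x m<..} y * ennreal (exp (lam * pi * (x m)\<^sup>2 - lam * pi * y\<^sup>2)) * f (x(Suc m := y)))"
    by (auto simp: fun_eq_iff split: split_indicator)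
  also have "borel_measurable (borel_product {..m} \<Otimes>\<^sub>M borel) =
    (borel_measurable (borel_product {..m} \<Otimes>\<^sub>M radial_intensity lam) :: ((nat \<Rightarrow> real) \<times> real \<Rightarrow> ennreal) set)"
    by (intro measurable_cong_sets sets_pair_measure_cong) simp_all
  finally have meas: "(\<lambda>(x, y). indicator {x m<..} y * ennreal (exp (lam * pi * (x m)\<^sup>2 - lam * pi * y\<^sup>2)) * f (x(Suc m := y)))
    \<in> borel_measurable (borel_product {..m} \<Otimes>\<^sub>M radial_intensity lam)" .
  have "(\<integral>\<^sup>+\<omega>. f (nearest (Suc m) \<omega>) \<partial>M) =
    (\<integral>\<^sup>+x. ordered_density lam m x *
      (\<integral>\<^sup>+y. indicator {x m<..} y * ennreal (exp (lam * pi * (x m)\<^sup>2 - lam * pi * y\<^sup>2)) * f (x(Suc m := y))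
        \<partial>radial_intensity lam) \<partial>radial_product lam m)"
    by (simp add: nn_integral_dist_seq[OF f] nn_integral_ordered_density_Suc[OF f])
  also have "\<dots> = (\<integral>\<^sup>+\<omega>. (\<lambda>x. \<integral>\<^sup>+y. indicator {x m<..} y * ennreal (exp (lam * pi * (x m)\<^sup>2 - lam * pi * y\<^sup>2)) * f (x(Suc m := y))
        \<partial>radial_intensity lam) (nearest m \<omega>) \<partial>M)"
    by (rule nn_integral_dist_seq[symmetric])
       (rule sigma_finite_measure.borel_measurable_nn_integral[OF sigma_finite_radial_intensity meas])
  finally show ?thesis by simp
qed

end

subsection \<open>The interference exponent\<close>

text \<open>For positive \<open>a\<close> and \<open>z\<close> this is \<open>z\<close> times the
  Gauss function 2F1(1, a; a + 1; - z powr (1 / a)).\<close>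

definition power_kernel :: "real \<Rightarrow> real \<Rightarrow> real" where
  "power_kernel a z = integral {0..z} (\<lambda>t. 1 / (1 + t powr (1 / a)))"

lemma power_kernel_continuous:
  fixes a z :: real
  assumes "a > 0"
  shows "continuous_on {0..z} (\<lambda>t. 1 / (1 + t powr (1 / a)))"
proof -
  have "1 + t powr (1 / a) \<noteq> 0" for t :: real
    using powr_ge_zero[of t "1 / a"] by linarith
  then show ?thesis
    using assms by (intro continuous_intros continuous_on_powr') auto
qed

lemma power_kernel_integrable:
  "(a :: real) > 0 \<Longrightarrow> (\<lambda>t. 1 / (1 + t powr (1 / a))) integrable_on {0..z}"
  by (intro integrable_continuous_real power_kernel_continuous)

lemma power_kernel_mono: "a > 0 \<Longrightarrow> mono (power_kernel a)"
  unfolding power_kernel_def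
  by (intro monoI integral_subset_le power_kernel_integrable) auto

lemma power_kernel_nonneg: "a > 0 \<Longrightarrow> 0 \<le> power_kernel a z"
  unfolding power_kernel_def by (intro integral_nonneg power_kernel_integrable) auto

lemma power_kernel_le:
  assumes "a > 0" "0 \<le> z"
  shows "power_kernel a z \<le> z"
proof -
  have le1: "1 / (1 + t powr (1 / a)) \<le> 1" for t :: real
    by (subst divide_le_eq_1_pos) (auto intro: add_pos_nonneg)
  have "power_kernel a z \<le> integral {0..z} (\<lambda>_. 1)"
    unfolding power_kernel_def
    using assms le1 by (intro integral_le power_kernel_integrable) auto
  then show ?thesis using assms by simp
qed

lemma has_real_derivative_power_kernel:
  assumes "a > 0" "z > 0"
  shows "(power_kernel a has_real_derivative 1 / (1 + z powr (1 / a))) (at z)"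
proof -
  have "(power_kernel a has_real_derivative 1 / (1 + z powr (1 / a))) (at z within {0..z + 1})"
    unfolding power_kernel_def[abs_def]
    using assms by (intro integral_has_real_derivative power_kernel_continuous) auto
  moreover have "at z within {0..z + 1} = at z"
    using assms by (intro at_within_interior) simp
  ultimately show ?thesis by simp
qed

lemma borel_measurable_power_kernel [measurable]:
  "a > 0 \<Longrightarrow> power_kernel a \<in> borel_measurable borel"
  by (intro borel_measurable_mono power_kernel_mono)

text \<open>The substitution \<open>t = q powr a * u\<close>; the integral over the unit interval is
  Euler's representation of the Gauss function.\<close>

lemma power_kernel_scaling:
  assumes "a > 0" "q > 0"
  shows "power_kernel a (q powr a) = q powr a * integral {0..1} (\<lambda>u. 1 / (1 + q * u powr (1 / a)))"
proof -
  define m where "m = q powr a"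
  have m: "m > 0" using assms by (simp add: m_def)
  have "((\<lambda>t. 1 / (1 + t powr (1 / a))) has_integral power_kernel a m) {0..m}"
    unfolding power_kernel_def using power_kernel_integrable[OF assms(1)] by (simp add: has_integral_integral)
  from has_integral_stretch_real[OF this, of m]
  have "((\<lambda>u. 1 / (1 + (m * u) powr (1 / a))) has_integral power_kernel a m / m) {0..1}"
    using m by (simp add: image_divide_atLeastAtMost)
  then have "((\<lambda>u. 1 / (1 + q * u powr (1 / a))) has_integral power_kernel a m / m) {0..1}"
  proof (rule has_integral_eq[rotated])
    fix u :: real assume "u \<in> {0..1}"
    then show "1 / (1 + (m * u) powr (1 / a)) = 1 / (1 + q * u powr (1 / a))"
      using assms by (simp add: m_def powr_mult powr_powr)
  qed
  then show ?thesis using m by (simp add: m_def integral_unique)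
qed

text \<open>\<open>1 / 2\<close> is the value of \<open>1 - 2 / \<eta>\<close> at
  \<open>\<eta> = 4\<close>, where the integrand becomes \<open>1 / (1 + t powr 2)\<close>.\<close>

lemma power_kernel_arctan:
  assumes "0 \<le> z"
  shows "power_kernel (1 / 2) z = arctan z"
proof -
  have "((\<lambda>t. 1 / (1 + t powr 2)) has_integral arctan z - arctan 0) {0..z}"
    using assms
    by (intro fundamental_theorem_of_calculus)
       (auto intro!: derivative_eq_intros simp: has_real_derivative_iff_has_vector_derivative[symmetric] field_simps)
  then show ?thesis by (simp add: power_kernel_def integral_unique)
qed

text \<open>
  The exponent \<open>\<integral>\<^sub>x\<^sup>\<infinity> c v\<^sup>-\<^sup>\<eta> / (1 + c v\<^sup>-\<^sup>\<eta>) 2\<pi>\<lambda>v dv\<close> after the substitution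
  \<open>t = c\<^sup>a v\<^sup>2\<^sup>-\<^sup>\<eta>\<close> with \<open>a = 1 - 2/\<eta>\<close>.
\<close>
definition interference_exponent :: "real \<Rightarrow> real \<Rightarrow> real \<Rightarrow> real \<Rightarrow> real" where
  "interference_exponent lam \<eta> c x =
    2 * pi * lam / (\<eta> - 2) * (c powr (2 / \<eta>) * power_kernel (1 - 2 / \<eta>) (c powr (1 - 2 / \<eta>) * x powr (2 - \<eta>)))"

context
  fixes lam \<eta> :: real
  assumes lam: "lam > 0" and eta: "\<eta> > 2"
begin

lemma exponent_pos: "0 < 1 - 2 / \<eta>"
  using eta by (simp add: field_simps)

lemma borel_measurable_interference_exponent [measurable (raw)]:
  assumes [measurable]: "c \<in> borel_measurable N" "x \<in> borel_measurable N"
  shows "(\<lambda>\<omega>. interference_exponent lam \<eta> (c \<omega>) (x \<omega>)) \<in> borel_measurable N"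
proof -
  note borel_measurable_power_kernel[OF exponent_pos, measurable]
  show ?thesis unfolding interference_exponent_def by measurable
qed

lemma interference_exponent_nonneg: "0 \<le> interference_exponent lam \<eta> c x"
  using lam eta power_kernel_nonneg[OF exponent_pos] by (simp add: interference_exponent_def)

text \<open>The kernel is at most its argument, and the exponents \<open>2 / \<eta>\<close> and
  \<open>1 - 2 / \<eta>\<close> of \<open>c\<close> add up to one. The bound is linear in
  \<open>c\<close> and decays in \<open>x\<close>; it gives H the limit 1 both for vanishing
  \<open>c\<close> and for growing distance.\<close>

lemma interference_exponent_le:
  assumes "0 \<le> c"
  shows "interference_exponent lam \<eta> c x \<le> 2 * pi * lam / (\<eta> - 2) * (c * x powr (2 - \<eta>))"
proof -
  have "c powr (2 / \<eta>) * power_kernel (1 - 2 / \<eta>) (c powr (1 - 2 / \<eta>) * x powr (2 - \<eta>)) \<le>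
    c powr (2 / \<eta>) * (c powr (1 - 2 / \<eta>) * x powr (2 - \<eta>))"
    by (intro mult_left_mono power_kernel_le exponent_pos) auto
  also have "\<dots> = c powr (2 / \<eta> + (1 - 2 / \<eta>)) * x powr (2 - \<eta>)"
    by (simp only: powr_add mult.assoc)
  also have "\<dots> = c * x powr (2 - \<eta>)" using assms by simp
  finally show ?thesis
    unfolding interference_exponent_def using lam eta by (intro mult_left_mono) auto
qed

text \<open>By the chain rule, with \<open>z powr (1 / a) = c * x powr (- \<eta>)\<close>, the
  powers of \<open>c\<close> recombine to \<open>c\<close> and the derivative is minus the integrand
  of the intended tail integral.\<close>

lemma has_real_derivative_interference_exponent:
  assumes c: "0 \<le> c" and x: "0 < x"
  shows "(interference_exponent lam \<eta> c has_real_derivative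
    - (2 * pi * lam * x * (c * x powr (- \<eta>) / (1 + c * x powr (- \<eta>))))) (at x)"
\<comment> \<open>For \<open>c = 0\<close> the argument of \<open>power_kernel\<close> sits at the
  endpoint 0, where no derivative is available, but the exponent vanishes identically.\<close>
proof (cases "c = 0")
  case True
  then have "interference_exponent lam \<eta> c = (\<lambda>_. 0)"
    by (simp add: interference_exponent_def fun_eq_iff)
  then show ?thesis using True by simp
next
  case False
  define a where "a = 1 - 2 / \<eta>"
  have a: "a > 0" using exponent_pos by (simp add: a_def)
  have c: "c > 0" using c False by simp
  define z where "z = c powr a * x powr (2 - \<eta>)"
  have z: "z > 0" using c x by (simp add: z_def)
  have "((\<lambda>x. c powr a * x powr (2 - \<eta>)) has_real_derivative c powr a * ((2 - \<eta>) * x powr (1 - \<eta>))) (at x)"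
    using x by (auto intro!: derivative_eq_intros)
  from DERIV_chain2[OF _ this, of "power_kernel a" "1 / (1 + z powr (1 / a))"]
  have "((\<lambda>x. power_kernel a (c powr a * x powr (2 - \<eta>))) has_real_derivative
     1 / (1 + z powr (1 / a)) * (c powr a * ((2 - \<eta>) * x powr (1 - \<eta>)))) (at x)"
    using has_real_derivative_power_kernel[OF a z] by (simp add: z_def)
  from DERIV_cmult[OF DERIV_cmult[OF this, of "c powr (2 / \<eta>)"], of "2 * pi * lam / (\<eta> - 2)"]
  have "(interference_exponent lam \<eta> c has_real_derivative 2 * pi * lam / (\<eta> - 2) *
     (c powr (2 / \<eta>) * (1 / (1 + z powr (1 / a)) * (c powr a * ((2 - \<eta>) * x powr (1 - \<eta>)))))) (at x)"
    by (simp add: interference_exponent_def[abs_def] a_def)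
  also have "z powr (1 / a) = c * x powr (- \<eta>)"
  proof -
    have "(2 - \<eta>) / a = - \<eta>" using eta by (simp add: a_def field_simps)
    then show ?thesis using c x a by (simp add: z_def powr_mult powr_powr)
  qed
  also have "2 * pi * lam / (\<eta> - 2) *
     (c powr (2 / \<eta>) * (1 / (1 + c * x powr (- \<eta>)) * (c powr a * ((2 - \<eta>) * x powr (1 - \<eta>))))) =
    (2 * pi * lam * ((2 - \<eta>) / (\<eta> - 2))) * (c powr (2 / \<eta>) * c powr a) * x powr (1 - \<eta>) / (1 + c * x powr (- \<eta>))"
    by simp
  also have "c powr (2 / \<eta>) * c powr a = c"
    using c by (simp add: a_def powr_add[symmetric])
  also have "(2 - \<eta>) / (\<eta> - 2) = - 1" using eta by (simp add: field_simps)
  also have "x powr (1 - \<eta>) = x * x powr (- \<eta>)" using x by (simp add: powr_mult_base)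
  finally show ?thesis by (simp add: mult_ac)
qed

text \<open>The heart of the martingale property. Differentiating
  \<open>exp (lam * pi * x\<^sup>2 - lam * pi * y\<^sup>2)\<close> times H(y) produces the factor
  \<open>1 - c y^-\<eta> / (1 + c y^-\<eta>)\<close>, which is exactly the fading factor
  \<open>1 / (1 + c y^-\<eta>)\<close>; so the integrand has an explicit antiderivative.\<close>

lemma interference_exponent_tail_integral:
  assumes c: "0 \<le> c" and x: "0 < x"
  shows "(\<integral>\<^sup>+y. indicator {x<..} y * ennreal (exp (lam * pi * x\<^sup>2 - lam * pi * y\<^sup>2)) *
      (ennreal (1 / (1 + c * y powr (- \<eta>))) * ennreal (exp (- interference_exponent lam \<eta> c y))) \<partial>radial_intensity lam) =
    ennreal (exp (- interference_exponent lam \<eta> c x))"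
proof -
  let ?D = "interference_exponent lam \<eta> c"
  let ?F = "\<lambda>y. - exp (lam * pi * x\<^sup>2 - lam * pi * y\<^sup>2 - ?D y)"
  let ?f = "\<lambda>y. 2 * pi * lam * y * exp (lam * pi * x\<^sup>2 - lam * pi * y\<^sup>2 - ?D y) * (1 / (1 + c * y powr (- \<eta>)))"
  have pos: "0 < 1 + c * y powr (- \<eta>)" for y
    using c by (intro add_pos_nonneg) auto
  have "(\<integral>\<^sup>+y. indicator {x<..} y * ennreal (exp (lam * pi * x\<^sup>2 - lam * pi * y\<^sup>2)) *
      (ennreal (1 / (1 + c * y powr (- \<eta>))) * ennreal (exp (- ?D y))) \<partial>radial_intensity lam) =
    (\<integral>\<^sup>+y. ennreal (2 * pi * lam * y) * (indicator {x<..} y * ennreal (exp (lam * pi * x\<^sup>2 - lam * pi * y\<^sup>2)) *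
      (ennreal (1 / (1 + c * y powr (- \<eta>))) * ennreal (exp (- ?D y)))) \<partial>lborel)"
    by (rule nn_integral_radial_intensity) measurable
  also have "\<dots> = (\<integral>\<^sup>+y. ennreal (?f y) * indicator {x..} y \<partial>lborel)"
  proof (rule nn_integral_cong_AE, rule AE_mp[OF AE_lborel_singleton[of x]], intro AE_I2 impI)
    fix y :: real assume "y \<noteq> x"
    show "ennreal (2 * pi * lam * y) * (indicator {x<..} y * ennreal (exp (lam * pi * x\<^sup>2 - lam * pi * y\<^sup>2)) *
      (ennreal (1 / (1 + c * y powr (- \<eta>))) * ennreal (exp (- ?D y)))) = ennreal (?f y) * indicator {x..} y"
    proof (cases "x < y")
      case True
      have "exp (lam * pi * x\<^sup>2 - lam * pi * y\<^sup>2 - ?D y) = exp (lam * pi * x\<^sup>2 - lam * pi * y\<^sup>2) * exp (- ?D y)"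
        by (simp add: mult_exp_exp)
      then have f: "?f y = 2 * pi * lam * y * (exp (lam * pi * x\<^sup>2 - lam * pi * y\<^sup>2) * (1 / (1 + c * y powr (- \<eta>)) * exp (- ?D y)))"
        by simp
      have k: "0 \<le> 1 / (1 + c * y powr (- \<eta>))" using pos[of y] by simp
      have "ennreal A * (ennreal B * (ennreal C * ennreal E)) = ennreal (A * (B * (C * E)))"
        if "0 \<le> B" "0 \<le> C" "0 \<le> E" for A B C E
        using that by (simp add: ennreal_mult'')
      from this[OF exp_ge_zero k exp_ge_zero] show ?thesis using True unfolding f by simp
    qed (use \<open>y \<noteq> x\<close> in auto)
  qed
  also have "\<dots> = ennreal (0 - ?F x)"
  proof (rule nn_integral_FTC_atLeast[where F = ?F])
    fix y assume "x \<le> y"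
    then have y: "0 < y" using x by simp
    have "((\<lambda>y. lam * pi * x\<^sup>2 - lam * pi * y\<^sup>2 - ?D y) has_real_derivative
      (0 - lam * pi * (2 * y) - (- (2 * pi * lam * y * (c * y powr (- \<eta>) / (1 + c * y powr (- \<eta>))))))) (at y)"
      by (intro DERIV_diff has_real_derivative_interference_exponent c y) (auto intro!: derivative_eq_intros)
    from DERIV_minus[OF DERIV_chain2[OF DERIV_exp this]]
    have "(?F has_real_derivative - (exp (lam * pi * x\<^sup>2 - lam * pi * y\<^sup>2 - ?D y) *
      (0 - lam * pi * (2 * y) - (- (2 * pi * lam * y * (c * y powr (- \<eta>) / (1 + c * y powr (- \<eta>)))))))) (at y)"
      .
    also have "- (exp (lam * pi * x\<^sup>2 - lam * pi * y\<^sup>2 - ?D y) *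
      (0 - lam * pi * (2 * y) - (- (2 * pi * lam * y * (c * y powr (- \<eta>) / (1 + c * y powr (- \<eta>))))))) =
      2 * pi * lam * y * exp (lam * pi * x\<^sup>2 - lam * pi * y\<^sup>2 - ?D y) * (1 - c * y powr (- \<eta>) / (1 + c * y powr (- \<eta>)))"
      by (simp add: algebra_simps)
    also have "1 - c * y powr (- \<eta>) / (1 + c * y powr (- \<eta>)) = 1 / (1 + c * y powr (- \<eta>))"
      using pos[of y] by (simp add: field_simps)
    finally show "(?F has_real_derivative ?f y) (at y)" .
    show "0 \<le> ?f y" using y lam pos[of y] by (simp add: less_imp_le)
  next
    \<comment> \<open>The exponent is nonnegative, so the antiderivative is squeezed by the Gaussian
      factor alone.\<close>
    show "(?F \<longlongrightarrow> 0) at_top"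
    proof (rule tendsto_sandwich)
      show "((\<lambda>y. - exp (lam * pi * x\<^sup>2 - lam * pi * y\<^sup>2)) \<longlongrightarrow> 0) at_top"
        using lam by real_asymp
      show "\<forall>\<^sub>F y in at_top. - exp (lam * pi * x\<^sup>2 - lam * pi * y\<^sup>2) \<le> ?F y"
        using interference_exponent_nonneg by simp
    qed auto
  qed measurable
  finally show ?thesis by simp
qed

text \<open>The substitution \<open>t = w powr (1 - \<eta> / 2)\<close> carries the tail onto a
  bounded interval at 0. It is performed through the antiderivative \<open>?F\<close>, which
  vanishes at infinity because \<open>power_kernel\<close> is at most its argument.\<close>

lemma set_integral_power_tail:
  assumes z: "0 < z"
  shows "(LBINT w:{z<..}. 1 / (1 + w powr (\<eta> / 2))) = 2 / (\<eta> - 2) * power_kernel (1 - 2 / \<eta>) (z powr (1 - \<eta> / 2))"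
proof -
  define a where "a = 1 - 2 / \<eta>"
  have a: "a > 0" using exponent_pos by (simp add: a_def)
  let ?F = "\<lambda>w. - (2 / (\<eta> - 2) * power_kernel a (w powr (1 - \<eta> / 2)))"
  have pos: "0 < 1 + w powr (\<eta> / 2)" for w by (intro add_pos_nonneg) auto
  have "(LBINT w:{z<..}. 1 / (1 + w powr (\<eta> / 2))) =
    enn2real (\<integral>\<^sup>+w. ennreal (indicator {z<..} w *\<^sub>R (1 / (1 + w powr (\<eta> / 2)))) \<partial>lborel)"
    unfolding set_lebesgue_integral_def
    by (intro integral_eq_nn_integral) (auto simp: less_imp_le[OF pos])
  also have "(\<integral>\<^sup>+w. ennreal (indicator {z<..} w *\<^sub>R (1 / (1 + w powr (\<eta> / 2)))) \<partial>lborel) =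
    (\<integral>\<^sup>+w. ennreal (1 / (1 + w powr (\<eta> / 2))) * indicator {z..} w \<partial>lborel)"
    by (rule nn_integral_cong_AE, rule AE_mp[OF AE_lborel_singleton[of z]])
       (auto intro!: AE_I2 split: split_indicator)
  also have "\<dots> = ennreal (0 - ?F z)"
  proof (rule nn_integral_FTC_atLeast[where F = ?F])
    fix w assume "z \<le> w"
    then have w: "0 < w" using z by simp
    have "((\<lambda>w. w powr (1 - \<eta> / 2)) has_real_derivative (1 - \<eta> / 2) * w powr (- (\<eta> / 2))) (at w)"
      using w by (auto intro!: derivative_eq_intros)
    from DERIV_chain2[OF has_real_derivative_power_kernel[OF a] this]
    have "((\<lambda>w. power_kernel a (w powr (1 - \<eta> / 2))) has_real_derivative
      1 / (1 + (w powr (1 - \<eta> / 2)) powr (1 / a)) * ((1 - \<eta> / 2) * w powr (- (\<eta> / 2)))) (at w)"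
      using w by simp
    from DERIV_minus[OF DERIV_cmult[OF this, of "2 / (\<eta> - 2)"]]
    have "(?F has_real_derivative - (2 / (\<eta> - 2) *
      (1 / (1 + (w powr (1 - \<eta> / 2)) powr (1 / a)) * ((1 - \<eta> / 2) * w powr (- (\<eta> / 2)))))) (at w)"
      by simp
    also have "(w powr (1 - \<eta> / 2)) powr (1 / a) = w powr (- (\<eta> / 2))"
    proof -
      have "(1 - \<eta> / 2) / a = - (\<eta> / 2)" using eta by (simp add: a_def field_simps)
      then show ?thesis by (simp add: powr_powr)
    qed
    also have "- (2 / (\<eta> - 2) * (1 / (1 + w powr (- (\<eta> / 2))) * ((1 - \<eta> / 2) * w powr (- (\<eta> / 2))))) =
      - (2 / (\<eta> - 2) * (1 - \<eta> / 2)) * (w powr (- (\<eta> / 2)) / (1 + w powr (- (\<eta> / 2))))"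
      by simp
    also have "- (2 / (\<eta> - 2) * (1 - \<eta> / 2)) = 1" using eta by (simp add: field_simps)
    also have "w powr (- (\<eta> / 2)) / (1 + w powr (- (\<eta> / 2))) = 1 / (1 + w powr (\<eta> / 2))"
      using w pos[of w] by (simp add: powr_minus field_simps)
    finally show "(?F has_real_derivative 1 / (1 + w powr (\<eta> / 2))) (at w)" by simp
    show "0 \<le> 1 / (1 + w powr (\<eta> / 2))" using pos[of w] by simp
  next
    show "(?F \<longlongrightarrow> 0) at_top"
    proof (rule tendsto_sandwich)
      show "((\<lambda>w. - (2 / (\<eta> - 2) * w powr (1 - \<eta> / 2))) \<longlongrightarrow> 0) at_top"
        using eta by real_asymp
      show "\<forall>\<^sub>F w in at_top. - (2 / (\<eta> - 2) * w powr (1 - \<eta> / 2)) \<le> ?F w"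
        using eta power_kernel_le[OF a] by (auto intro!: always_eventually mult_left_mono divide_right_mono)
      show "\<forall>\<^sub>F w in at_top. ?F w \<le> 0"
        using eta power_kernel_nonneg[OF a] by (auto intro!: always_eventually)
    qed auto
  qed measurable
  finally show ?thesis
    using eta power_kernel_nonneg[OF a] by (simp add: a_def)
qed

text \<open>Measuring \<open>c\<close> in units of \<open>x powr \<eta>\<close> makes the argument
  of \<open>power_kernel\<close> free of \<open>x\<close>, because
  \<open>\<eta> * (1 - 2 / \<eta>) = \<eta> - 2\<close>. The remaining prefactor contributes
  \<open>x\<^sup>2\<close>.\<close>

lemma interference_exponent_eq_hypergeometric_integral:
  assumes q: "0 < q" and x: "0 < x"
  shows "interference_exponent lam \<eta> (q * x powr \<eta>) x =
    pi * lam * x\<^sup>2 * (2 * q / (\<eta> - 2) * integral {0..1} (\<lambda>u. 1 / (1 + q * u powr (1 / (1 - 2 / \<eta>)))))"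
proof -
  define a where "a = 1 - 2 / \<eta>"
  have a: "a > 0" using exponent_pos by (simp add: a_def)
  have "(q * x powr \<eta>) powr a * x powr (2 - \<eta>) = q powr a * x powr (\<eta> * a + (2 - \<eta>))"
    using q x by (simp add: powr_mult powr_powr powr_add)
  also have "\<eta> * a + (2 - \<eta>) = 0" using eta by (simp add: a_def field_simps)
  finally have 1: "(q * x powr \<eta>) powr a * x powr (2 - \<eta>) = q powr a" using x by simp
  have 2: "(q * x powr \<eta>) powr (2 / \<eta>) = q powr (2 / \<eta>) * x\<^sup>2"
    using q x eta by (simp add: powr_mult powr_powr powr_numeral)
  have 3: "q powr (2 / \<eta>) * q powr a = q"
    using q by (simp add: a_def powr_add[symmetric])
  have "interference_exponent lam \<eta> (q * x powr \<eta>) x =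
    2 * pi * lam / (\<eta> - 2) * (q powr (2 / \<eta>) * x\<^sup>2 * (q powr a * integral {0..1} (\<lambda>u. 1 / (1 + q * u powr (1 / a)))))"
    using 1 2 power_kernel_scaling[OF a q] by (simp add: interference_exponent_def a_def)
  also have "\<dots> = 2 * pi * lam / (\<eta> - 2) * x\<^sup>2 * (q powr (2 / \<eta>) * q powr a) * integral {0..1} (\<lambda>u. 1 / (1 + q * u powr (1 / a)))"
    by (simp add: mult_ac)
  finally show ?thesis unfolding 3 by (simp add: a_def mult_ac)
qed

lemma interference_exponent_eq_power_tail:
  assumes T: "0 < T" and x: "0 < x"
  shows "interference_exponent lam \<eta> (T * x powr \<eta>) x =
    pi * lam * x\<^sup>2 * (T powr (2 / \<eta>) * (LBINT w:{T powr (- 2 / \<eta>)<..}. 1 / (1 + w powr (\<eta> / 2))))"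
proof -
  define a where "a = 1 - 2 / \<eta>"
  have "(T * x powr \<eta>) powr a * x powr (2 - \<eta>) = T powr a * x powr (\<eta> * a + (2 - \<eta>))"
    using T x by (simp add: powr_mult powr_powr powr_add)
  also have "\<eta> * a + (2 - \<eta>) = 0" using eta by (simp add: a_def field_simps)
  finally have 1: "(T * x powr \<eta>) powr a * x powr (2 - \<eta>) = T powr a" using x by simp
  have 2: "(T * x powr \<eta>) powr (2 / \<eta>) = T powr (2 / \<eta>) * x\<^sup>2"
    using T x eta by (simp add: powr_mult powr_powr powr_numeral)
  \<comment> \<open>This identity is where the lower limit \<open>T powr (- 2 / \<eta>)\<close>
    comes from: the substitution behind \<open>set_integral_power_tail\<close> sends it to
    \<open>T powr a\<close>.\<close>
  have "(- 2 / \<eta>) * (1 - \<eta> / 2) = a" using eta by (simp add: a_def field_simps)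
  then have "(T powr (- 2 / \<eta>)) powr (1 - \<eta> / 2) = T powr a" by (simp add: powr_powr)
  then show ?thesis
    using 1 2 set_integral_power_tail[of "T powr (- 2 / \<eta>)"] T
    by (simp add: interference_exponent_def a_def mult_ac)
qed

end

subsection \<open>The hypergeometric function\<close>

lemma open_slit_plane: "open slit_plane"
  unfolding slit_plane_def
  by (intro open_Compl closed_injective_linear_image)
     (auto intro: bounded_linear.linear bounded_linear_of_real injI)

lemma slit_plane_denominator:
  assumes z: "z \<in> slit_plane" and w: "0 \<le> w" "w \<le> 1"
  shows "1 - z * of_real w \<noteq> 0"
proof
  assume eq: "1 - z * of_real w = 0"
  then have "w \<noteq> 0" by auto
  then have "z = of_real (1 / w)" using eq by (simp add: field_simps)
  moreover have "1 / w \<in> {1..}" using \<open>w \<noteq> 0\<close> w by simp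
  ultimately show False using z unfolding slit_plane_def by blast
qed

text \<open>Euler's integral with parameters 1, a, a + 1, after the change of variable that absorbs
  the weight \<open>a * t powr (a - 1)\<close>. Differentiation under the integral sign is done on a
  ball inside the slit plane, where the denominator cannot vanish.\<close>

lemma hypergeometric_integral_holomorphic:
  assumes a: "a > 0"
  shows "(\<lambda>z. integral (cbox 0 1) (\<lambda>u. 1 / (1 - z * of_real (u powr (1 / a))))) holomorphic_on slit_plane"
proof (rule holomorphic_onI)
  let ?w = "\<lambda>u::real. u powr (1 / a)"
  fix z0 assume "z0 \<in> slit_plane"
  then obtain r where r: "r > 0" "ball z0 r \<subseteq> slit_plane"
    using open_slit_plane openE by blast
  have w: "0 \<le> ?w u" "?w u \<le> 1" if "u \<in> cbox 0 1" for u
    using that a by (auto intro!: powr_le1)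
  have nz: "1 - z * of_real (?w u) \<noteq> 0" if "z \<in> ball z0 r" "u \<in> cbox 0 1" for z u
    using slit_plane_denominator[of z "?w u"] w[OF that(2)] that(1) r by blast
  have contw: "continuous_on S (\<lambda>x. of_real (?w (f x)) :: complex)"
    if "continuous_on S f" "f ` S \<subseteq> cbox 0 1" for S :: "'b::topological_space set" and f
    using that a by (intro continuous_intros continuous_on_powr') auto
  have "(\<lambda>z. integral (cbox 0 1) (\<lambda>u. 1 / (1 - z * of_real (?w u)))) holomorphic_on ball z0 r"
  proof (rule leibniz_rule_holomorphic[where fx = "\<lambda>z u. of_real (?w u) / (1 - z * of_real (?w u))\<^sup>2"])
    fix z and u :: real assume zu: "z \<in> ball z0 r" "u \<in> cbox 0 1"
    show "((\<lambda>z. 1 / (1 - z * of_real (?w u))) has_field_derivative of_real (?w u) / (1 - z * of_real (?w u))\<^sup>2) (at z within ball z0 r)"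
      using nz[OF zu] by (auto intro!: derivative_eq_intros simp: power2_eq_square)
  next
    fix z assume z: "z \<in> ball z0 r"
    show "(\<lambda>u. 1 / (1 - z * of_real (?w u))) integrable_on cbox 0 1"
      using nz[OF z] by (intro integrable_continuous continuous_intros contw) auto
  next
    show "continuous_on (ball z0 r \<times> cbox 0 1) (\<lambda>(z, u). of_real (?w u) / (1 - z * of_real (?w u))\<^sup>2)"
      unfolding split_beta' using nz by (intro continuous_intros contw) auto
  qed auto
  then have "(\<lambda>z. integral (cbox 0 1) (\<lambda>u. 1 / (1 - z * of_real (?w u)))) field_differentiable at z0"
    using r by (intro holomorphic_on_imp_differentiable_at[of _ "ball z0 r"]) auto
  then show "(\<lambda>z. integral (cbox 0 1) (\<lambda>u. 1 / (1 - z * of_real (?w u)))) field_differentiable at z0 within slit_plane"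
    by (rule field_differentiable_at_within)
qed

text \<open>In the disc the geometric series converges uniformly in \<open>u\<close>, so it may be
  integrated term by term. The integral of \<open>u powr (i / a)\<close> is
  \<open>a / (a + i)\<close>, the quotient of the Pochhammer symbols of \<open>a\<close> and
  \<open>a + 1\<close>, while that of 1 cancels the factorial.\<close>

lemma hypergeometric_integral_series:
  fixes z :: complex
  assumes a: "a > 0" and z: "z \<in> ball 0 1"
  shows "integral (cbox 0 1) (\<lambda>u. 1 / (1 - z * of_real (u powr (1 / a)))) =
    eval_fps (fps_hypergeo [1, of_real a] [of_real (a + 1)] 1) z"
proof -
  let ?w = "\<lambda>u::real. u powr (1 / a)"
  have w: "0 \<le> ?w u" "?w u \<le> 1" if "u \<in> {0..1}" for u
    using that a by (auto intro!: powr_le1)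
  have z1: "norm z < 1" using z by simp
  have nw: "norm (z * of_real (?w u)) \<le> norm z" if "u \<in> {0..1}" for u
    using w[OF that] by (auto simp: norm_mult intro!: mult_left_le)
  have "uniform_limit {0..1} (\<lambda>n u. \<Sum>i<n. (z * of_real (?w u)) ^ i) (\<lambda>u. \<Sum>i. (z * of_real (?w u)) ^ i) sequentially"
    using z1 nw by (intro Weierstrass_m_test[of _ _ "\<lambda>i. norm z ^ i"])
      (auto simp: norm_power intro!: power_mono summable_geometric)
  then have ul: "uniform_limit {0..1} (\<lambda>n u. \<Sum>i<n. (z * of_real (?w u)) ^ i) (\<lambda>u. 1 / (1 - z * of_real (?w u))) sequentially"
  proof (rule uniform_limit_cong'[THEN iffD1, rotated 2])
    show "(\<Sum>i. (z * of_real (?w u)) ^ i) = 1 / (1 - z * of_real (?w u))" if "u \<in> {0..1}" for u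
      by (rule suminf_geometric[OF le_less_trans[OF nw[OF that] z1]])
  qed auto
  have cont: "continuous_on {0..1} (\<lambda>u. \<Sum>i<n. (z * of_real (?w u)) ^ i)" for n
    using a by (intro continuous_intros continuous_on_powr') auto
  obtain I J where IJ: "\<And>n. ((\<lambda>u. \<Sum>i<n. (z * of_real (?w u)) ^ i) has_integral I n) {0..1}"
    "((\<lambda>u. 1 / (1 - z * of_real (?w u))) has_integral J) {0..1}" "I \<longlonglongrightarrow> J"
    using uniform_limit_integral[OF ul cont] by auto
  have powers: "((\<lambda>u. (z * of_real (?w u)) ^ i) has_integral of_real (a / (a + i)) * z ^ i) {0..1}" for i
  proof -
    have "((\<lambda>u. u powr (real i / a)) has_integral 1 powr (real i / a + 1) / (real i / a + 1)) {0..1}"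
      using a by (intro has_integral_powr_from_0) (auto intro: order_less_le_trans[of "-1" 0])
    then have "((\<lambda>u. u powr (real i / a)) has_integral a / (a + i)) {0..1}"
      using a by (simp add: field_simps)
    then have "((\<lambda>u. of_real (u powr (real i / a)) * z ^ i) has_integral of_real (a / (a + i)) * z ^ i) {0..1}"
      by (intro has_integral_mult_left has_integral_of_real)
    then show ?thesis
    \<comment> \<open>For \<open>i = 0\<close> the two sides differ at \<open>u = 0\<close>, where
      the ordinary power is 1 and \<open>0 powr 0\<close> is 0; the point is discarded.\<close>
    proof (rule has_integral_spike_finite[of "{0}", rotated 2])
      fix u assume "u \<in> {0..1} - {0::real}"
      then have "u > 0" by auto
      then have "?w u ^ i = u powr (real i / a)"
        by (simp add: powr_realpow[symmetric] powr_powr)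
      then show "(z * of_real (?w u)) ^ i = of_real (u powr (real i / a)) * z ^ i"
        by (simp add: power_mult_distrib mult.commute flip: of_real_power)
    qed auto
  qed
  have "I n = (\<Sum>i<n. of_real (a / (a + i)) * z ^ i)" for n
    using IJ(1)[of n] has_integral_sum[of "{..<n}" "\<lambda>i u. (z * of_real (?w u)) ^ i" "\<lambda>i. of_real (a / (a + i)) * z ^ i" "{0..1}"]
      powers by (auto intro: has_integral_unique)
  then have "I = (\<lambda>n. \<Sum>i<n. of_real (a / (a + i)) * z ^ i)" by (rule ext)
  then have "(\<lambda>i. of_real (a / (a + i)) * z ^ i) sums J"
    using IJ(3) by (simp only: sums_def)
  moreover have "fps_nth (fps_hypergeo [1, of_real a] [of_real (a + 1)] 1) i = (of_real (a / (a + i)) :: complex)" for i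
  proof -
    have rec: "pochhammer (of_real a :: complex) i * (of_real a + of_nat i) = of_real a * pochhammer (of_real (a + 1)) i"
      using pochhammer_Suc[of "of_real a :: complex" i] pochhammer_rec[of "of_real a :: complex" i] by simp
    have nz: "pochhammer (of_real (a + 1) :: complex) i \<noteq> 0"
    proof -
      have "of_real (a + 1) \<noteq> - (of_nat k :: complex)" for k
      proof
        assume "of_real (a + 1) = - (of_nat k :: complex)"
        then have "Re (of_real (a + 1)) = Re (- (of_nat k :: complex))" by simp
        then show False using a by simp
      qed
      then show ?thesis by (metis pochhammer_eq_0_iff)
    qed
    have nz2: "(of_real a + of_nat i :: complex) \<noteq> 0"
    proof
      assume "(of_real a + of_nat i :: complex) = 0"
      then have "Re (of_real a + of_nat i) = 0" by simp
      then show False using a by simp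
    qed
    have "fps_nth (fps_hypergeo [1, of_real a] [of_real (a + 1)] 1) i =
      pochhammer (of_real a :: complex) i / pochhammer (of_real (a + 1)) i"
      by (simp add: fps_hypergeo_Gauss pochhammer_fact[symmetric])
    also have "\<dots> = of_real a / (of_real a + of_nat i)"
      using rec nz nz2 by (simp add: field_simps)
    finally show ?thesis by simp
  qed
  ultimately have "eval_fps (fps_hypergeo [1, of_real a] [of_real (a + 1)] 1) z = J"
    by (simp add: eval_fps_def sums_iff)
  then show ?thesis using IJ(2) by (simp add: integral_unique)
qed

text \<open>\<open>hyp2F1\<close> is pinned down by uniqueness of analytic continuation, so it
  suffices that the integral is holomorphic on the slit plane and agrees with the series in the
  disc. The point \<open>- q\<close> lies off the slit.\<close>

lemma real_hyp2F1_integral: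
  assumes a: "a > 0" and q: "q \<ge> 0"
  shows "real_hyp2F1 1 a (a + 1) (- q) = integral {0..1} (\<lambda>u. 1 / (1 + q * u powr (1 / a)))"
proof -
  let ?f = "\<lambda>u. 1 / (1 + q * u powr (1 / a))"
  have slit: "of_real (- q) \<in> slit_plane"
    using q by (auto simp: slit_plane_def simp flip: of_real_minus)
  have "hyp2F1 (of_real 1) (of_real a) (of_real (a + 1)) (of_real (- q)) =
    integral (cbox 0 1) (\<lambda>u. 1 / (1 - of_real (- q) * of_real (u powr (1 / a))))"
    by (rule hyp2F1_eqI[OF hypergeometric_integral_holomorphic[OF a] _ slit])
       (simp only: hypergeometric_integral_series[OF a] of_real_1)
  also have "\<dots> = integral {0..1} (\<lambda>u. of_real (?f u))"
    by simp
  also have "\<dots> = of_real (integral {0..1} ?f)"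
  proof (rule integral_unique, rule has_integral_of_real)
    have "1 + q * u powr (1 / a) \<noteq> 0" for u
      using q by (metis add_pos_nonneg less_irrefl mult_nonneg_nonneg powr_ge_zero zero_less_one)
    then have "continuous_on {0..1} ?f"
      using a by (intro continuous_intros continuous_on_powr') auto
    then show "(?f has_integral integral {0..1} ?f) {0..1}"
      by (intro integrable_integral integrable_continuous_real)
  qed
  finally show ?thesis by (simp add: real_hyp2F1_def)
qed

subsection \<open>Fading\<close>

text \<open>Independence makes the joint law a product, so Fubini applies. The inner integral runs
  over a second sample point, which replaces conditioning on \<open>X\<close>.\<close>

lemma (in prob_space) nn_integral_indep_var:
  assumes ind: "indep_var S X T Y" and f [measurable]: "f \<in> borel_measurable (S \<Otimes>\<^sub>M T)"
  shows "(\<integral>\<^sup>+\<omega>. f (X \<omega>, Y \<omega>) \<partial>M) = (\<integral>\<^sup>+\<omega>. (\<integral>\<^sup>+\<omega>'. f (X \<omega>, Y \<omega>') \<partial>M) \<partial>M)"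
proof -
  have X [measurable]: "X \<in> measurable M S" and Y [measurable]: "Y \<in> measurable M T"
    using indep_var_rv1[OF ind] indep_var_rv2[OF ind] by auto
  interpret Y: prob_space "distr M T Y" by (rule prob_space_distr) fact
  have "(\<integral>\<^sup>+\<omega>. f (X \<omega>, Y \<omega>) \<partial>M) = (\<integral>\<^sup>+z. f z \<partial>distr M (S \<Otimes>\<^sub>M T) (\<lambda>\<omega>. (X \<omega>, Y \<omega>)))"
    by (subst nn_integral_distr) auto
  also have "\<dots> = (\<integral>\<^sup>+z. f z \<partial>(distr M S X \<Otimes>\<^sub>M distr M T Y))"
    using ind by (simp add: indep_var_distribution_eq)
  also have "\<dots> = (\<integral>\<^sup>+x. (\<integral>\<^sup>+y. f (x, y) \<partial>distr M T Y) \<partial>distr M S X)"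
    by (rule Y.nn_integral_fst[symmetric]) measurable
  also have "\<dots> = (\<integral>\<^sup>+\<omega>. (\<integral>\<^sup>+y. f (X \<omega>, y) \<partial>distr M T Y) \<partial>M)"
    by (rule nn_integral_distr) measurable
  also have "\<dots> = (\<integral>\<^sup>+\<omega>. (\<integral>\<^sup>+\<omega>'. f (X \<omega>, Y \<omega>') \<partial>M) \<partial>M)"
    by (intro nn_integral_cong nn_integral_distr) (auto intro: measurable_Pair2 dest: measurable_space[OF X])
  finally show ?thesis .
qed

text \<open>Tilting the exponential density of rate 1 by \<open>exp (- (c * x))\<close> gives
  \<open>1 / (1 + c)\<close> times the density of rate \<open>1 + c\<close>.\<close>

lemma (in prob_space) nn_integral_exp_exponential:
  assumes h: "distributed M lborel h (exponential_density 1)" and c: "0 \<le> c"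
  shows "(\<integral>\<^sup>+\<omega>. ennreal (exp (- (c * h \<omega>))) \<partial>M) = ennreal (1 / (1 + c))"
proof -
  interpret E: prob_space "density lborel (\<lambda>x. ennreal (exponential_density (1 + c) x))"
    using c by (intro prob_space_exponential_density) simp
  have "(\<integral>\<^sup>+\<omega>. ennreal (exp (- (c * h \<omega>))) \<partial>M) =
    (\<integral>\<^sup>+x. ennreal (exponential_density 1 x) * ennreal (exp (- (c * x))) \<partial>lborel)"
    by (rule distributed_nn_integral[OF h, symmetric]) measurable
  also have "\<dots> = (\<integral>\<^sup>+x. ennreal (1 / (1 + c)) * ennreal (exponential_density (1 + c) x) \<partial>lborel)"
  proof (rule nn_integral_cong)
    fix x :: real
    have "exponential_density 1 x * exp (- (c * x)) = 1 / (1 + c) * exponential_density (1 + c) x"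
    proof -
      have "exp (- x) * exp (- (c * x)) = exp (- x * (1 + c))" by (simp add: mult_exp_exp algebra_simps)
      moreover have "1 + c \<noteq> 0" using c by linarith
      ultimately show ?thesis by (simp add: exponential_density_def)
    qed
    then show "ennreal (exponential_density 1 x) * ennreal (exp (- (c * x))) =
      ennreal (1 / (1 + c)) * ennreal (exponential_density (1 + c) x)"
      using c by (simp only: ennreal_mult''[symmetric] exp_ge_zero ennreal_mult'[symmetric] zero_le_divide_1_iff add_nonneg_nonneg zero_le_one)
  qed
  also have "\<dots> = ennreal (1 / (1 + c)) * (\<integral>\<^sup>+x. ennreal (exponential_density (1 + c) x) \<partial>lborel)"
    by (rule nn_integral_cmult) measurable
  also have "(\<integral>\<^sup>+x. ennreal (exponential_density (1 + c) x) \<partial>lborel) = 1"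
    using E.emeasure_space_1 by (simp add: emeasure_density)
  finally show ?thesis by simp
qed

section \<open>Squared moduli of complex Gaussian combinations\<close>

lemma emeasure_annulus_prod:
  assumes "0 \<le> c" "c \<le> w"
  shows "emeasure (lborel \<Otimes>\<^sub>M lborel) {z::real \<times> real. c < (fst z)\<^sup>2 + (snd z)\<^sup>2 \<and> (fst z)\<^sup>2 + (snd z)\<^sup>2 < w} =
    ennreal (pi * (w - c))"
proof -
  have norm: "norm z < sqrt w \<longleftrightarrow> (fst z)\<^sup>2 + (snd z)\<^sup>2 < w" "norm z \<le> sqrt c \<longleftrightarrow> (fst z)\<^sup>2 + (snd z)\<^sup>2 \<le> c"
    for z :: "real \<times> real"
    by (auto simp: norm_prod_def)
  have eq: "{z::real \<times> real. c < (fst z)\<^sup>2 + (snd z)\<^sup>2 \<and> (fst z)\<^sup>2 + (snd z)\<^sup>2 < w} = ball 0 (sqrt w) - cball 0 (sqrt c)"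
    by (rule set_eqI) (simp only: mem_Collect_eq Diff_iff mem_ball_0 mem_cball_0 norm not_le conj_commute)
  show ?thesis
  proof (cases "c = w")
    case True
    have empty: "{z::real \<times> real. w < (fst z)\<^sup>2 + (snd z)\<^sup>2 \<and> (fst z)\<^sup>2 + (snd z)\<^sup>2 < w} = {}" by auto
    show ?thesis unfolding True empty by simp
  next
    case False
    then have sub: "cball (0::real \<times> real) (sqrt c) \<subseteq> ball 0 (sqrt w)"
      using assms by (simp add: cball_subset_ball_iff)
    have "emeasure (lborel :: (real \<times> real) measure) (ball 0 (sqrt w) - cball 0 (sqrt c)) =
      emeasure lborel (ball (0::real \<times> real) (sqrt w)) - emeasure lborel (cball (0::real \<times> real) (sqrt c))"
      using emeasure_lborel_cball_finite[of "0 :: real \<times> real" "sqrt c"] sub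
      by (intro emeasure_Diff) auto
    then show ?thesis
      using assms unfolding lborel_prod eq
      by (simp add: emeasure_ball emeasure_cball unit_ball_vol_2 ennreal_minus algebra_simps)
  qed
qed

lemma nn_integral_exp_half_line:
  assumes "v > 0"
  shows "(\<integral>\<^sup>+w. ennreal (exp (- (w / v)) / v) * indicator {u<..} w \<partial>lborel) = ennreal (exp (- (u / v)))"
proof -
  have "(\<integral>\<^sup>+w. ennreal (exp (- (w / v)) / v) * indicator {u<..} w \<partial>lborel) =
    (\<integral>\<^sup>+w. ennreal (exp (- (w / v)) / v) * indicator {u..} w \<partial>lborel)"
    by (rule nn_integral_cong_AE, rule AE_mp[OF AE_lborel_singleton[of u]])
       (auto intro!: AE_I2 split: split_indicator)
  also have "\<dots> = ennreal (0 - (- exp (- (u / v))))"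
  proof (rule nn_integral_FTC_atLeast[where F = "\<lambda>w. - exp (- (w / v))"])
    show "((\<lambda>w. - exp (- (w / v))) \<longlongrightarrow> 0) at_top" using assms by real_asymp
  qed (use assms in \<open>auto intro!: derivative_eq_intros\<close>)
  finally show ?thesis by simp
qed

text \<open>
  Writing the Gaussian density as a mixture of uniform densities on discs turns the tail
  probability into a one-dimensional integral over disc areas.
\<close>
lemma nn_integral_gaussian_tail:
  assumes v: "v > 0" and c: "c \<ge> 0"
  shows "(\<integral>\<^sup>+z. ennreal (exp (- (((fst z)\<^sup>2 + (snd z)\<^sup>2) / v)) / (pi * v)) * indicator {c<..} ((fst z)\<^sup>2 + (snd z)\<^sup>2)
    \<partial>(lborel \<Otimes>\<^sub>M lborel)) = ennreal (exp (- (c / v)))"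
proof -
  let ?u = "\<lambda>z::real \<times> real. (fst z)\<^sup>2 + (snd z)\<^sup>2"
  let ?k = "\<lambda>w. ennreal (exp (- (w / v)) / v)"
  have "(\<integral>\<^sup>+z. ennreal (exp (- (?u z / v)) / (pi * v)) * indicator {c<..} (?u z) \<partial>(lborel \<Otimes>\<^sub>M lborel)) =
    (\<integral>\<^sup>+z. (\<integral>\<^sup>+w. ennreal (1 / (pi * v)) * ?k w * (if c < ?u z \<and> ?u z < w then 1 else 0) \<partial>lborel) \<partial>(lborel \<Otimes>\<^sub>M lborel))"
  proof (rule nn_integral_cong)
    fix z :: "real \<times> real"
    have "ennreal (exp (- (?u z / v)) / (pi * v)) = ennreal (1 / (pi * v)) * ennreal (exp (- (?u z / v)))"
      using v by (simp add: ennreal_mult''[symmetric])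
    also have "\<dots> = ennreal (1 / (pi * v)) * (\<integral>\<^sup>+w. ?k w * indicator {?u z<..} w \<partial>lborel)"
      by (simp add: nn_integral_exp_half_line[OF v])
    finally have "ennreal (exp (- (?u z / v)) / (pi * v)) * indicator {c<..} (?u z) =
      (\<integral>\<^sup>+w. ennreal (1 / (pi * v)) * (?k w * indicator {?u z<..} w) \<partial>lborel) * indicator {c<..} (?u z)"
      by (simp add: nn_integral_cmult)
    also have "\<dots> = (\<integral>\<^sup>+w. ennreal (1 / (pi * v)) * (?k w * indicator {?u z<..} w) * indicator {c<..} (?u z) \<partial>lborel)"
      by (rule nn_integral_multc[symmetric]) measurable
    finally show "ennreal (exp (- (?u z / v)) / (pi * v)) * indicator {c<..} (?u z) =
      (\<integral>\<^sup>+w. ennreal (1 / (pi * v)) * ?k w * (if c < ?u z \<and> ?u z < w then 1 else 0) \<partial>lborel)"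
      by (auto intro!: nn_integral_cong simp: mult_ac split: split_indicator elim!: back_subst[of "\<lambda>x. _ = x"])
  qed
  also have "\<dots> = (\<integral>\<^sup>+w. (\<integral>\<^sup>+z. ennreal (1 / (pi * v)) * ?k w * (if c < ?u z \<and> ?u z < w then 1 else 0) \<partial>(lborel \<Otimes>\<^sub>M lborel)) \<partial>lborel)"
  proof -
    interpret LL: pair_sigma_finite "lborel \<Otimes>\<^sub>M lborel :: (real \<times> real) measure" "lborel :: real measure"
      by (simp add: pair_sigma_finite_def lborel_prod lborel.sigma_finite_measure_axioms)
    show ?thesis
      by (rule LL.Fubini'[symmetric]) measurable
  qed
  \<comment> \<open>After the exchange of integrals the inner one is \<open>pi * (w - c)\<close>,
    the area between the circles of squared radius \<open>c\<close> and \<open>w\<close>.\<close>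
  also have "\<dots> = (\<integral>\<^sup>+w. ennreal (exp (- (w / v)) * (w - c) / v\<^sup>2) * indicator {c..} w \<partial>lborel)"
  proof (rule nn_integral_cong)
    fix w :: real
    have "(\<integral>\<^sup>+z. ennreal (1 / (pi * v)) * ?k w * (if c < ?u z \<and> ?u z < w then 1 else 0) \<partial>(lborel \<Otimes>\<^sub>M lborel)) =
      (\<integral>\<^sup>+z. ennreal (1 / (pi * v)) * ?k w * indicator {z. c < ?u z \<and> ?u z < w} z \<partial>(lborel \<Otimes>\<^sub>M lborel))"
      by (auto intro!: nn_integral_cong)
    also have "\<dots> = ennreal (1 / (pi * v)) * ?k w * emeasure (lborel \<Otimes>\<^sub>M lborel) {z. c < ?u z \<and> ?u z < w}"
    proof (rule nn_integral_cmult_indicator)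
      have "{z \<in> space (borel \<Otimes>\<^sub>M borel). c < ?u z \<and> ?u z < w} \<in> sets (borel \<Otimes>\<^sub>M borel)" by measurable
      moreover have "sets (lborel \<Otimes>\<^sub>M lborel) = sets (borel \<Otimes>\<^sub>M borel :: (real \<times> real) measure)"
        by (intro sets_pair_measure_cong) simp_all
      ultimately show "{z. c < ?u z \<and> ?u z < w} \<in> sets (lborel \<Otimes>\<^sub>M lborel)" by (simp add: space_pair_measure)
    qed
    also have "\<dots> = ennreal (exp (- (w / v)) * (w - c) / v\<^sup>2) * indicator {c..} w"
    proof (cases "c \<le> w")
      case True
      have "ennreal (1 / (pi * v)) * ?k w * ennreal (pi * (w - c)) = ennreal (1 / (pi * v) * (exp (- (w / v)) / v) * (pi * (w - c)))"
        using v True by (simp add: ennreal_mult''[symmetric] ennreal_mult'[symmetric])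
      also have "1 / (pi * v) * (exp (- (w / v)) / v) * (pi * (w - c)) = exp (- (w / v)) * (w - c) / v\<^sup>2"
        by (simp add: power2_eq_square)
      finally show ?thesis using True by (simp add: emeasure_annulus_prod[OF c])
    next
      case False
      then have empty: "{z::real \<times> real. c < ?u z \<and> ?u z < w} = {}" by auto
      show ?thesis unfolding empty using False by simp
    qed
    finally show "(\<integral>\<^sup>+z. ennreal (1 / (pi * v)) * ?k w * (if c < ?u z \<and> ?u z < w then 1 else 0) \<partial>(lborel \<Otimes>\<^sub>M lborel)) =
      ennreal (exp (- (w / v)) * (w - c) / v\<^sup>2) * indicator {c..} w" .
  qed
  also have "\<dots> = ennreal (0 - (- (((c - c) / v + 1) * exp (- (c / v)))))"
  proof (rule nn_integral_FTC_atLeast[where F = "\<lambda>w. - (((w - c) / v + 1) * exp (- (w / v)))"])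
    show "((\<lambda>w. - (((w - c) / v + 1) * exp (- (w / v)))) \<longlongrightarrow> 0) at_top" using v by real_asymp
    show "((\<lambda>w. - (((w - c) / v + 1) * exp (- (w / v)))) has_real_derivative exp (- (w / v)) * (w - c) / v\<^sup>2) (at w)" for w
      using v by (auto intro!: derivative_eq_intros simp: field_simps power2_eq_square)
  qed auto
  finally show ?thesis by simp
qed

text \<open>The joint density depends on the squared radius only, and
  \<open>nn_integral_gaussian_tail\<close> applies with \<open>v = 2 * s\<^sup>2\<close>, the mean
  of the resulting exponential law.\<close>

lemma (in prob_space) prob_indep_normal_sum_squares_gt:
  assumes ind: "indep_var borel X borel Y" and s: "s > 0" and c: "c \<ge> 0"
    and X: "distributed M lborel X (normal_density 0 s)"
    and Y: "distributed M lborel Y (normal_density 0 s)"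
  shows "emeasure M {\<omega> \<in> space M. c < (X \<omega>)\<^sup>2 + (Y \<omega>)\<^sup>2} = ennreal (exp (- (c / (2 * s\<^sup>2))))"
proof -
  have ind': "indep_var lborel X lborel Y"
    using ind unfolding indep_var_eq by (simp cong: measurable_cong_sets)
  interpret pair_sigma_finite "lborel :: real measure" "lborel :: real measure" ..
  have joint: "distributed M (lborel \<Otimes>\<^sub>M lborel) (\<lambda>\<omega>. (X \<omega>, Y \<omega>))
    (\<lambda>(x, y). ennreal (normal_density 0 s x) * ennreal (normal_density 0 s y))"
    by (rule distributed_joint_indep[OF _ _ X Y ind']) (rule lborel.sigma_finite_measure_axioms)+
  have meas [measurable]: "(\<lambda>z::real \<times> real. indicator {c<..} ((fst z)\<^sup>2 + (snd z)\<^sup>2) :: ennreal) \<in> borel_measurable (lborel \<Otimes>\<^sub>M lborel)"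
    by measurable
  have [measurable]: "X \<in> borel_measurable M" "Y \<in> borel_measurable M"
    using X Y by (auto dest: distributed_measurable)
  have "emeasure M {\<omega> \<in> space M. c < (X \<omega>)\<^sup>2 + (Y \<omega>)\<^sup>2} =
    (\<integral>\<^sup>+\<omega>. indicator {\<omega> \<in> space M. c < (X \<omega>)\<^sup>2 + (Y \<omega>)\<^sup>2} \<omega> \<partial>M)"
    by (rule nn_integral_indicator[symmetric]) measurable
  also have "\<dots> = (\<integral>\<^sup>+\<omega>. (\<lambda>z. indicator {c<..} ((fst z)\<^sup>2 + (snd z)\<^sup>2)) (X \<omega>, Y \<omega>) \<partial>M)"
    by (intro nn_integral_cong) (simp split: split_indicator)
  also have "\<dots> = (\<integral>\<^sup>+z. (case z of (x, y) \<Rightarrow> ennreal (normal_density 0 s x) * ennreal (normal_density 0 s y)) *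
      indicator {c<..} ((fst z)\<^sup>2 + (snd z)\<^sup>2) \<partial>(lborel \<Otimes>\<^sub>M lborel))"
    by (rule distributed_nn_integral[OF joint meas, symmetric])
  also have "\<dots> = (\<integral>\<^sup>+z. ennreal (exp (- (((fst z)\<^sup>2 + (snd z)\<^sup>2) / (2 * s\<^sup>2))) / (pi * (2 * s\<^sup>2))) * indicator {c<..} ((fst z)\<^sup>2 + (snd z)\<^sup>2)
    \<partial>(lborel \<Otimes>\<^sub>M lborel))"
  proof (rule nn_integral_cong)
    fix z :: "real \<times> real"
    have "normal_density 0 s (fst z) * normal_density 0 s (snd z) =
      exp (- (((fst z)\<^sup>2 + (snd z)\<^sup>2) / (2 * s\<^sup>2))) / (pi * (2 * s\<^sup>2))"
      using s by (simp add: normal_density_def mult_exp_exp add_divide_distrib power2_eq_square[of s] flip: real_sqrt_mult)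
    then show "(case z of (x, y) \<Rightarrow> ennreal (normal_density 0 s x) * ennreal (normal_density 0 s y)) *
      indicator {c<..} ((fst z)\<^sup>2 + (snd z)\<^sup>2) =
      ennreal (exp (- (((fst z)\<^sup>2 + (snd z)\<^sup>2) / (2 * s\<^sup>2))) / (pi * (2 * s\<^sup>2))) * indicator {c<..} ((fst z)\<^sup>2 + (snd z)\<^sup>2)"
      by (simp add: split_beta' ennreal_mult''[symmetric])
  qed
  also have "\<dots> = ennreal (exp (- (c / (2 * s\<^sup>2))))"
    using s c by (intro nn_integral_gaussian_tail) auto
  finally show ?thesis .
qed

text \<open>In an index \<open>(i, j)\<close> the first component selects the variable and the
  second its real or imaginary part. Independence of the two complex variables separates the pairs,
  and independence within each variable separates the parts.\<close>

lemma (in prob_space) indep_vars_Re_Im: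
  assumes ind: "indep_var borel g borel g'"
    and g: "indep_var borel (\<lambda>\<omega>. Re (g \<omega>)) borel (\<lambda>\<omega>. Im (g \<omega>))"
    and g': "indep_var borel (\<lambda>\<omega>. Re (g' \<omega>)) borel (\<lambda>\<omega>. Im (g' \<omega>))"
  shows "indep_vars (\<lambda>_. borel) (\<lambda>(i, j) \<omega>. (if j then Re else Im) ((if i then g else g') \<omega>)) UNIV"
proof -
  let ?Z = "\<lambda>(i, j) \<omega>. (if j then Re else Im) ((if i then g else g') \<omega>) :: real"
  have [measurable]: "g \<in> borel_measurable M" "g' \<in> borel_measurable M"
    using indep_var_rv1[OF ind] indep_var_rv2[OF ind] by auto
  have rv: "random_variable borel (?Z k)" for k
    by (cases k) auto
  have UNIV4: "(UNIV :: (bool \<times> bool) set) = {(True, True), (True, False), (False, True), (False, False)}"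
    by (auto simp: UNIV_bool)
  have "indep_sets (\<lambda>k. {?Z k -` A \<inter> space M | A. A \<in> sets borel}) UNIV"
  \<comment> \<open>Each family contains the whole space and the index set is finite, so the product
    formula over all four indices implies the one for every subfamily.\<close>
  proof (subst indep_sets_finite)
    show "{?Z k -` A \<inter> space M | A. A \<in> sets borel} \<subseteq> events" for k
      using rv[of k] by (auto dest: measurable_sets)
    show "space M \<in> {?Z k -` A \<inter> space M | A. A \<in> sets borel}" for k
      by (intro CollectI exI[of _ UNIV]) auto
    show "\<forall>A\<in>Pi UNIV (\<lambda>k. {?Z k -` A \<inter> space M | A. A \<in> sets borel}).
      prob (\<Inter>j\<in>UNIV. A j) = (\<Prod>j\<in>UNIV. prob (A j))"
    proof
      fix A assume A: "A \<in> Pi UNIV (\<lambda>k. {?Z k -` A \<inter> space M | A. A \<in> sets borel})"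
      have "\<exists>B. B \<in> sets borel \<and> A k = ?Z k -` B \<inter> space M" for k
        using Pi_mem[OF A, of k] by blast
      then obtain B where B: "\<And>k. B k \<in> sets borel" "\<And>k. A k = ?Z k -` B k \<inter> space M" by metis
      \<comment> \<open>Joint conditions on real and imaginary part of one variable form a single
        Borel set of the plane.\<close>
      define S where "S i = {z. Re z \<in> B (i, True) \<and> Im z \<in> B (i, False)}" for i
      have S: "S i \<in> sets borel" for i
      proof -
        have "{z \<in> space borel. Re z \<in> B (i, True) \<and> Im z \<in> B (i, False)} \<in> sets borel"
          using B(1) by measurable
        then show ?thesis by (simp add: S_def)
      qed
      have "prob (\<Inter>j\<in>UNIV. A j) = prob (g -` S True \<inter> g' -` S False \<inter> space M)"
        by (rule arg_cong[where f = prob]) (auto simp: UNIV4 B(2) S_def)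
      also have "\<dots> = prob (g -` S True \<inter> space M) * prob (g' -` S False \<inter> space M)"
        using indep_varD[OF ind S S, of True False] by (simp add: vimage_def Int_def conj_ac)
      also have "prob (g -` S True \<inter> space M) = prob (A (True, True)) * prob (A (True, False))"
        using indep_varD[OF g B(1) B(1), of "(True, True)" "(True, False)"]
        by (simp add: B(2) S_def vimage_def Int_def conj_ac)
      also have "prob (g' -` S False \<inter> space M) = prob (A (False, True)) * prob (A (False, False))"
        using indep_varD[OF g' B(1) B(1), of "(False, True)" "(False, False)"]
        by (simp add: B(2) S_def vimage_def Int_def conj_ac)
      finally show "prob (\<Inter>j\<in>UNIV. A j) = (\<Prod>j\<in>UNIV. prob (A j))"
        by (simp add: UNIV4 mult_ac)
    qed
  qed auto
  then show ?thesis
    unfolding indep_vars_def2 using rv by auto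
qed

text \<open>Real and imaginary part of the combination are independent centred normals of variance
  \<open>(\<alpha>\<^sup>2 + \<beta>\<^sup>2) / 2\<close>. Joint transmission thus acts like a
  single Rayleigh link whose mean power is the sum of the two.\<close>

lemma (in prob_space) emeasure_complex_gaussian_combination_gt:
  assumes ind: "indep_var borel g borel g'"
    and g: "std_complex_gaussian M g" and g': "std_complex_gaussian M g'"
    and ab: "\<alpha> > 0" "\<beta> > 0" and c: "c \<ge> 0"
  shows "emeasure M {\<omega> \<in> space M. c < (cmod (of_real \<alpha> * g \<omega> + of_real \<beta> * g' \<omega>))\<^sup>2} =
    ennreal (exp (- (c / (\<alpha>\<^sup>2 + \<beta>\<^sup>2))))"
proof -
  let ?Z = "\<lambda>(i, j) \<omega>. (if j then Re else Im) ((if i then g else g') \<omega>) :: real"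
  have Z: "indep_vars (\<lambda>_. borel) ?Z UNIV"
    using ind g g' by (intro indep_vars_Re_Im) (auto simp: std_complex_gaussian_def)
  have normal: "distributed M lborel (?Z k) (normal_density 0 (sqrt (1 / 2)))" for k
    using g g' by (cases k) (auto simp: std_complex_gaussian_def)
  define X where "X j \<omega> = \<alpha> * ?Z (True, j) \<omega> + \<beta> * ?Z (False, j) \<omega>" for j \<omega>
  define s where "s = sqrt ((\<alpha>\<^sup>2 + \<beta>\<^sup>2) / 2)"
  have s: "s > 0" using ab by (simp add: s_def add_pos_pos)
  have X: "distributed M lborel (X j) (normal_density 0 s)" for j
  proof -
    have "indep_var (PiM {(True, j)} (\<lambda>_. borel)) (\<lambda>\<omega>. restrict (\<lambda>k. ?Z k \<omega>) {(True, j)})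
      (PiM {(False, j)} (\<lambda>_. borel)) (\<lambda>\<omega>. restrict (\<lambda>k. ?Z k \<omega>) {(False, j)})"
      using Z by (rule indep_var_restrict) auto
    \<comment> \<open>The added zeros fit the affine form in which
      \<open>normal_density_affine\<close> is stated.\<close>
    then have "indep_var borel ((\<lambda>f. 0 + \<alpha> * f (True, j)) \<circ> (\<lambda>\<omega>. restrict (\<lambda>k. ?Z k \<omega>) {(True, j)}))
      borel ((\<lambda>f. 0 + \<beta> * f (False, j)) \<circ> (\<lambda>\<omega>. restrict (\<lambda>k. ?Z k \<omega>) {(False, j)}))"
      by (rule indep_var_compose) measurable
    then have "distributed M lborel (\<lambda>\<omega>. (0 + \<alpha> * ?Z (True, j) \<omega>) + (0 + \<beta> * ?Z (False, j) \<omega>))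
      (normal_density ((0 + \<alpha> * 0) + (0 + \<beta> * 0)) (sqrt ((\<bar>\<alpha>\<bar> * sqrt (1 / 2))\<^sup>2 + (\<bar>\<beta>\<bar> * sqrt (1 / 2))\<^sup>2)))"
      using ab by (intro add_indep_normal normal_density_affine normal) (auto simp: o_def)
    moreover have "sqrt ((\<bar>\<alpha>\<bar> * sqrt (1 / 2))\<^sup>2 + (\<bar>\<beta>\<bar> * sqrt (1 / 2))\<^sup>2) = s"
      unfolding s_def by (rule arg_cong[where f = sqrt]) (simp add: power_mult_distrib real_sqrt_pow2)
    ultimately show ?thesis by (simp add: X_def[abs_def])
  qed
  have indX: "indep_var borel (X True) borel (X False)"
  proof -
    have "indep_var (PiM {(True, True), (False, True)} (\<lambda>_. borel)) (\<lambda>\<omega>. restrict (\<lambda>k. ?Z k \<omega>) {(True, True), (False, True)})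
      (PiM {(True, False), (False, False)} (\<lambda>_. borel)) (\<lambda>\<omega>. restrict (\<lambda>k. ?Z k \<omega>) {(True, False), (False, False)})"
      using Z by (rule indep_var_restrict) auto
    then have "indep_var borel ((\<lambda>f. \<alpha> * f (True, True) + \<beta> * f (False, True)) \<circ> (\<lambda>\<omega>. restrict (\<lambda>k. ?Z k \<omega>) {(True, True), (False, True)}))
      borel ((\<lambda>f. \<alpha> * f (True, False) + \<beta> * f (False, False)) \<circ> (\<lambda>\<omega>. restrict (\<lambda>k. ?Z k \<omega>) {(True, False), (False, False)}))"
      by (rule indep_var_compose) measurable
    then show ?thesis by (simp add: X_def[abs_def] o_def)
  qed
  have "(cmod (of_real \<alpha> * g \<omega> + of_real \<beta> * g' \<omega>))\<^sup>2 = (X True \<omega>)\<^sup>2 + (X False \<omega>)\<^sup>2" for \<omega>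
    by (simp add: X_def cmod_power2)
  then have "emeasure M {\<omega> \<in> space M. c < (cmod (of_real \<alpha> * g \<omega> + of_real \<beta> * g' \<omega>))\<^sup>2} =
    ennreal (exp (- (c / (2 * s\<^sup>2))))"
    using prob_indep_normal_sum_squares_gt[OF indX s c X X] by simp
  also have "2 * s\<^sup>2 = \<alpha>\<^sup>2 + \<beta>\<^sup>2" by (simp add: s_def)
  finally show ?thesis .
qed

subsection \<open>The interference beyond the nearest stations\<close>

context poisson_network
begin

text \<open>The ball of radius 0 has Lebesgue measure 0, so almost surely no station sits at the
  origin.\<close>

lemma AE_dist_seq_pos: "AE \<omega> in M. \<forall>i. 0 < dist_seq \<omega> i"
proof -
  have "prob {\<omega> \<in> space M. card (\<Phi> \<omega> \<inter> cball 0 0) = 0} = 1"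
    using prob_count[of "cball 0 0" 0] by simp
  then have "AE \<omega> in M. \<omega> \<in> {\<omega> \<in> space M. card (\<Phi> \<omega> \<inter> cball 0 0) = 0}"
    by (rule AE_prob_1)
  with AE_infinitely_many show ?thesis
  proof eventually_elim
    case (elim \<omega>)
    then have "\<not> dist_seq \<omega> i \<le> 0" for i
      using ordered_dist_le_iff[of "\<Phi> \<omega>" "Suc i" 0] \<Phi>_locally_finite[of \<omega>] by simp
    then show ?case by (simp add: not_le)
  qed
qed

text \<open>A ball contains finitely many stations, and every index beyond their number has its
  distance outside.\<close>

lemma AE_dist_seq_at_top: "AE \<omega> in M. filterlim (dist_seq \<omega>) at_top sequentially"
  using AE_infinitely_many AE_space
proof eventually_elim
  case (elim \<omega>)
  show ?case
    unfolding filterlim_at_top_dense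
  proof
    fix t
    have "t < dist_seq \<omega> i" if i: "card (\<Phi> \<omega> \<inter> cball 0 (max 0 t)) \<le> i" for i
    proof -
      have "\<not> dist_seq \<omega> i \<le> max 0 t"
        using ordered_dist_le_iff[OF \<Phi>_locally_finite[OF elim(2)] elim(1)[rule_format], of "max 0 t" "Suc i"] i
        by simp
      then show ?thesis by simp
    qed
    then show "\<forall>\<^sub>F i in sequentially. t < dist_seq \<omega> i"
      unfolding eventually_sequentially by blast
  qed
qed

text \<open>
  With \<open>H\<close> the exponential of minus the interference exponent, the products
  \<open>\<Prod>\<^sub>i (1 + c r\<^sub>i\<^sup>-\<^sup>\<eta>)\<^sup>-\<^sup>1 H(r\<^sub>m)\<close> form a martingale in \<open>m\<close>.
\<close>
lemma nn_integral_martingale_step: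
  assumes eta: "\<eta> > 2"
    and G: "G \<in> borel_measurable (borel_product {..m})"
    and c: "c \<in> borel_measurable (borel_product {..m})" and c0: "\<And>x. 0 \<le> c x"
  shows "(\<integral>\<^sup>+\<omega>. G (nearest m \<omega>) *
      (ennreal (1 / (1 + c (nearest m \<omega>) * dist_seq \<omega> (Suc m) powr (- \<eta>))) *
       ennreal (exp (- interference_exponent lam \<eta> (c (nearest m \<omega>)) (dist_seq \<omega> (Suc m))))) \<partial>M) =
    (\<integral>\<^sup>+\<omega>. G (nearest m \<omega>) *
      ennreal (exp (- interference_exponent lam \<eta> (c (nearest m \<omega>)) (dist_seq \<omega> m))) \<partial>M)"
proof -
  define f where "f x = G (restrict x {..m}) *
      (ennreal (1 / (1 + c (restrict x {..m}) * x (Suc m) powr (- \<eta>))) *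
       ennreal (exp (- interference_exponent lam \<eta> (c (restrict x {..m})) (x (Suc m)))))" for x :: "nat \<Rightarrow> real"
  note [measurable] = borel_measurable_interference_exponent[OF lam_pos eta]
  have restr: "(\<lambda>x. restrict x {..m}) \<in> measurable (borel_product {..Suc m}) (borel_product {..m})"
    by (rule measurable_restrict_subset) auto
  note [measurable] = measurable_compose[OF restr G] measurable_compose[OF restr c]
  have "f \<in> borel_measurable (borel_product {..Suc m})"
    unfolding f_def by measurable
  note eq = nn_integral_dist_seq_markov[OF this]
  have r1: "restrict (restrict x {..Suc m}) {..m} = restrict x {..m}" for x :: "nat \<Rightarrow> real"
    by (auto simp: fun_eq_iff)
  \<comment> \<open>\<open>G\<close> and \<open>c\<close> do not see coordinate
    \<open>Suc m\<close>, so \<open>G\<close> leaves the inner integral and \<open>c\<close> is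
    constant in it.\<close>
  have r2: "restrict ((restrict x {..m})(Suc m := y)) {..m} = restrict x {..m}" for x :: "nat \<Rightarrow> real" and y
    by (auto simp: fun_eq_iff)
  have "(\<integral>\<^sup>+\<omega>. (\<integral>\<^sup>+y. indicator {dist_seq \<omega> m<..} y *
        ennreal (exp (lam * pi * (dist_seq \<omega> m)\<^sup>2 - lam * pi * y\<^sup>2)) *
        f ((nearest m \<omega>)(Suc m := y)) \<partial>radial_intensity lam) \<partial>M) =
    (\<integral>\<^sup>+\<omega>. G (nearest m \<omega>) *
      ennreal (exp (- interference_exponent lam \<eta> (c (nearest m \<omega>)) (dist_seq \<omega> m))) \<partial>M)"
  proof (rule nn_integral_cong_AE, rule AE_mp[OF AE_dist_seq_pos], intro AE_I2 impI)
    fix \<omega> assume pos: "\<forall>i. 0 < dist_seq \<omega> i"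
    let ?x = "nearest m \<omega>"
    have "(\<integral>\<^sup>+y. indicator {dist_seq \<omega> m<..} y *
        ennreal (exp (lam * pi * (dist_seq \<omega> m)\<^sup>2 - lam * pi * y\<^sup>2)) *
        f (?x(Suc m := y)) \<partial>radial_intensity lam) =
      (\<integral>\<^sup>+y. G ?x * (indicator {dist_seq \<omega> m<..} y *
        ennreal (exp (lam * pi * (dist_seq \<omega> m)\<^sup>2 - lam * pi * y\<^sup>2)) *
        (ennreal (1 / (1 + c ?x * y powr (- \<eta>))) * ennreal (exp (- interference_exponent lam \<eta> (c ?x) y))))
        \<partial>radial_intensity lam)"
      unfolding f_def r2 by (simp add: mult_ac)
    also have "\<dots> = G ?x * (\<integral>\<^sup>+y. indicator {dist_seq \<omega> m<..} y *
        ennreal (exp (lam * pi * (dist_seq \<omega> m)\<^sup>2 - lam * pi * y\<^sup>2)) *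
        (ennreal (1 / (1 + c ?x * y powr (- \<eta>))) * ennreal (exp (- interference_exponent lam \<eta> (c ?x) y)))
        \<partial>radial_intensity lam)"
      by (rule nn_integral_cmult) measurable
    also have "\<dots> = G ?x * ennreal (exp (- interference_exponent lam \<eta> (c ?x) (dist_seq \<omega> m)))"
      using interference_exponent_tail_integral[OF lam_pos eta c0[of ?x], of "dist_seq \<omega> m"] pos by simp
    finally show "(\<integral>\<^sup>+y. indicator {dist_seq \<omega> m<..} y *
        ennreal (exp (lam * pi * (dist_seq \<omega> m)\<^sup>2 - lam * pi * y\<^sup>2)) *
        f (?x(Suc m := y)) \<partial>radial_intensity lam) =
      G ?x * ennreal (exp (- interference_exponent lam \<eta> (c ?x) (dist_seq \<omega> m)))" .
  qed
  with eq show ?thesis unfolding f_def r1 by simp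
qed

text \<open>Induction on \<open>n\<close>, the factors collected so far being absorbed into the
  weight \<open>G\<close> of the one-step identity. Both \<open>G\<close> and \<open>c\<close> stay
  functions of the first \<open>k + 1\<close> distances while the chain runs on.\<close>

lemma nn_integral_martingale:
  assumes eta: "\<eta> > 2"
    and G: "G \<in> borel_measurable (borel_product {..k})"
    and c: "c \<in> borel_measurable (borel_product {..k})" and c0: "\<And>x. 0 \<le> c x"
  shows "(\<integral>\<^sup>+\<omega>. G (nearest k \<omega>) *
      ((\<Prod>j<n. ennreal (1 / (1 + c (nearest k \<omega>) * dist_seq \<omega> (Suc (k + j)) powr (- \<eta>)))) *
       ennreal (exp (- interference_exponent lam \<eta> (c (nearest k \<omega>)) (dist_seq \<omega> (k + n))))) \<partial>M) =
    (\<integral>\<^sup>+\<omega>. G (nearest k \<omega>) *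
      ennreal (exp (- interference_exponent lam \<eta> (c (nearest k \<omega>)) (dist_seq \<omega> k))) \<partial>M)"
proof (induction n)
  case (Suc n)
  let ?G = "\<lambda>x. G (restrict x {..k}) * (\<Prod>j<n. ennreal (1 / (1 + c (restrict x {..k}) * x (Suc (k + j)) powr (- \<eta>))))"
  let ?c = "\<lambda>x. c (restrict x {..k})"
  have restr: "(\<lambda>x. restrict x {..k}) \<in> measurable (borel_product {..k + n}) (borel_product {..k})"
    by (rule measurable_restrict_subset) auto
  note [measurable] = measurable_compose[OF restr G] measurable_compose[OF restr c]
  have "?G \<in> borel_measurable (borel_product {..k + n})"
  proof (intro borel_measurable_times_ennreal borel_measurable_prod_ennreal measurable_compose[OF restr G])
    fix j assume "j \<in> {..<n}"
    then have [measurable]: "(\<lambda>x. x (Suc (k + j))) \<in> borel_measurable (borel_product {..k + n})"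
      by (intro measurable_component_singleton) auto
    show "(\<lambda>x. ennreal (1 / (1 + c (restrict x {..k}) * x (Suc (k + j)) powr (- \<eta>))))
      \<in> borel_measurable (borel_product {..k + n})"
      by measurable
  qed
  from nn_integral_martingale_step[OF eta this measurable_compose[OF restr c]]
  have "(\<integral>\<^sup>+\<omega>. ?G (restrict (dist_seq \<omega>) {..k + n}) *
      (ennreal (1 / (1 + ?c (restrict (dist_seq \<omega>) {..k + n}) * dist_seq \<omega> (Suc (k + n)) powr (- \<eta>))) *
       ennreal (exp (- interference_exponent lam \<eta> (?c (restrict (dist_seq \<omega>) {..k + n})) (dist_seq \<omega> (Suc (k + n)))))) \<partial>M) =
    (\<integral>\<^sup>+\<omega>. ?G (restrict (dist_seq \<omega>) {..k + n}) *
      ennreal (exp (- interference_exponent lam \<eta> (?c (restrict (dist_seq \<omega>) {..k + n})) (dist_seq \<omega> (k + n)))) \<partial>M)"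
    using c0 by simp
  note step = this
  have restr2: "restrict (restrict x {..k + n}) {..k} = restrict x {..k}" for x :: "nat \<Rightarrow> real"
    by (auto simp: fun_eq_iff)
  have prod_restr: "(\<Prod>j<n. ennreal (1 / (1 + c y * restrict x {..k + n} (Suc (k + j)) powr (- \<eta>)))) =
      (\<Prod>j<n. ennreal (1 / (1 + c y * x (Suc (k + j)) powr (- \<eta>))))" for x y :: "nat \<Rightarrow> real"
    by (intro prod.cong refl) simp
  show ?case
    unfolding Suc.IH[symmetric] prod.lessThan_Suc add_Suc_right
    using step[unfolded restr2 prod_restr] by (simp only: mult_ac)
qed simp

end

subsection \<open>Independence of positions and fading\<close>

text \<open>
  Distances, gains and coefficients as random elements of one space, so that the library's
  independence of families of random variables applies.
\<close>
fun source_value ::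
  "('w \<Rightarrow> (real^2) set) \<Rightarrow> (nat \<Rightarrow> 'w \<Rightarrow> real) \<Rightarrow> (nat \<Rightarrow> 'w \<Rightarrow> complex) \<Rightarrow> source \<Rightarrow> 'w \<Rightarrow> nat \<Rightarrow> real" where
  "source_value \<Phi> h g Process \<omega> = (\<lambda>i. ordered_dist (\<Phi> \<omega>) (Suc i))"
| "source_value \<Phi> h g (Gain k) \<omega> = (\<lambda>_. h k \<omega>)"
| "source_value \<Phi> h g (Coeff k) \<omega> = (\<lambda>i. if i = 0 then Re (g k \<omega>) else Im (g k \<omega>))"

text \<open>A function of a random element generates a smaller sigma-algebra. In this way the
  distances inherit the independence assumed for the point process.\<close>

lemma vimage_algebra_compose_subset:
  assumes Y: "Y \<in> measurable M N" and f: "f \<in> measurable N S"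
  shows "{(\<lambda>\<omega>. f (Y \<omega>)) -` A \<inter> space M | A. A \<in> sets S} \<subseteq> sets (vimage_algebra (space M) Y N)"
proof safe
  fix A assume A: "A \<in> sets S"
  have YN: "Y \<in> measurable (vimage_algebra (space M) Y N) N"
    using Y by (intro measurable_vimage_algebra1) (auto dest: measurable_space)
  from measurable_sets[OF measurable_compose[OF YN f] A]
  show "(\<lambda>\<omega>. f (Y \<omega>)) -` A \<inter> space M \<in> sets (vimage_algebra (space M) Y N)"
    by simp
qed

lemma (in prob_space) indep_vars_source_value:
  assumes ind: "indep_sets (generated_events M \<Phi> h g) I"
    and \<Phi>: "\<Phi> \<in> measurable M configurations"
    and h: "\<And>k. Gain k \<in> I \<Longrightarrow> h k \<in> borel_measurable M"
    and g: "\<And>k. Coeff k \<in> I \<Longrightarrow> g k \<in> borel_measurable M"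
  shows "indep_vars (\<lambda>_. borel_product UNIV) (source_value \<Phi> h g) I"
proof -
  let ?S = "borel_product UNIV :: (nat \<Rightarrow> real) measure"
  note pre = vimage_algebra_compose_subset
  have position: "(\<lambda>S i. ordered_dist S (Suc i)) \<in> measurable configurations ?S"
    by (rule measurable_PiM_single') (auto intro: measurable_ordered_dist)
  have gain: "(\<lambda>x _. x) \<in> measurable borel ?S"
    by (rule measurable_PiM_single') auto
  have coeff: "(\<lambda>z i. if i = 0 then Re z else Im z) \<in> measurable borel ?S"
    by (rule measurable_PiM_single') auto
  have "source_value \<Phi> h g i \<in> measurable M ?S \<and>
      {source_value \<Phi> h g i -` A \<inter> space M | A. A \<in> sets ?S} \<subseteq> generated_events M \<Phi> h g i" if "i \<in> I" for i
  proof (cases i)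
    case Process
    have "source_value \<Phi> h g i = (\<lambda>\<omega> i. ordered_dist (\<Phi> \<omega>) (Suc i))" by (auto simp: Process)
    then show ?thesis
      using pre[OF \<Phi> position] measurable_compose[OF \<Phi> position] Process by simp
  next
    case (Gain k)
    have "source_value \<Phi> h g i = (\<lambda>\<omega> _. h k \<omega>)" by (auto simp: Gain)
    then show ?thesis
      using pre[OF h gain, of k] measurable_compose[OF h gain, of k] Gain that by simp
  next
    case (Coeff k)
    have "source_value \<Phi> h g i = (\<lambda>\<omega> i. if i = 0 then Re (g k \<omega>) else Im (g k \<omega>))" by (auto simp: Coeff)
    then show ?thesis
      using pre[OF g coeff, of k] measurable_compose[OF g coeff, of k] Coeff that by simp
  qed
  then have rv: "\<And>i. i \<in> I \<Longrightarrow> source_value \<Phi> h g i \<in> measurable M ?S"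
    and sub: "\<And>i. i \<in> I \<Longrightarrow> {source_value \<Phi> h g i -` A \<inter> space M | A. A \<in> sets ?S} \<subseteq> generated_events M \<Phi> h g i"
    by blast+
  show ?thesis
    unfolding indep_vars_def2 using rv indep_sets_mono_sets[OF ind sub] by auto
qed

text \<open>\<open>J\<close> holds the zero-based indices of the interfering stations. Serving
  stations stay outside, so that their gains or coefficients can be integrated separately from the
  interference.\<close>

locale faded_network = poisson_network M \<Phi> lam
  for M :: "'w measure" and \<Phi> :: "'w \<Rightarrow> (real^2) set" and lam :: real +
  fixes h :: "nat \<Rightarrow> 'w \<Rightarrow> real" and g :: "nat \<Rightarrow> 'w \<Rightarrow> complex" and J :: "nat set" and P \<eta> :: real
  assumes P_pos: "P > 0" and eta: "\<eta> > 2"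
    and exponential: "\<And>i. i \<in> J \<Longrightarrow> distributed M lborel (h (Suc i)) (exponential_density 1)"
    and indep: "indep_vars (\<lambda>_. borel_product UNIV) (source_value \<Phi> h g) (insert Process (Gain ` Suc ` J))"
begin

lemma measurable_gain [measurable]: "i \<in> J \<Longrightarrow> h (Suc i) \<in> borel_measurable M"
  using distributed_measurable[OF exponential] by simp

lemma AE_gain_pos: "AE \<omega> in M. \<forall>i\<in>J. 0 < h (Suc i) \<omega>"
proof -
  have "AE \<omega> in M. 0 < h (Suc i) \<omega>" if "i \<in> J" for i
  proof -
    have "prob {\<omega> \<in> space M. 0 < h (Suc i) \<omega>} = 1"
      using exponential_distributedD_gt[OF exponential[OF that], of 0] by simp
    from AE_prob_1[OF this] show ?thesis by eventually_elim simp
  qed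
  then show ?thesis by (subst AE_ball_countable) auto
qed

text \<open>With the distances held fixed, the gains are independent exponentials, and each
  contributes its Laplace transform. \<open>G\<close> may depend on all distances, which leaves room
  for the H factor at an arbitrarily late station.\<close>

lemma nn_integral_gains:
  assumes K: "finite K" "K \<subseteq> J"
    and G: "G \<in> borel_measurable (borel_product UNIV)"
    and c: "\<And>i. i \<in> K \<Longrightarrow> c i \<in> borel_measurable (borel_product UNIV)" and c0: "\<And>i x. 0 \<le> c i x"
  shows "(\<integral>\<^sup>+\<omega>. G (dist_seq \<omega>) * (\<Prod>i\<in>K. ennreal (exp (- (c i (dist_seq \<omega>) * h (Suc i) \<omega>)))) \<partial>M) =
    (\<integral>\<^sup>+\<omega>. G (dist_seq \<omega>) * (\<Prod>i\<in>K. ennreal (1 / (1 + c i (dist_seq \<omega>)))) \<partial>M)"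
proof -
  let ?S = "borel_product UNIV :: (nat \<Rightarrow> real) measure"
  let ?V = "source_value \<Phi> h g"
  have "indep_var (PiM {Process} (\<lambda>_. ?S)) (\<lambda>\<omega>. restrict (\<lambda>i. ?V i \<omega>) {Process})
    (PiM (Gain ` Suc ` K) (\<lambda>_. ?S)) (\<lambda>\<omega>. restrict (\<lambda>i. ?V i \<omega>) (Gain ` Suc ` K))"
    using K by (intro indep_var_restrict[OF indep]) auto
  then have "indep_var ?S ((\<lambda>f. f Process) \<circ> (\<lambda>\<omega>. restrict (\<lambda>i. ?V i \<omega>) {Process}))
    (PiM K (\<lambda>_. borel)) ((\<lambda>f. \<lambda>i\<in>K. f (Gain (Suc i)) 0) \<circ> (\<lambda>\<omega>. restrict (\<lambda>i. ?V i \<omega>) (Gain ` Suc ` K)))"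
  proof (rule indep_var_compose)
    show "(\<lambda>f. f Process) \<in> measurable (PiM {Process} (\<lambda>_. ?S)) ?S" by simp
    show "(\<lambda>f. \<lambda>i\<in>K. f (Gain (Suc i)) 0) \<in> measurable (PiM (Gain ` Suc ` K) (\<lambda>_. ?S)) (PiM K (\<lambda>_. borel))"
    proof (rule measurable_restrict)
      fix i assume "i \<in> K"
      then have "(\<lambda>f. f (Gain (Suc i))) \<in> measurable (PiM (Gain ` Suc ` K) (\<lambda>_. ?S)) ?S"
        by (intro measurable_component_singleton) auto
      then show "(\<lambda>f. f (Gain (Suc i)) 0) \<in> borel_measurable (PiM (Gain ` Suc ` K) (\<lambda>_. ?S))"
        by (rule measurable_compose) simp
    qed
  qed
  also have "(\<lambda>f. f Process) \<circ> (\<lambda>\<omega>. restrict (\<lambda>i. ?V i \<omega>) {Process}) = dist_seq"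
    by (auto simp: fun_eq_iff)
  also have "(\<lambda>f. \<lambda>i\<in>K. f (Gain (Suc i)) 0) \<circ> (\<lambda>\<omega>. restrict (\<lambda>i. ?V i \<omega>) (Gain ` Suc ` K)) = (\<lambda>\<omega>. \<lambda>i\<in>K. h (Suc i) \<omega>)"
    by (auto simp: fun_eq_iff)
  finally have ind: "indep_var ?S dist_seq (PiM K (\<lambda>_. borel)) (\<lambda>\<omega>. \<lambda>i\<in>K. h (Suc i) \<omega>)" .
  let ?f = "\<lambda>(x, y). G x * (\<Prod>i\<in>K. ennreal (exp (- (c i x * y i))))"
  have "?f \<in> borel_measurable (?S \<Otimes>\<^sub>M PiM K (\<lambda>_. borel))"
  proof -
    have "(\<lambda>z. c i (fst z) * snd z i) \<in> borel_measurable (?S \<Otimes>\<^sub>M PiM K (\<lambda>_. borel))" if "i \<in> K" for i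
      using that by (intro borel_measurable_times measurable_compose[OF measurable_fst c]
          measurable_compose[OF measurable_snd measurable_component_singleton])
    then show ?thesis
      unfolding split_beta' using G by measurable
  qed
  from nn_integral_indep_var[OF ind this]
  have "(\<integral>\<^sup>+\<omega>. G (dist_seq \<omega>) * (\<Prod>i\<in>K. ennreal (exp (- (c i (dist_seq \<omega>) * h (Suc i) \<omega>)))) \<partial>M) =
    (\<integral>\<^sup>+\<omega>. (\<integral>\<^sup>+\<omega>'. G (dist_seq \<omega>) * (\<Prod>i\<in>K. ennreal (exp (- (c i (dist_seq \<omega>) * h (Suc i) \<omega>')))) \<partial>M) \<partial>M)"
    by (simp cong: prod.cong)
  also have "\<dots> = (\<integral>\<^sup>+\<omega>. G (dist_seq \<omega>) * (\<Prod>i\<in>K. ennreal (1 / (1 + c i (dist_seq \<omega>)))) \<partial>M)"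
  proof (rule nn_integral_cong)
    fix \<omega>
    let ?d = "\<lambda>i. c i (dist_seq \<omega>)"
    \<comment> \<open>Decodes a gain source into its zero-based station; the default 0 on other
      sources is never evaluated.\<close>
    define idx where "idx s = (case s of Gain n \<Rightarrow> n - 1 | _ \<Rightarrow> 0)" for s
    have inj: "inj_on (Gain \<circ> Suc) K" by (auto simp: inj_on_def)
    have [measurable]: "h (Suc i) \<in> borel_measurable M" if "i \<in> K" for i
      using that K by auto
    have iv: "indep_vars (\<lambda>_. borel) (\<lambda>s \<omega>'. ennreal (exp (- (?d (idx s) * ?V s \<omega>' 0)))) ((Gain \<circ> Suc) ` K)"
      by (rule indep_vars_compose2[OF indep_vars_subset[OF indep], where Y = "\<lambda>s v. ennreal (exp (- (?d (idx s) * v 0)))"])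
         (use K in auto)
    have "(\<integral>\<^sup>+\<omega>'. G (dist_seq \<omega>) * (\<Prod>i\<in>K. ennreal (exp (- (?d i * h (Suc i) \<omega>')))) \<partial>M) =
      G (dist_seq \<omega>) * (\<integral>\<^sup>+\<omega>'. (\<Prod>i\<in>K. ennreal (exp (- (?d i * h (Suc i) \<omega>')))) \<partial>M)"
      by (rule nn_integral_cmult) measurable
    also have "(\<integral>\<^sup>+\<omega>'. (\<Prod>i\<in>K. ennreal (exp (- (?d i * h (Suc i) \<omega>')))) \<partial>M) =
      (\<integral>\<^sup>+\<omega>'. (\<Prod>s\<in>(Gain \<circ> Suc) ` K. ennreal (exp (- (?d (idx s) * ?V s \<omega>' 0)))) \<partial>M)"
      unfolding prod.reindex[OF inj] by (simp add: idx_def)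
    also have "\<dots> = (\<Prod>s\<in>(Gain \<circ> Suc) ` K. \<integral>\<^sup>+\<omega>'. ennreal (exp (- (?d (idx s) * ?V s \<omega>' 0))) \<partial>M)"
      using K iv by (intro indep_vars_nn_integral) auto
    also have "\<dots> = (\<Prod>i\<in>K. \<integral>\<^sup>+\<omega>'. ennreal (exp (- (?d i * h (Suc i) \<omega>'))) \<partial>M)"
      unfolding prod.reindex[OF inj] by (simp add: idx_def)
    also have "\<dots> = (\<Prod>i\<in>K. ennreal (1 / (1 + ?d i)))"
      using K c0 by (intro prod.cong refl nn_integral_exp_exponential exponential) auto
    finally show "(\<integral>\<^sup>+\<omega>'. G (dist_seq \<omega>) * (\<Prod>i\<in>K. ennreal (exp (- (?d i * h (Suc i) \<omega>')))) \<partial>M) =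
      G (dist_seq \<omega>) * (\<Prod>i\<in>K. ennreal (1 / (1 + ?d i)))" .
  qed
  finally show ?thesis .
qed

end

section \<open>Laplace transform of the interference\<close>

context faded_network
begin

abbreviation power_at :: "nat \<Rightarrow> 'w \<Rightarrow> real" where
  "power_at i \<omega> \<equiv> received_power P \<eta> \<Phi> h (Suc i) \<omega>"

lemma measurable_power_at [measurable]: "i \<in> J \<Longrightarrow> power_at i \<in> borel_measurable M"
  unfolding received_power_def by measurable

lemma AE_power_at_pos: "AE \<omega> in M. \<forall>i\<in>J. 0 < power_at i \<omega>"
  using AE_gain_pos AE_dist_seq_pos
proof eventually_elim
  case (elim \<omega>)
  show ?case
  proof
    fix i assume "i \<in> J"
    then have "0 < dist_seq \<omega> i powr (- \<eta>)" "0 < h (Suc i) \<omega>"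
      using elim(2)[rule_format, of i] elim(1) by simp_all
    then show "0 < power_at i \<omega>" using P_pos by (simp add: received_power_def)
  qed
qed

lemma measurable_restrict_atMost:
  "(\<lambda>x. restrict x {..k}) \<in> measurable (borel_product UNIV) (borel_product {..k})" for k :: nat
  by (rule measurable_restrict_subset) auto

text \<open>Integrating out the gains leaves a product of fading factors, and the martingale
  identity removes those beyond \<open>k\<close>. The right-hand side is free of \<open>n\<close>:
  the H factor at index \<open>k + n\<close> compensates exactly for the interferers left
  out.\<close>

lemma nn_integral_partial_interference:
  assumes J0: "J0 \<subseteq> {..k}" "J0 \<subseteq> J" and tail: "{k<..} \<subseteq> J"
    and G: "G \<in> borel_measurable (borel_product {..k})"
    and s: "s \<in> borel_measurable (borel_product {..k})" and s0: "\<And>x. 0 \<le> s x"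
  shows "(\<integral>\<^sup>+\<omega>. G (nearest k \<omega>) *
      ennreal (exp (- (s (nearest k \<omega>) * ((\<Sum>i\<in>J0. power_at i \<omega>) + (\<Sum>j<n. power_at (Suc (k + j)) \<omega>))))) *
      ennreal (exp (- interference_exponent lam \<eta> (s (nearest k \<omega>) * P) (dist_seq \<omega> (k + n)))) \<partial>M) =
    (\<integral>\<^sup>+\<omega>. G (nearest k \<omega>) *
      (\<Prod>i\<in>J0. ennreal (1 / (1 + s (nearest k \<omega>) * P * dist_seq \<omega> i powr (- \<eta>)))) *
      ennreal (exp (- interference_exponent lam \<eta> (s (nearest k \<omega>) * P) (dist_seq \<omega> k))) \<partial>M)"
    (is "?lhs = ?rhs")
proof -
  let ?X = "\<lambda>x. restrict x {..k} :: nat \<Rightarrow> real"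
  let ?T = "(\<lambda>j. Suc (k + j)) ` {..<n}"
  define K where "K = J0 \<union> ?T"
  let ?c = "\<lambda>i x. s (?X x) * P * x i powr (- \<eta>)"
  let ?H = "\<lambda>x i. ennreal (exp (- interference_exponent lam \<eta> (s (?X x) * P) (x i)))"
  have fin: "finite J0" using J0 finite_subset by blast
  have disj: "J0 \<inter> ?T = {}" using J0 by auto
  have inj: "inj_on (\<lambda>j. Suc (k + j)) {..<n}" by (auto simp: inj_on_def)
  have K: "finite K" "K \<subseteq> J" using fin J0 tail by (auto simp: K_def)
  note [measurable] = measurable_compose[OF measurable_restrict_atMost G] measurable_compose[OF measurable_restrict_atMost s]
    borel_measurable_interference_exponent[OF lam_pos eta]
  have sumK: "(\<Sum>i\<in>K. f i) = (\<Sum>i\<in>J0. f i) + (\<Sum>j<n. f (Suc (k + j)))" for f :: "nat \<Rightarrow> real"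
    unfolding K_def using fin disj inj by (subst sum.union_disjoint) (auto simp: sum.reindex)
  have prodK: "(\<Prod>i\<in>K. f i) = (\<Prod>i\<in>J0. f i) * (\<Prod>j<n. f (Suc (k + j)))" for f :: "nat \<Rightarrow> ennreal"
    unfolding K_def using fin disj inj by (subst prod.union_disjoint) (auto simp: prod.reindex)
  have "?lhs = (\<integral>\<^sup>+\<omega>. (\<lambda>x. G (?X x) * ?H x (k + n)) (dist_seq \<omega>) *
      (\<Prod>i\<in>K. ennreal (exp (- (?c i (dist_seq \<omega>) * h (Suc i) \<omega>)))) \<partial>M)"
  proof (rule nn_integral_cong)
    fix \<omega>
    have "(\<Prod>i\<in>K. ennreal (exp (- (?c i (dist_seq \<omega>) * h (Suc i) \<omega>)))) =
      ennreal (exp (\<Sum>i\<in>K. - (?c i (dist_seq \<omega>) * h (Suc i) \<omega>)))"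
      using K by (simp add: prod_ennreal exp_sum)
    also have "(\<Sum>i\<in>K. - (?c i (dist_seq \<omega>) * h (Suc i) \<omega>)) = - (s (?X (dist_seq \<omega>)) * (\<Sum>i\<in>K. power_at i \<omega>))"
      by (simp add: sum_negf sum_distrib_left received_power_def mult_ac)
    finally show "G (?X (dist_seq \<omega>)) *
      ennreal (exp (- (s (?X (dist_seq \<omega>)) * ((\<Sum>i\<in>J0. power_at i \<omega>) + (\<Sum>j<n. power_at (Suc (k + j)) \<omega>))))) *
      ?H (dist_seq \<omega>) (k + n) = (\<lambda>x. G (?X x) * ?H x (k + n)) (dist_seq \<omega>) *
      (\<Prod>i\<in>K. ennreal (exp (- (?c i (dist_seq \<omega>) * h (Suc i) \<omega>))))"
      unfolding sumK by (simp only: mult_ac)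
  qed
  also have "\<dots> = (\<integral>\<^sup>+\<omega>. (\<lambda>x. G (?X x) * ?H x (k + n)) (dist_seq \<omega>) * (\<Prod>i\<in>K. ennreal (1 / (1 + ?c i (dist_seq \<omega>)))) \<partial>M)"
  proof (rule nn_integral_gains[OF K])
    show "(\<lambda>x. G (?X x) * ?H x (k + n)) \<in> borel_measurable (borel_product UNIV)" by measurable
    show "?c i \<in> borel_measurable (borel_product UNIV)" for i by measurable
    show "0 \<le> ?c i x" for i x using s0 P_pos by simp
  qed
  also have "\<dots> = (\<integral>\<^sup>+\<omega>. (\<lambda>x. G x * (\<Prod>i\<in>J0. ennreal (1 / (1 + s x * P * x i powr (- \<eta>))))) (?X (dist_seq \<omega>)) *
      ((\<Prod>j<n. ennreal (1 / (1 + s (?X (dist_seq \<omega>)) * P * dist_seq \<omega> (Suc (k + j)) powr (- \<eta>)))) *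
       ennreal (exp (- interference_exponent lam \<eta> (s (?X (dist_seq \<omega>)) * P) (dist_seq \<omega> (k + n))))) \<partial>M)"
  proof (rule nn_integral_cong)
    fix \<omega>
    have "(\<Prod>i\<in>J0. ennreal (1 / (1 + s (?X (dist_seq \<omega>)) * P * ?X (dist_seq \<omega>) i powr (- \<eta>)))) =
      (\<Prod>i\<in>J0. ennreal (1 / (1 + s (?X (dist_seq \<omega>)) * P * dist_seq \<omega> i powr (- \<eta>))))"
      using J0 by (intro prod.cong refl) auto
    then show "(\<lambda>x. G (?X x) * ?H x (k + n)) (dist_seq \<omega>) * (\<Prod>i\<in>K. ennreal (1 / (1 + ?c i (dist_seq \<omega>)))) =
      (\<lambda>x. G x * (\<Prod>i\<in>J0. ennreal (1 / (1 + s x * P * x i powr (- \<eta>))))) (?X (dist_seq \<omega>)) *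
      ((\<Prod>j<n. ennreal (1 / (1 + s (?X (dist_seq \<omega>)) * P * dist_seq \<omega> (Suc (k + j)) powr (- \<eta>)))) *
       ennreal (exp (- interference_exponent lam \<eta> (s (?X (dist_seq \<omega>)) * P) (dist_seq \<omega> (k + n)))))"
      unfolding prodK by (simp only: mult_ac)
  qed
  also have "\<dots> = (\<integral>\<^sup>+\<omega>. (\<lambda>x. G x * (\<Prod>i\<in>J0. ennreal (1 / (1 + s x * P * x i powr (- \<eta>))))) (?X (dist_seq \<omega>)) *
       ennreal (exp (- interference_exponent lam \<eta> (s (?X (dist_seq \<omega>)) * P) (dist_seq \<omega> k))) \<partial>M)"
  proof (rule nn_integral_martingale[OF eta])
    show "(\<lambda>x. G x * (\<Prod>i\<in>J0. ennreal (1 / (1 + s x * P * x i powr (- \<eta>))))) \<in> borel_measurable (borel_product {..k})"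
    proof (intro borel_measurable_times_ennreal borel_measurable_prod_ennreal G)
      fix i assume "i \<in> J0"
      then have [measurable]: "(\<lambda>x. x i) \<in> borel_measurable (borel_product {..k})"
        using J0 by (intro measurable_component_singleton) auto
      show "(\<lambda>x. ennreal (1 / (1 + s x * P * x i powr (- \<eta>)))) \<in> borel_measurable (borel_product {..k})"
        using s by measurable
    qed
    show "(\<lambda>x. s x * P) \<in> borel_measurable (borel_product {..k})" using s by measurable
    show "0 \<le> s x * P" for x using s0 P_pos by simp
  qed
  also have "\<dots> = ?rhs"
  proof (rule nn_integral_cong)
    fix \<omega>
    have "(\<Prod>i\<in>J0. ennreal (1 / (1 + s (?X (dist_seq \<omega>)) * P * ?X (dist_seq \<omega>) i powr (- \<eta>)))) =
      (\<Prod>i\<in>J0. ennreal (1 / (1 + s (?X (dist_seq \<omega>)) * P * dist_seq \<omega> i powr (- \<eta>))))"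
      using J0 by (intro prod.cong refl) auto
    then show "(\<lambda>x. G x * (\<Prod>i\<in>J0. ennreal (1 / (1 + s x * P * x i powr (- \<eta>))))) (?X (dist_seq \<omega>)) *
       ennreal (exp (- interference_exponent lam \<eta> (s (?X (dist_seq \<omega>)) * P) (dist_seq \<omega> k))) =
      G (?X (dist_seq \<omega>)) *
      (\<Prod>i\<in>J0. ennreal (1 / (1 + s (?X (dist_seq \<omega>)) * P * dist_seq \<omega> i powr (- \<eta>)))) *
      ennreal (exp (- interference_exponent lam \<eta> (s (?X (dist_seq \<omega>)) * P) (dist_seq \<omega> k)))"
      by simp
  qed
  finally show ?thesis .
qed

text \<open>
  Almost sure convergence of the interference is read off its Laplace transform: letting the
  argument tend to \<open>0\<close>, the mass lost to divergence tends to \<open>0\<close>.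
\<close>
lemma AE_summable_interference:
  assumes tail: "{k<..} \<subseteq> J"
  shows "AE \<omega> in M. summable (\<lambda>j. power_at (Suc (k + j)) \<omega>)"
proof -
  let ?a = "\<lambda>\<omega> j. power_at (Suc (k + j)) \<omega>"
  have [measurable]: "power_at (Suc (k + j)) \<in> borel_measurable M" for j
    using tail by (intro measurable_power_at) auto
  note [measurable] = borel_measurable_interference_exponent[OF lam_pos eta]
  have pred [measurable]: "Measurable.pred M (\<lambda>\<omega>. summable (?a \<omega>))"
    unfolding summable_iff_convergent Cauchy_convergent_iff[symmetric] by measurable
  let ?H = "\<lambda>c \<omega>. ennreal (exp (- interference_exponent lam \<eta> (c * P) (dist_seq \<omega> k)))"
  have pos: "AE \<omega> in M. \<forall>j. 0 < ?a \<omega> j"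
    using AE_power_at_pos
  proof eventually_elim
    case (elim \<omega>)
    then show ?case using subsetD[OF tail] by simp
  qed
  have lower: "(\<integral>\<^sup>+\<omega>. ?H c \<omega> \<partial>M) \<le> (\<integral>\<^sup>+\<omega>. (if summable (?a \<omega>) then 1 else 0) \<partial>M)" if c: "c > 0" for c
  proof -
    \<comment> \<open>The pointwise limit of \<open>?W\<close>: if the positive terms are not
      summable, the partial sums tend to infinity and the exponential vanishes.\<close>
    let ?U = "\<lambda>\<omega>. if summable (?a \<omega>) then ennreal (exp (- (c * suminf (?a \<omega>)))) else 0"
    let ?W = "\<lambda>n \<omega>. ennreal (exp (- (c * (\<Sum>j<n. ?a \<omega> j))))"
    have "(\<lambda>n. \<integral>\<^sup>+\<omega>. ?W n \<omega> \<partial>M) \<longlonglongrightarrow> (\<integral>\<^sup>+\<omega>. ?U \<omega> \<partial>M)"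
    proof (rule nn_integral_dominated_convergence[where w = "\<lambda>_. 1"])
      show "AE \<omega> in M. ?W n \<omega> \<le> 1" for n
        using pos
      proof eventually_elim
        case (elim \<omega>)
        then have "0 \<le> (\<Sum>j<n. ?a \<omega> j)" by (simp add: sum_nonneg less_imp_le)
        then show ?case using c by (simp add: ennreal_le_1)
      qed
      show "AE \<omega> in M. (\<lambda>n. ?W n \<omega>) \<longlonglongrightarrow> ?U \<omega>"
        using pos
      proof eventually_elim
        case (elim \<omega>)
        show ?case
        proof (cases "summable (?a \<omega>)")
          case True
          then have "(\<lambda>n. \<Sum>j<n. ?a \<omega> j) \<longlonglongrightarrow> suminf (?a \<omega>)" by (rule summable_LIMSEQ)
          then show ?thesis using True by (auto intro!: tendsto_ennrealI tendsto_intros)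
        next
          case False
          have "filterlim (\<lambda>n. \<Sum>j<n. ?a \<omega> j) at_top sequentially"
            unfolding filterlim_at_top
          proof
            fix B
            have "\<exists>n. B \<le> (\<Sum>j<n. ?a \<omega> j)"
            proof (rule ccontr)
              assume "\<nexists>n. B \<le> (\<Sum>j<n. ?a \<omega> j)"
              then have "\<And>n. (\<Sum>j<n. ?a \<omega> j) \<le> B" by (meson le_cases)
              then have "summable (?a \<omega>)"
                using elim by (intro summableI_nonneg_bounded[of _ B]) (auto intro: less_imp_le)
              then show False using False by simp
            qed
            then obtain n where n: "B \<le> (\<Sum>j<n. ?a \<omega> j)" ..
            have "B \<le> (\<Sum>j<m. ?a \<omega> j)" if "m \<ge> n" for m
              using n sum_mono2[of "{..<m}" "{..<n}" "?a \<omega>"] that elim by (force intro: less_imp_le)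
            then show "\<forall>\<^sub>F n in sequentially. B \<le> (\<Sum>j<n. ?a \<omega> j)"
              unfolding eventually_sequentially by blast
          qed
          then have "filterlim (\<lambda>n. c * (\<Sum>j<n. ?a \<omega> j)) at_top sequentially"
            using c by (intro filterlim_tendsto_pos_mult_at_top[OF tendsto_const]) auto
          then have "filterlim (\<lambda>n. - (c * (\<Sum>j<n. ?a \<omega> j))) at_bot sequentially"
            by (simp add: filterlim_uminus_at_bot)
          then have "(\<lambda>n. exp (- (c * (\<Sum>j<n. ?a \<omega> j)))) \<longlonglongrightarrow> 0"
            by (rule filterlim_compose[OF exp_at_bot])
          then have "(\<lambda>n. ennreal (exp (- (c * (\<Sum>j<n. ?a \<omega> j))))) \<longlonglongrightarrow> ennreal 0"
            by (rule tendsto_ennrealI)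
          then show ?thesis using False by simp
        qed
      qed
    qed (auto simp: emeasure_space_1)
    \<comment> \<open>The truncated identity, with the H factor at the last radius estimated by
      1.\<close>
    moreover have "(\<integral>\<^sup>+\<omega>. ?H c \<omega> \<partial>M) \<le> (\<integral>\<^sup>+\<omega>. ?W n \<omega> \<partial>M)" for n
    proof -
      have "(\<integral>\<^sup>+\<omega>. ?H c \<omega> \<partial>M) = (\<integral>\<^sup>+\<omega>. ?W n \<omega> * ennreal (exp (- interference_exponent lam \<eta> (c * P) (dist_seq \<omega> (k + n)))) \<partial>M)"
        using nn_integral_partial_interference[of "{}" k "\<lambda>_. 1" "\<lambda>_. c" n] tail c by simp
      also have "\<dots> \<le> (\<integral>\<^sup>+\<omega>. ?W n \<omega> * 1 \<partial>M)"
        using interference_exponent_nonneg[OF lam_pos eta]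
        by (intro nn_integral_mono mult_left_mono) (auto simp: ennreal_le_1)
      finally show ?thesis by simp
    qed
    ultimately have "(\<integral>\<^sup>+\<omega>. ?H c \<omega> \<partial>M) \<le> (\<integral>\<^sup>+\<omega>. ?U \<omega> \<partial>M)"
      by (intro LIMSEQ_le_const) auto
    also have "\<dots> \<le> (\<integral>\<^sup>+\<omega>. (if summable (?a \<omega>) then 1 else 0) \<partial>M)"
    proof (rule nn_integral_mono_AE, use pos in eventually_elim)
      case (elim \<omega>)
      then have "0 \<le> suminf (?a \<omega>)" if "summable (?a \<omega>)"
        using that by (intro suminf_nonneg) (auto intro: less_imp_le)
      then show ?case using c by (simp add: ennreal_le_1)
    qed
    finally show ?thesis .
  qed
  \<comment> \<open>Along \<open>c = 1 / (n + 1)\<close> the exponent is squeezed to 0 by its linear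
    bound, so the lower bounds increase to full probability.\<close>
  have "(\<lambda>n. \<integral>\<^sup>+\<omega>. ?H (1 / real (Suc n)) \<omega> \<partial>M) \<longlonglongrightarrow> (\<integral>\<^sup>+\<omega>. 1 \<partial>M)"
  proof (rule nn_integral_dominated_convergence[where w = "\<lambda>_. 1"])
    show "AE \<omega> in M. ?H (1 / real (Suc n)) \<omega> \<le> 1" for n
      using interference_exponent_nonneg[OF lam_pos eta] by (auto simp: ennreal_le_1)
    show "AE \<omega> in M. (\<lambda>n. ?H (1 / real (Suc n)) \<omega>) \<longlonglongrightarrow> 1"
    proof (rule AE_I2)
      fix \<omega>
      let ?D = "\<lambda>n. interference_exponent lam \<eta> (1 / real (Suc n) * P) (dist_seq \<omega> k)"
      have "?D \<longlonglongrightarrow> 0"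
      proof (rule tendsto_sandwich[OF _ _ tendsto_const])
        show "\<forall>\<^sub>F n in sequentially. ?D n \<le> 2 * pi * lam / (\<eta> - 2) * (1 / real (Suc n) * P * dist_seq \<omega> k powr (2 - \<eta>))"
          using P_pos by (intro always_eventually allI interference_exponent_le[OF lam_pos eta]) simp
        have "(\<lambda>n. 2 * pi * lam / (\<eta> - 2) * (1 / real (Suc n) * P * dist_seq \<omega> k powr (2 - \<eta>))) \<longlonglongrightarrow>
          2 * pi * lam / (\<eta> - 2) * (0 * P * dist_seq \<omega> k powr (2 - \<eta>))"
          by (intro tendsto_intros LIMSEQ_Suc[OF lim_1_over_n])
        then show "(\<lambda>n. 2 * pi * lam / (\<eta> - 2) * (1 / real (Suc n) * P * dist_seq \<omega> k powr (2 - \<eta>))) \<longlonglongrightarrow> 0"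
          by simp
      qed (use interference_exponent_nonneg[OF lam_pos eta] in auto)
      then have "(\<lambda>n. ennreal (exp (- ?D n))) \<longlonglongrightarrow> ennreal (exp (- 0))"
        by (intro tendsto_ennrealI tendsto_intros)
      then show "(\<lambda>n. ?H (1 / real (Suc n)) \<omega>) \<longlonglongrightarrow> 1" by simp
    qed
  qed (auto simp: emeasure_space_1)
  then have "(\<lambda>n. \<integral>\<^sup>+\<omega>. ?H (1 / real (Suc n)) \<omega> \<partial>M) \<longlonglongrightarrow> 1"
    by (simp add: emeasure_space_1)
  then have "1 \<le> (\<integral>\<^sup>+\<omega>. (if summable (?a \<omega>) then 1 else 0) \<partial>M)"
    by (rule LIMSEQ_le_const2) (intro exI[of _ 0] allI impI lower, simp)
  also have "\<dots> = (\<integral>\<^sup>+\<omega>. indicator {\<omega> \<in> space M. summable (?a \<omega>)} \<omega> \<partial>M)"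
    by (intro nn_integral_cong) (simp split: split_indicator)
  also have "\<dots> = emeasure M {\<omega> \<in> space M. summable (?a \<omega>)}"
    by (rule nn_integral_indicator) measurable
  finally have "prob {\<omega> \<in> space M. summable (?a \<omega>)} = 1"
    using prob_le_1[of "{\<omega> \<in> space M. summable (?a \<omega>)}"] by (simp add: emeasure_eq_measure)
  from AE_prob_1[OF this] show ?thesis by eventually_elim simp
qed

lemma measurable_interference_from:
  "{k<..} \<subseteq> J \<Longrightarrow> interference_from P \<eta> \<Phi> h (k + 2) \<in> borel_measurable M"
  unfolding interference_from_def by (intro borel_measurable_suminf) (use measurable_power_at[of "Suc (k + _)"] in \<open>simp add: subset_iff\<close>)

text \<open>\<open>power_at\<close> is zero-based and \<open>interference_from\<close> one-based:
  the first station beyond zero-based index \<open>k\<close> has one-based index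
  \<open>k + 2\<close>.\<close>

lemma interference_from_eq: "interference_from P \<eta> \<Phi> h (k + 2) \<omega> = (\<Sum>j. power_at (Suc (k + j)) \<omega>)"
  by (simp add: interference_from_def)

text \<open>The expectation of \<open>exp (- s (I + N))\<close> after all gains and all stations
  beyond \<open>k\<close> have been integrated out. \<open>J0\<close> lists the interferers among
  the first \<open>k + 1\<close> stations, and \<open>s\<close> may depend on the distances of the
  latter.\<close>

abbreviation laplace_value :: "nat set \<Rightarrow> nat \<Rightarrow> ((nat \<Rightarrow> real) \<Rightarrow> real) \<Rightarrow> real \<Rightarrow> ennreal" where
  "laplace_value J0 k s N \<equiv> (\<integral>\<^sup>+\<omega>. ennreal (exp (- (s (nearest k \<omega>) * N))) *
      (\<Prod>i\<in>J0. ennreal (1 / (1 + s (nearest k \<omega>) * P * dist_seq \<omega> i powr (- \<eta>)))) *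
      ennreal (exp (- interference_exponent lam \<eta> (s (nearest k \<omega>) * P) (dist_seq \<omega> k))) \<partial>M)"

text \<open>Limit of the truncated identity, dominated by 1: the partial sums converge almost
  surely, and H tends to 1 because the distances tend to infinity.\<close>

lemma nn_integral_interference:
  assumes J0: "J0 \<subseteq> {..k}" "J0 \<subseteq> J" and tail: "{k<..} \<subseteq> J" and N: "0 \<le> N"
    and s: "s \<in> borel_measurable (borel_product {..k})" and s0: "\<And>x. 0 \<le> s x"
  shows "(\<integral>\<^sup>+\<omega>. ennreal (exp (- (s (nearest k \<omega>) *
        ((\<Sum>i\<in>J0. power_at i \<omega>) + interference_from P \<eta> \<Phi> h (k + 2) \<omega> + N)))) \<partial>M) =
    laplace_value J0 k s N"
proof -
  let ?X = "\<lambda>\<omega>. nearest k \<omega>"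
  let ?a = "\<lambda>\<omega> j. power_at (Suc (k + j)) \<omega>"
  let ?u = "\<lambda>n \<omega>. ennreal (exp (- (s (?X \<omega>) * N))) *
      ennreal (exp (- (s (?X \<omega>) * ((\<Sum>i\<in>J0. power_at i \<omega>) + (\<Sum>j<n. ?a \<omega> j))))) *
      ennreal (exp (- interference_exponent lam \<eta> (s (?X \<omega>) * P) (dist_seq \<omega> (k + n))))"
  have a_meas [measurable]: "power_at (Suc (k + j)) \<in> borel_measurable M" for j
    using tail by (intro measurable_power_at) auto
  have [measurable]: "power_at i \<in> borel_measurable M" if "i \<in> J0" for i
    using that J0 by (intro measurable_power_at) auto
  note [measurable] = borel_measurable_interference_exponent[OF lam_pos eta]
    measurable_compose[OF measurable_restrict_dist_seq s] measurable_interference_from[OF tail]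
  have [measurable]: "(\<lambda>\<omega>. \<Sum>i\<in>J0. power_at i \<omega>) \<in> borel_measurable M"
    by (rule borel_measurable_sum) measurable
  have limit_meas: "(\<lambda>\<omega>. ennreal (exp (- (s (?X \<omega>) *
        ((\<Sum>i\<in>J0. power_at i \<omega>) + interference_from P \<eta> \<Phi> h (k + 2) \<omega> + N))))) \<in> borel_measurable M"
    by measurable
  have "(\<lambda>n. \<integral>\<^sup>+\<omega>. ?u n \<omega> \<partial>M) \<longlonglongrightarrow> (\<integral>\<^sup>+\<omega>. ennreal (exp (- (s (?X \<omega>) *
        ((\<Sum>i\<in>J0. power_at i \<omega>) + interference_from P \<eta> \<Phi> h (k + 2) \<omega> + N)))) \<partial>M)"
  proof (rule nn_integral_dominated_convergence[where w = "\<lambda>_. 1"])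
    show "AE \<omega> in M. ?u n \<omega> \<le> 1" for n
      using AE_power_at_pos
    proof eventually_elim
      case (elim \<omega>)
      have "0 < power_at i \<omega>" if "i \<in> J0" for i using elim J0 that by blast
      moreover have "0 < ?a \<omega> j" for j using elim subsetD[OF tail] by simp
      ultimately have "0 \<le> (\<Sum>i\<in>J0. power_at i \<omega>)" "0 \<le> (\<Sum>j<n. ?a \<omega> j)"
        by (simp_all add: sum_nonneg less_imp_le)
      then show ?case
        using N s0[of "?X \<omega>"] interference_exponent_nonneg[OF lam_pos eta, of "s (?X \<omega>) * P"]
        by (intro mult_le_one) (auto simp: ennreal_le_1)
    qed
    show "AE \<omega> in M. (\<lambda>n. ?u n \<omega>) \<longlonglongrightarrow> ennreal (exp (- (s (?X \<omega>) *
        ((\<Sum>i\<in>J0. power_at i \<omega>) + interference_from P \<eta> \<Phi> h (k + 2) \<omega> + N))))"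
      using AE_summable_interference[OF tail] AE_dist_seq_at_top
    proof eventually_elim
      case (elim \<omega>)
      let ?D = "\<lambda>n. interference_exponent lam \<eta> (s (?X \<omega>) * P) (dist_seq \<omega> (k + n))"
      have "?D \<longlonglongrightarrow> 0"
      proof (rule tendsto_sandwich[OF _ _ tendsto_const])
        show "\<forall>\<^sub>F n in sequentially. ?D n \<le> 2 * pi * lam / (\<eta> - 2) * (s (?X \<omega>) * P * dist_seq \<omega> (k + n) powr (2 - \<eta>))"
          using P_pos s0 by (intro always_eventually allI interference_exponent_le[OF lam_pos eta]) simp
        have "filterlim (\<lambda>n. dist_seq \<omega> (n + k)) at_top sequentially"
          using elim(2) by (rule filterlim_compose) (rule filterlim_add_const_nat_at_top)
        then have "(\<lambda>n. dist_seq \<omega> (k + n) powr (2 - \<eta>)) \<longlonglongrightarrow> 0"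
          using eta by (intro tendsto_neg_powr) (auto simp: add.commute)
        then have "(\<lambda>n. 2 * pi * lam / (\<eta> - 2) * (s (?X \<omega>) * P * dist_seq \<omega> (k + n) powr (2 - \<eta>))) \<longlonglongrightarrow>
          2 * pi * lam / (\<eta> - 2) * (s (?X \<omega>) * P * 0)"
          by (intro tendsto_intros)
        then show "(\<lambda>n. 2 * pi * lam / (\<eta> - 2) * (s (?X \<omega>) * P * dist_seq \<omega> (k + n) powr (2 - \<eta>))) \<longlonglongrightarrow> 0"
          by simp
      qed (use interference_exponent_nonneg[OF lam_pos eta] in auto)
      moreover have "(\<lambda>n. \<Sum>j<n. ?a \<omega> j) \<longlonglongrightarrow> interference_from P \<eta> \<Phi> h (k + 2) \<omega>"
        unfolding interference_from_eq using elim(1) by (rule summable_LIMSEQ)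
      ultimately have lim: "(\<lambda>n. ennreal (exp (- (s (?X \<omega>) * N) - (s (?X \<omega>) * ((\<Sum>i\<in>J0. power_at i \<omega>) + (\<Sum>j<n. ?a \<omega> j))) - ?D n))) \<longlonglongrightarrow>
        ennreal (exp (- (s (?X \<omega>) * N) - (s (?X \<omega>) * ((\<Sum>i\<in>J0. power_at i \<omega>) + interference_from P \<eta> \<Phi> h (k + 2) \<omega>)) - 0))"
        by (intro tendsto_ennrealI tendsto_intros)
      have split: "ennreal (exp (- A - B - D)) = ennreal (exp (- A)) * ennreal (exp (- B)) * ennreal (exp (- D))" for A B D :: real
        by (simp add: ennreal_mult''[symmetric] mult_exp_exp)
      have limit_eq: "- (s (?X \<omega>) * N) - (s (?X \<omega>) * ((\<Sum>i\<in>J0. power_at i \<omega>) + interference_from P \<eta> \<Phi> h (k + 2) \<omega>)) - 0 =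
        - (s (?X \<omega>) * ((\<Sum>i\<in>J0. power_at i \<omega>) + interference_from P \<eta> \<Phi> h (k + 2) \<omega> + N))"
        by (simp add: algebra_simps)
      show ?case using lim unfolding limit_eq split .
    qed
    show "?u n \<in> borel_measurable M" for n by measurable
  qed (use limit_meas in \<open>auto simp: emeasure_space_1\<close>)
  moreover have "(\<integral>\<^sup>+\<omega>. ?u n \<omega> \<partial>M) = (\<integral>\<^sup>+\<omega>. ennreal (exp (- (s (?X \<omega>) * N))) *
      (\<Prod>i\<in>J0. ennreal (1 / (1 + s (?X \<omega>) * P * dist_seq \<omega> i powr (- \<eta>)))) *
      ennreal (exp (- interference_exponent lam \<eta> (s (?X \<omega>) * P) (dist_seq \<omega> k))) \<partial>M)" for n
    by (rule nn_integral_partial_interference[OF J0 tail _ s s0, where G = "\<lambda>x. ennreal (exp (- (s x * N)))"])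
       (use s in measurable)
  ultimately show ?thesis
    by (simp add: LIMSEQ_const_iff)
qed

text \<open>Given positions and interference, the signal exceeds \<open>T\<close> times the
  denominator with an exponential probability, so coverage becomes a Laplace transform. The
  hypothesis \<open>signal\<close> captures what single and joint transmission share;
  \<open>Y\<close> is the randomness of the serving link.\<close>

lemma emeasure_coverage:
  fixes sig :: "(nat \<Rightarrow> real) \<Rightarrow> (source \<Rightarrow> nat \<Rightarrow> real) \<Rightarrow> real"
  assumes J0: "J0 \<subseteq> {..k}" "J0 \<subseteq> J" and tail: "{k<..} \<subseteq> J" and N: "0 \<le> N"
    and s: "s \<in> borel_measurable (borel_product {..k})" and s0: "\<And>x. 0 \<le> s x"
    and sig [measurable]: "(\<lambda>(x, y). sig x y) \<in> borel_measurable (borel_product UNIV \<Otimes>\<^sub>M S)"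
    and ind: "indep_var (PiM (insert Process (Gain ` Suc ` J)) (\<lambda>_. borel_product UNIV))
      (\<lambda>\<omega>. restrict (\<lambda>i. source_value \<Phi> h g i \<omega>) (insert Process (Gain ` Suc ` J))) S Y"
    and signal: "\<And>x c. (\<And>i. 0 < x i) \<Longrightarrow> 0 \<le> c \<Longrightarrow>
      emeasure M {\<omega> \<in> space M. T * c < sig x (Y \<omega>)} = ennreal (exp (- (s (restrict x {..k}) * c)))"
  shows "emeasure M {\<omega> \<in> space M. T <
      sig (dist_seq \<omega>) (Y \<omega>) / ((\<Sum>i\<in>J0. power_at i \<omega>) + interference_from P \<eta> \<Phi> h (k + 2) \<omega> + N)} =
    laplace_value J0 k s N"
proof -
  let ?S = "borel_product UNIV :: (nat \<Rightarrow> real) measure"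
  let ?A = "insert Process (Gain ` Suc ` J)"
  let ?R = "\<lambda>\<omega>. restrict (\<lambda>i. source_value \<Phi> h g i \<omega>) ?A"
  let ?B = "PiM ?A (\<lambda>_. ?S)"
  \<comment> \<open>The interference is rebuilt from the vector of sources, so that the coverage
    event is a function of the independent pair \<open>?R\<close> and \<open>Y\<close>.\<close>
  define pw where "pw i v = P * v (Gain (Suc i)) 0 * v Process i powr (- \<eta>)" for i and v :: "source \<Rightarrow> nat \<Rightarrow> real"
  define tot where "tot v = (\<Sum>i\<in>J0. pw i v) + (\<Sum>j. pw (Suc (k + j)) v) + N" for v
  let ?I = "\<lambda>\<omega>. (\<Sum>i\<in>J0. power_at i \<omega>) + interference_from P \<eta> \<Phi> h (k + 2) \<omega> + N"
  have kJ: "Suc (k + j) \<in> J" for j using subsetD[OF tail] by simp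
  have proc [measurable]: "(\<lambda>v. v Process) \<in> measurable ?B ?S"
    by (rule measurable_component_singleton) simp
  have coord: "(\<lambda>x. x i) \<in> borel_measurable ?S" for i by simp
  have pw_meas: "pw i \<in> borel_measurable ?B" if "i \<in> J" for i
  proof -
    have "(\<lambda>v. v (Gain (Suc i))) \<in> measurable ?B ?S"
      using that by (intro measurable_component_singleton) auto
    note [measurable] = measurable_compose[OF this coord] measurable_compose[OF proc coord]
    show ?thesis unfolding pw_def[abs_def] by measurable
  qed
  have [measurable]: "tot \<in> borel_measurable ?B"
    unfolding tot_def[abs_def] using pw_meas J0 kJ
    by (intro borel_measurable_add borel_measurable_sum borel_measurable_suminf borel_measurable_const) auto
  have pw: "pw i (?R \<omega>) = power_at i \<omega>" if "i \<in> J" for i \<omega>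
    using that by (simp add: pw_def received_power_def)
  have tot: "tot (?R \<omega>) = ?I \<omega>" for \<omega>
  proof -
    have "(\<Sum>i\<in>J0. pw i (?R \<omega>)) = (\<Sum>i\<in>J0. power_at i \<omega>)"
      using J0 by (intro sum.cong refl pw) auto
    moreover have "pw (Suc (k + j)) (?R \<omega>) = power_at (Suc (k + j)) \<omega>" for j
      by (rule pw[OF kJ])
    ultimately show ?thesis unfolding tot_def interference_from_eq by simp
  qed
  have procR: "?R \<omega> Process = dist_seq \<omega>" for \<omega> by (simp add: fun_eq_iff)
  have R [measurable]: "?R \<in> measurable M ?B" and Y [measurable]: "Y \<in> measurable M S"
    using indep_var_rv1[OF ind] indep_var_rv2[OF ind] by auto
  have "(\<lambda>\<omega>. ?R \<omega> Process) \<in> measurable M ?S"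
    by (rule measurable_compose[OF R proc])
  then have D [measurable]: "dist_seq \<in> measurable M ?S" unfolding procR .
  have "(\<lambda>\<omega>. tot (?R \<omega>)) \<in> borel_measurable M" by measurable
  then have I_meas [measurable]: "?I \<in> borel_measurable M" unfolding tot .
  have [measurable]: "(\<lambda>\<omega>. sig (dist_seq \<omega>) (Y \<omega>)) \<in> borel_measurable M"
    using measurable_compose[OF measurable_Pair[OF D Y] sig] by simp
  \<comment> \<open>Clearing the fraction requires a positive denominator. The gains in the tail are
    positive, so this holds even for \<open>N = 0\<close> and empty \<open>J0\<close>.\<close>
  have Ipos: "AE \<omega> in M. 0 < ?I \<omega>"
    using AE_power_at_pos AE_summable_interference[OF tail]
  proof eventually_elim
    case (elim \<omega>)
    have "0 \<le> (\<Sum>i\<in>J0. power_at i \<omega>)" using elim(1) J0 by (intro sum_nonneg) (auto intro: less_imp_le)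
    moreover have "0 < interference_from P \<eta> \<Phi> h (k + 2) \<omega>"
      unfolding interference_from_eq using elim kJ by (intro suminf_pos) auto
    ultimately show ?case using N by linarith
  qed
  let ?f = "\<lambda>(v, y). if T * tot v < sig (v Process) y then 1 else 0 :: ennreal"
  have f: "?f \<in> borel_measurable (?B \<Otimes>\<^sub>M S)"
  proof -
    have "(\<lambda>(v, y). (v Process, y)) \<in> measurable (?B \<Otimes>\<^sub>M S) (?S \<Otimes>\<^sub>M S)" by measurable
    from measurable_compose[OF this sig]
    have [measurable]: "(\<lambda>z. sig (fst z Process) (snd z)) \<in> borel_measurable (?B \<Otimes>\<^sub>M S)"
      by (simp add: split_beta')
    show ?thesis unfolding split_beta' by measurable
  qed
  have "emeasure M {\<omega> \<in> space M. T < sig (dist_seq \<omega>) (Y \<omega>) / ?I \<omega>} =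
    emeasure M {\<omega> \<in> space M. T * ?I \<omega> < sig (dist_seq \<omega>) (Y \<omega>)}"
  proof (rule emeasure_eq_AE)
    show "AE \<omega> in M. \<omega> \<in> {\<omega> \<in> space M. T < sig (dist_seq \<omega>) (Y \<omega>) / ?I \<omega>} \<longleftrightarrow>
      \<omega> \<in> {\<omega> \<in> space M. T * ?I \<omega> < sig (dist_seq \<omega>) (Y \<omega>)}"
      using Ipos by eventually_elim (simp add: pos_less_divide_eq)
  qed measurable
  also have "\<dots> = (\<integral>\<^sup>+\<omega>. indicator {\<omega> \<in> space M. T * ?I \<omega> < sig (dist_seq \<omega>) (Y \<omega>)} \<omega> \<partial>M)"
    by (rule nn_integral_indicator[symmetric]) measurable
  also have "\<dots> = (\<integral>\<^sup>+\<omega>. ?f (?R \<omega>, Y \<omega>) \<partial>M)"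
    by (rule nn_integral_cong) (simp only: prod.case tot procR, simp split: split_indicator)
  also have "\<dots> = (\<integral>\<^sup>+\<omega>. (\<integral>\<^sup>+\<omega>'. ?f (?R \<omega>, Y \<omega>') \<partial>M) \<partial>M)"
    by (rule nn_integral_indep_var[OF ind f])
  also have "\<dots> = (\<integral>\<^sup>+\<omega>. ennreal (exp (- (s (nearest k \<omega>) * ?I \<omega>))) \<partial>M)"
  proof (rule nn_integral_cong_AE, use Ipos AE_dist_seq_pos AE_space in eventually_elim)
    case (elim \<omega>)
    have [measurable]: "sig (dist_seq \<omega>) \<in> borel_measurable S"
      using measurable_compose[OF measurable_Pair1'[of "dist_seq \<omega>"] sig]
      by (simp add: space_PiM)
    have "(\<integral>\<^sup>+\<omega>'. ?f (?R \<omega>, Y \<omega>') \<partial>M) =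
      (\<integral>\<^sup>+\<omega>'. indicator {\<omega>' \<in> space M. T * ?I \<omega> < sig (dist_seq \<omega>) (Y \<omega>')} \<omega>' \<partial>M)"
      by (rule nn_integral_cong) (simp only: prod.case tot procR, simp split: split_indicator)
    also have "\<dots> = emeasure M {\<omega>' \<in> space M. T * ?I \<omega> < sig (dist_seq \<omega>) (Y \<omega>')}"
      by (rule nn_integral_indicator) measurable
    also have "\<dots> = ennreal (exp (- (s (nearest k \<omega>) * ?I \<omega>)))"
      using elim by (intro signal) auto
    finally show ?case .
  qed
  also have "\<dots> = laplace_value J0 k s N"
    by (rule nn_integral_interference[OF J0 tail N s s0])
  finally show ?thesis .
qed

end

subsection \<open>Joint densities of the first three distances\<close>

context poisson_network
begin

lemma nn_integral_dist1:
  assumes f: "f \<in> borel_measurable borel"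
  shows "(\<integral>\<^sup>+\<omega>. f (dist_seq \<omega> 0) \<partial>M) =
    (\<integral>\<^sup>+x. (if 0 < x then ennreal (2 * pi * lam * x * exp (- (lam * pi * x\<^sup>2))) else 0) * f x \<partial>lborel)"
proof -
  note [measurable] = f
  have "(\<integral>\<^sup>+\<omega>. (\<lambda>x. f (x 0)) (nearest 0 \<omega>) \<partial>M) =
    (\<integral>\<^sup>+x. ordered_density lam 0 x * f (x 0) \<partial>PiM {..0} (\<lambda>_. radial_intensity lam))"
    by (rule nn_integral_dist_seq) measurable
  also have "\<dots> = (\<integral>\<^sup>+x. (if 0 < x 0 then ennreal (exp (- (lam * pi * (x 0)\<^sup>2))) else 0) * f (x 0) \<partial>PiM {0::nat} (\<lambda>_. radial_intensity lam))"
    unfolding atMost_0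
    by (intro nn_integral_cong)
       (auto simp: ordered_density_def increasing_seqs_def space_PiM PiE_def split: split_indicator)
  also have "\<dots> = (\<integral>\<^sup>+x. (if 0 < x then ennreal (exp (- (lam * pi * x\<^sup>2))) else 0) * f x \<partial>radial_intensity lam)"
    by (rule radial.product_nn_integral_singleton[where f = "\<lambda>x. (if 0 < x then ennreal (exp (- (lam * pi * x\<^sup>2))) else 0) * f x"]) measurable
  also have "\<dots> = (\<integral>\<^sup>+x. ennreal (2 * pi * lam * x) * ((if 0 < x then ennreal (exp (- (lam * pi * x\<^sup>2))) else 0) * f x) \<partial>lborel)"
    by (rule nn_integral_radial_intensity) measurable
  also have "\<dots> = (\<integral>\<^sup>+x. (if 0 < x then ennreal (2 * pi * lam * x * exp (- (lam * pi * x\<^sup>2))) else 0) * f x \<partial>lborel)"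
    by (intro nn_integral_cong) (simp add: ennreal_mult''[symmetric] mult.assoc[symmetric])
  finally show ?thesis by simp
qed

lemma nn_integral_next_radius:
  assumes f [measurable]: "f \<in> borel_measurable borel"
  shows "(\<integral>\<^sup>+y. indicator {x<..} y * ennreal (exp (lam * pi * x\<^sup>2 - lam * pi * y\<^sup>2)) * f y \<partial>radial_intensity lam) =
    (\<integral>\<^sup>+y. (if x < y then ennreal (2 * pi * lam * y * exp (lam * pi * x\<^sup>2 - lam * pi * y\<^sup>2)) else 0) * f y \<partial>lborel)"
  by (subst nn_integral_radial_intensity)
     (auto intro!: nn_integral_cong simp: ennreal_mult''[symmetric] mult.assoc[symmetric])

text \<open>The accumulated factor \<open>exp (- (lam * pi * x\<^sup>2))\<close> cancels against the
  kernel, so only the outermost radius stays in the exponent.\<close>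

lemma nn_integral_append_radius:
  assumes f [measurable]: "f \<in> borel_measurable borel" and a: "0 \<le> a"
  shows "ennreal (a * exp (- (lam * pi * x\<^sup>2))) *
      (\<integral>\<^sup>+y. (if x < y then ennreal (2 * pi * lam * y * exp (lam * pi * x\<^sup>2 - lam * pi * y\<^sup>2)) else 0) * f y \<partial>lborel) =
    (\<integral>\<^sup>+y. (if x < y then ennreal (a * (2 * pi * lam * y) * exp (- (lam * pi * y\<^sup>2))) else 0) * f y \<partial>lborel)"
    (is "ennreal ?a * _ = _")
proof -
  have "?a * (2 * pi * lam * y * exp (lam * pi * x\<^sup>2 - lam * pi * y\<^sup>2)) =
      a * (2 * pi * lam * y) * (exp (- (lam * pi * x\<^sup>2)) * exp (lam * pi * x\<^sup>2 - lam * pi * y\<^sup>2))" for y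
    by simp
  then have eq: "?a * (2 * pi * lam * y * exp (lam * pi * x\<^sup>2 - lam * pi * y\<^sup>2)) = a * (2 * pi * lam * y) * exp (- (lam * pi * y\<^sup>2))" for y
    by (simp add: mult_exp_exp)
  have "0 \<le> ?a" using a by simp
  then have prod: "ennreal ?a * ennreal (2 * pi * lam * y * exp (lam * pi * x\<^sup>2 - lam * pi * y\<^sup>2)) =
      ennreal (a * (2 * pi * lam * y) * exp (- (lam * pi * y\<^sup>2)))" for y
    by (simp only: ennreal_mult'[symmetric] eq)
  have "ennreal ?a * ((if x < y then ennreal (2 * pi * lam * y * exp (lam * pi * x\<^sup>2 - lam * pi * y\<^sup>2)) else 0) * f y) =
      (if x < y then ennreal (a * (2 * pi * lam * y) * exp (- (lam * pi * y\<^sup>2))) else 0) * f y" for y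
    unfolding prod[symmetric] by (cases "x < y") (simp_all only: if_True if_False mult_zero_left mult_zero_right mult.assoc)
  then show ?thesis
    by (subst nn_integral_cmult[symmetric]) simp_all
qed

lemma nn_integral_dist2:
  assumes f: "(\<lambda>(x, y). f x y) \<in> borel_measurable (borel \<Otimes>\<^sub>M borel)"
  shows "(\<integral>\<^sup>+\<omega>. f (dist_seq \<omega> 0) (dist_seq \<omega> 1) \<partial>M) =
    (\<integral>\<^sup>+x. (\<integral>\<^sup>+y. (if 0 < x \<and> x < y then ennreal (2 * pi * lam * x * (2 * pi * lam * y) * exp (- (lam * pi * y\<^sup>2))) else 0)
      * f x y \<partial>lborel) \<partial>lborel)"
proof -
  have f1: "(\<lambda>z. f (fst z) (snd z)) \<in> borel_measurable (borel \<Otimes>\<^sub>M borel)"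
    using f by (simp add: split_beta')
  have f2: "f x \<in> borel_measurable borel" for x
    using measurable_compose[OF measurable_Pair1' f, of x] by simp
  have f3: "(\<lambda>x. f (x 0) (x (Suc 0))) \<in> borel_measurable (PiM {..Suc 0} (\<lambda>_. borel))"
  proof -
    have "(\<lambda>x. (x 0, x (Suc 0))) \<in> measurable (PiM {..Suc 0} (\<lambda>_. borel)) (borel \<Otimes>\<^sub>M borel)"
      by (intro measurable_Pair measurable_component_singleton) auto
    from measurable_compose[OF this f] show ?thesis by simp
  qed
  let ?F = "\<lambda>x. \<integral>\<^sup>+y. (if x < y then ennreal (2 * pi * lam * y * exp (lam * pi * x\<^sup>2 - lam * pi * y\<^sup>2)) else 0) * f x y \<partial>lborel"
  have F: "?F \<in> borel_measurable borel"
  proof (rule lborel.borel_measurable_nn_integral)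
    show "(\<lambda>(x, y). (if x < y then ennreal (2 * pi * lam * y * exp (lam * pi * x\<^sup>2 - lam * pi * y\<^sup>2)) else 0) * f x y) \<in> borel_measurable (borel \<Otimes>\<^sub>M lborel)"
      using f1 by (simp add: split_beta' cong: measurable_cong_sets)
  qed
  have "(\<integral>\<^sup>+\<omega>. (\<lambda>x. f (x 0) (x (Suc 0))) (restrict (dist_seq \<omega>) {..Suc 0}) \<partial>M) = (\<integral>\<^sup>+\<omega>. ?F (dist_seq \<omega> 0) \<partial>M)"
    unfolding nn_integral_dist_seq_markov[OF f3]
    by (simp add: nn_integral_next_radius[OF f2])
  also have "\<dots> = (\<integral>\<^sup>+x. (if 0 < x then ennreal (2 * pi * lam * x * exp (- (lam * pi * x\<^sup>2))) else 0) * ?F x \<partial>lborel)"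
    by (rule nn_integral_dist1[OF F])
  also have "\<dots> = (\<integral>\<^sup>+x. (\<integral>\<^sup>+y. (if 0 < x \<and> x < y then ennreal (2 * pi * lam * x * (2 * pi * lam * y) * exp (- (lam * pi * y\<^sup>2))) else 0)
      * f x y \<partial>lborel) \<partial>lborel)"
  proof (rule nn_integral_cong)
    fix x :: real
    show "(if 0 < x then ennreal (2 * pi * lam * x * exp (- (lam * pi * x\<^sup>2))) else 0) * ?F x =
      (\<integral>\<^sup>+y. (if 0 < x \<and> x < y then ennreal (2 * pi * lam * x * (2 * pi * lam * y) * exp (- (lam * pi * y\<^sup>2))) else 0)
      * f x y \<partial>lborel)"
    proof (cases "0 < x")
      case True
      then have "0 \<le> 2 * pi * lam * x" using lam_pos by simp
      from nn_integral_append_radius[OF f2 this] True show ?thesis by simp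
    qed simp
  qed
  finally show ?thesis by simp
qed

lemma nn_integral_dist3:
  assumes f: "(\<lambda>(x, y, z). f x y z) \<in> borel_measurable (borel \<Otimes>\<^sub>M borel \<Otimes>\<^sub>M borel)"
  shows "(\<integral>\<^sup>+\<omega>. f (dist_seq \<omega> 0) (dist_seq \<omega> 1) (dist_seq \<omega> 2) \<partial>M) =
    (\<integral>\<^sup>+x. (\<integral>\<^sup>+y. (\<integral>\<^sup>+z. (if 0 < x \<and> x < y \<and> y < z
        then ennreal (2 * pi * lam * x * (2 * pi * lam * y) * (2 * pi * lam * z) * exp (- (lam * pi * z\<^sup>2))) else 0)
      * f x y z \<partial>lborel) \<partial>lborel) \<partial>lborel)"
proof -
  have f1: "(\<lambda>w. f (fst (fst w)) (snd (fst w)) (snd w)) \<in> borel_measurable ((borel \<Otimes>\<^sub>M borel) \<Otimes>\<^sub>M borel)"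
  proof -
    have "(\<lambda>w. (fst (fst w), snd (fst w), snd w)) \<in> measurable ((borel \<Otimes>\<^sub>M borel) \<Otimes>\<^sub>M borel) (borel \<Otimes>\<^sub>M borel \<Otimes>\<^sub>M borel)"
      by measurable
    from measurable_compose[OF this f] show ?thesis by simp
  qed
  have f2: "f x y \<in> borel_measurable borel" for x y
    using measurable_compose[OF measurable_Pair1' f1, of "(x, y)"] by (simp add: space_pair_measure)
  have f3: "(\<lambda>x. f (x 0) (x (Suc 0)) (x (Suc (Suc 0)))) \<in> borel_measurable (PiM {..Suc (Suc 0)} (\<lambda>_. borel))"
  proof -
    have "(\<lambda>x. (x 0, x (Suc 0), x (Suc (Suc 0)))) \<in> measurable (PiM {..Suc (Suc 0)} (\<lambda>_. borel)) (borel \<Otimes>\<^sub>M borel \<Otimes>\<^sub>M borel)"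
      by (intro measurable_Pair measurable_component_singleton) auto
    from measurable_compose[OF this f] show ?thesis by simp
  qed
  let ?F = "\<lambda>x y. \<integral>\<^sup>+z. (if y < z then ennreal (2 * pi * lam * z * exp (lam * pi * y\<^sup>2 - lam * pi * z\<^sup>2)) else 0) * f x y z \<partial>lborel"
  have F: "(\<lambda>(x, y). ?F x y) \<in> borel_measurable (borel \<Otimes>\<^sub>M borel)"
    unfolding split_beta'
  proof (rule lborel.borel_measurable_nn_integral)
    show "(\<lambda>(w, z). (if snd w < z then ennreal (2 * pi * lam * z * exp (lam * pi * (snd w)\<^sup>2 - lam * pi * z\<^sup>2)) else 0) *
      f (fst w) (snd w) z) \<in> borel_measurable ((borel \<Otimes>\<^sub>M borel) \<Otimes>\<^sub>M lborel)"
      using f1 by (simp add: split_beta' cong: measurable_cong_sets)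
  qed
  have "(\<integral>\<^sup>+\<omega>. (\<lambda>x. f (x 0) (x (Suc 0)) (x (Suc (Suc 0)))) (restrict (dist_seq \<omega>) {..Suc (Suc 0)}) \<partial>M) =
    (\<integral>\<^sup>+\<omega>. ?F (dist_seq \<omega> 0) (dist_seq \<omega> (Suc 0)) \<partial>M)"
    unfolding nn_integral_dist_seq_markov[OF f3]
    by (simp add: nn_integral_next_radius[OF f2])
  also have "\<dots> = (\<integral>\<^sup>+x. (\<integral>\<^sup>+y. (if 0 < x \<and> x < y then ennreal (2 * pi * lam * x * (2 * pi * lam * y) * exp (- (lam * pi * y\<^sup>2))) else 0)
      * ?F x y \<partial>lborel) \<partial>lborel)"
    by (rule nn_integral_dist2[OF F, unfolded One_nat_def])
  also have "\<dots> = (\<integral>\<^sup>+x. (\<integral>\<^sup>+y. (\<integral>\<^sup>+z. (if 0 < x \<and> x < y \<and> y < z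
        then ennreal (2 * pi * lam * x * (2 * pi * lam * y) * (2 * pi * lam * z) * exp (- (lam * pi * z\<^sup>2))) else 0)
      * f x y z \<partial>lborel) \<partial>lborel) \<partial>lborel)"
  proof (intro nn_integral_cong)
    fix x y :: real
    let ?c = "2 * pi * lam * x * (2 * pi * lam * y)"
    show "(if 0 < x \<and> x < y then ennreal (?c * exp (- (lam * pi * y\<^sup>2))) else 0) * ?F x y =
      (\<integral>\<^sup>+z. (if 0 < x \<and> x < y \<and> y < z
        then ennreal (?c * (2 * pi * lam * z) * exp (- (lam * pi * z\<^sup>2))) else 0) * f x y z \<partial>lborel)"
    proof (cases "0 < x \<and> x < y")
      case True
      then have "0 \<le> ?c" using lam_pos by simp
      from nn_integral_append_radius[OF f2 this] True show ?thesis by simp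
    next
      case False
      then have "(if 0 < x \<and> x < y \<and> y < z then ennreal (?c * (2 * pi * lam * z) * exp (- (lam * pi * z\<^sup>2))) else 0) = 0" for z
        by auto
      then show ?thesis by (simp only: False if_False mult_zero_left nn_integral_const)
    qed
  qed
  finally show ?thesis by (simp add: numeral_2_eq_2)
qed

end

subsection \<open>From Lebesgue to Bochner integrals\<close>

text \<open>Measurability of \<open>g\<close> is inherited from \<open>F\<close>, which matters when
  \<open>g\<close> contains \<open>real_hyp2F1\<close> at a varying argument. If the integral
  diverges, both sides are 0.\<close>

lemma integral_eq_enn2real:
  assumes F: "F \<in> borel_measurable N" and g: "\<And>x. F x = ennreal (g x)" and g0: "\<And>x. 0 \<le> g x"
  shows "integral\<^sup>L N g = enn2real (\<integral>\<^sup>+x. F x \<partial>N)"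
proof -
  have "g = (\<lambda>x. enn2real (F x))" using g g0 by (simp add: fun_eq_iff)
  then have "g \<in> borel_measurable N" using F by simp
  then show ?thesis using g0 unfolding g by (intro integral_eq_nn_integral) auto
qed

text \<open>\<open>enn2real\<close> reads an infinite inner integral as 0; finiteness of the total
  confines this to a null set of \<open>x\<close>.\<close>

lemma iterated_integral_eq_enn2real:
  fixes F :: "real \<Rightarrow> real \<Rightarrow> ennreal"
  assumes F: "(\<lambda>(x, y). F x y) \<in> borel_measurable (lborel \<Otimes>\<^sub>M lborel)"
    and g: "\<And>x y. F x y = ennreal (g x y)" and g0: "\<And>x y. 0 \<le> g x y"
    and fin: "(\<integral>\<^sup>+x. (\<integral>\<^sup>+y. F x y \<partial>lborel) \<partial>lborel) \<noteq> \<infinity>"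
  shows "(LBINT x. (LBINT y. g x y)) = enn2real (\<integral>\<^sup>+x. (\<integral>\<^sup>+y. F x y \<partial>lborel) \<partial>lborel)"
proof -
  let ?G = "\<lambda>x. \<integral>\<^sup>+y. F x y \<partial>lborel"
  have G [measurable]: "?G \<in> borel_measurable lborel"
    using F by (rule lborel.borel_measurable_nn_integral)
  have "(LBINT y. g x y) = enn2real (?G x)" for x
  proof (rule integral_eq_enn2real[OF _ g g0])
    show "F x \<in> borel_measurable lborel"
      using measurable_compose[OF measurable_Pair1' F, of x] by simp
  qed
  then have "(LBINT x. (LBINT y. g x y)) = (LBINT x. enn2real (?G x))" by simp
  also have "\<dots> = enn2real (\<integral>\<^sup>+x. ennreal (enn2real (?G x)) \<partial>lborel)"
    by (rule integral_eq_enn2real) auto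
  also have "(\<integral>\<^sup>+x. ennreal (enn2real (?G x)) \<partial>lborel) = (\<integral>\<^sup>+x. ?G x \<partial>lborel)"
  proof (rule nn_integral_cong_AE)
    have "AE x in lborel. ?G x \<noteq> \<infinity>"
      using fin by (intro nn_integral_PInf_AE) auto
    then show "AE x in lborel. ennreal (enn2real (?G x)) = ?G x"
      by eventually_elim (simp add: top.not_eq_extremum)
  qed
  finally show ?thesis .
qed

text \<open>The densities list the distances from the nearest outwards, whereas the claimed formula
  integrates over the nearest one innermost.\<close>

lemma nn_integral_rotate:
  fixes F :: "real \<Rightarrow> real \<Rightarrow> real \<Rightarrow> ennreal"
  assumes F: "(\<lambda>(x, y, z). F x y z) \<in> borel_measurable (borel \<Otimes>\<^sub>M borel \<Otimes>\<^sub>M borel)"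
  shows "(\<integral>\<^sup>+x. (\<integral>\<^sup>+y. (\<integral>\<^sup>+z. F x y z \<partial>lborel) \<partial>lborel) \<partial>lborel) =
    (\<integral>\<^sup>+y. (\<integral>\<^sup>+z. (\<integral>\<^sup>+x. F x y z \<partial>lborel) \<partial>lborel) \<partial>lborel)"
    and "(\<lambda>(y, z). \<integral>\<^sup>+x. F x y z \<partial>lborel) \<in> borel_measurable (lborel \<Otimes>\<^sub>M lborel)"
proof -
  let ?L = "lborel \<Otimes>\<^sub>M lborel :: (real \<times> real) measure"
  have cong: "borel_measurable (lborel \<Otimes>\<^sub>M ?L) = (borel_measurable (borel \<Otimes>\<^sub>M borel \<Otimes>\<^sub>M borel) :: (real \<times> real \<times> real \<Rightarrow> ennreal) set)"
    by (intro measurable_cong_sets sets_pair_measure_cong) simp_all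
  have F' [measurable]: "(\<lambda>(x, w). F x (fst w) (snd w)) \<in> borel_measurable (lborel \<Otimes>\<^sub>M ?L)"
    unfolding cong using F by (simp add: split_beta')
  interpret LL: pair_sigma_finite "lborel :: real measure" ?L
    by (simp add: pair_sigma_finite_def lborel_prod lborel.sigma_finite_measure_axioms)
  have swap: "(\<lambda>(w, x). F x (fst w) (snd w)) \<in> borel_measurable (?L \<Otimes>\<^sub>M lborel)"
    using measurable_compose[OF measurable_pair_swap' F'] by (simp add: split_beta')
  have G: "(\<lambda>w. \<integral>\<^sup>+x. F x (fst w) (snd w) \<partial>lborel) \<in> borel_measurable ?L"
    using swap by (rule lborel.borel_measurable_nn_integral)
  then show "(\<lambda>(y, z). \<integral>\<^sup>+x. F x y z \<partial>lborel) \<in> borel_measurable ?L" by (simp add: split_beta')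
  have "(\<integral>\<^sup>+x. (\<integral>\<^sup>+y. (\<integral>\<^sup>+z. F x y z \<partial>lborel) \<partial>lborel) \<partial>lborel) = (\<integral>\<^sup>+x. (\<integral>\<^sup>+w. F x (fst w) (snd w) \<partial>?L) \<partial>lborel)"
  proof (rule nn_integral_cong)
    fix x :: real
    have "(\<lambda>w. F x (fst w) (snd w)) \<in> borel_measurable ?L"
      using measurable_compose[OF measurable_Pair1' F', of x] by simp
    from lborel.nn_integral_fst[OF this]
    show "(\<integral>\<^sup>+y. (\<integral>\<^sup>+z. F x y z \<partial>lborel) \<partial>lborel) = (\<integral>\<^sup>+w. F x (fst w) (snd w) \<partial>?L)" by simp
  qed
  also have "\<dots> = (\<integral>\<^sup>+w. (\<integral>\<^sup>+x. F x (fst w) (snd w) \<partial>lborel) \<partial>?L)"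
    by (rule LL.Fubini'[symmetric]) (rule F')
  also have "\<dots> = (\<integral>\<^sup>+y. (\<integral>\<^sup>+z. (\<integral>\<^sup>+x. F x y z \<partial>lborel) \<partial>lborel) \<partial>lborel)"
    using lborel.nn_integral_fst[OF G] by simp
  finally show "(\<integral>\<^sup>+x. (\<integral>\<^sup>+y. (\<integral>\<^sup>+z. F x y z \<partial>lborel) \<partial>lborel) \<partial>lborel) =
    (\<integral>\<^sup>+y. (\<integral>\<^sup>+z. (\<integral>\<^sup>+x. F x y z \<partial>lborel) \<partial>lborel) \<partial>lborel)" .
qed

text \<open>The contribution of the interfering nearest station when the second station is at
  distance \<open>y\<close>.\<close>

definition nearest_factor :: "real \<Rightarrow> real \<Rightarrow> real \<Rightarrow> real" where
  "nearest_factor \<eta> c y = (LBINT x:{0<..<y}. x / (1 + c * x powr (- \<eta>)))"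

lemma nearest_factor:
  assumes c: "0 \<le> c"
  shows "(\<integral>\<^sup>+x. (if 0 < x \<and> x < y then ennreal (x / (1 + c * x powr (- \<eta>))) else 0) \<partial>lborel) = ennreal (nearest_factor \<eta> c y)"
    and nearest_factor_nonneg: "0 \<le> nearest_factor \<eta> c y"
proof -
  let ?g = "\<lambda>x. indicator {0<..<y} x *\<^sub>R (x / (1 + c * x powr (- \<eta>)))"
  have pos: "1 \<le> 1 + c * x powr (- \<eta>)" for x using c by simp
  have int: "integrable lborel ?g"
  proof (rule integrableI_bounded_set_indicator[where B = "\<bar>y\<bar>"])
    show "AE x in lborel. x \<in> {0<..<y} \<longrightarrow> norm (x / (1 + c * x powr (- \<eta>))) \<le> \<bar>y\<bar>"
    proof (intro AE_I2 impI)
      fix x assume x: "x \<in> {0<..<y}"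
      have "x / (1 + c * x powr (- \<eta>)) \<le> x / 1"
        using x pos[of x] by (intro divide_left_mono) auto
      moreover have "0 \<le> x / (1 + c * x powr (- \<eta>))" using x pos[of x] by simp
      ultimately show "norm (x / (1 + c * x powr (- \<eta>))) \<le> \<bar>y\<bar>"
        using x unfolding real_norm_def by (subst abs_of_nonneg) auto
    qed
    show "emeasure lborel {0<..<y} < \<infinity>" by (cases "0 \<le> y") auto
  qed auto
  have g0: "0 \<le> ?g x" for x
  proof -
    have "0 \<le> 1 + c * x powr (- \<eta>)" using pos[of x] by simp
    then show ?thesis by (auto simp: indicator_def)
  qed
  show "(\<integral>\<^sup>+x. (if 0 < x \<and> x < y then ennreal (x / (1 + c * x powr (- \<eta>))) else 0) \<partial>lborel) = ennreal (nearest_factor \<eta> c y)"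
  proof -
    have "ennreal (?g x) = (if 0 < x \<and> x < y then ennreal (x / (1 + c * x powr (- \<eta>))) else 0)" for x
      by (simp add: indicator_def)
    then show ?thesis
      unfolding nearest_factor_def set_lebesgue_integral_def
      using nn_integral_eq_integral[OF int AE_I2[OF g0]] by (simp only:)
  qed
  show "0 \<le> nearest_factor \<eta> c y"
    unfolding nearest_factor_def set_lebesgue_integral_def by (intro Bochner_Integration.integral_nonneg g0)
qed

text \<open>Since \<open>x ^ 5 / (A + x ^ 4) = x - A * x / (A + x ^ 4)\<close>, the variable
  \<open>x\<^sup>2\<close> leads to the antiderivative \<open>?F\<close>.\<close>

lemma nearest_factor_4:
  assumes A: "0 < A" and y: "0 < y"
  shows "nearest_factor 4 A y = y\<^sup>2 / 2 * (1 - sqrt A / y\<^sup>2 * arctan (y\<^sup>2 / sqrt A))"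
proof -
  let ?F = "\<lambda>x. (x\<^sup>2 - sqrt A * arctan (x\<^sup>2 / sqrt A)) / 2"
  let ?f = "\<lambda>x::real. x ^ 5 / (A + x ^ 4)"
  have sA: "0 < sqrt A" "sqrt A * sqrt A = A" using A by auto
  have nz: "A + x ^ 4 \<noteq> 0" for x :: real using A by (metis add_pos_nonneg less_irrefl zero_le_even_power even_numeral)
  \<comment> \<open>Clearing the negative power gives a rational function regular at 0, so the
    fundamental theorem applies on the closed interval.\<close>
  have "nearest_factor 4 A y = (LBINT x. ?f x * indicator {0..y} x)"
    unfolding nearest_factor_def set_lebesgue_integral_def
  proof (rule integral_cong_AE)
    show "AE x in lborel. indicator {0<..<y} x *\<^sub>R (x / (1 + A * x powr - 4)) = ?f x * indicator {0..y} x"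
      using AE_lborel_singleton[of 0] AE_lborel_singleton[of y]
    proof eventually_elim
      case (elim x)
      show ?case
      proof (cases "x \<in> {0<..<y}")
        case True
        have x5: "x ^ 5 = x * x ^ 4" by (simp add: eval_nat_numeral)
        from True have "x / (1 + A * x powr - 4) = ?f x"
          using nz[of x] by (simp add: powr_minus powr_numeral x5 field_simps)
        then show ?thesis using True by simp
      qed (use elim in \<open>auto split: split_indicator\<close>)
    qed
  qed measurable
  also have "\<dots> = ?F y - ?F 0"
  proof (rule integral_FTC_Icc_real)
    fix x :: real
    have d: "((\<lambda>x. x\<^sup>2 / sqrt A) has_real_derivative 2 * x / sqrt A) (at x)"
      by (rule DERIV_cdivide) (auto intro!: derivative_eq_intros)
    have "(?F has_real_derivative (2 * x - sqrt A * (inverse (1 + (x\<^sup>2 / sqrt A)\<^sup>2) * (2 * x / sqrt A))) / 2) (at x)"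
      using DERIV_chain2[OF DERIV_arctan d]
      by (intro DERIV_cdivide DERIV_diff DERIV_cmult) (auto intro!: derivative_eq_intros)
    also have "(x\<^sup>2 / sqrt A)\<^sup>2 = x ^ 4 / A"
      using A by (simp add: power_divide)
    also have "(2 * x - sqrt A * (inverse (1 + x ^ 4 / A) * (2 * x / sqrt A))) / 2 = ?f x"
    proof -
      have x5: "x ^ 5 = x * x ^ 4" by (simp add: eval_nat_numeral)
      have i: "inverse (1 + x ^ 4 / A) = A / (A + x ^ 4)"
        using A nz[of x] by (simp add: field_simps)
      have "sqrt A * (A / (A + x ^ 4) * (2 * x / sqrt A)) = 2 * x * (A / (A + x ^ 4))"
        using sA by simp
      then show ?thesis
        unfolding i x5 using nz[of x] by (simp add: field_simps)
    qed
    finally show "(?F has_real_derivative ?f x) (at x)" .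
    show "isCont ?f x" using nz[of x] by (intro continuous_intros) auto
  qed (use y in simp)
  also have "\<dots> = y\<^sup>2 / 2 * (1 - sqrt A / y\<^sup>2 * arctan (y\<^sup>2 / sqrt A))"
    using y by (simp add: right_diff_distrib diff_divide_distrib)
  finally show ?thesis .
qed

subsection \<open>Coverage probabilities\<close>

text \<open>Dividing by the mean power \<open>P * r powr (- \<eta>)\<close> produces the Laplace
  argument \<open>T * r powr \<eta> / P\<close>.\<close>

lemma (in prob_space) emeasure_exponential_signal_gt:
  assumes h: "distributed M lborel h (exponential_density 1)"
    and P: "0 < P" and T: "0 \<le> T" and r: "0 < r" and c: "0 \<le> c"
  shows "emeasure M {\<omega> \<in> space M. T * c < P * h \<omega> * r powr (- \<eta>)} = ennreal (exp (- (T * r powr \<eta> / P * c)))"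
proof -
  have "T * c < P * x * r powr (- \<eta>) \<longleftrightarrow> T * r powr \<eta> / P * c < x" for x
    using P r by (simp add: powr_minus field_simps)
  then show ?thesis
    using exponential_distributedD_gt[OF h, of "T * r powr \<eta> / P * c"] P T c
    by (simp add: emeasure_eq_measure)
qed

lemma (in faded_network) interference_exponent_eq_hyp2F1:
  assumes "0 < q" "0 < x"
  shows "interference_exponent lam \<eta> (q * x powr \<eta>) x =
    pi * lam * x\<^sup>2 * (2 * q / (\<eta> - 2) * real_hyp2F1 1 (1 - 2 / \<eta>) (2 - 2 / \<eta>) (- q))"
proof -
  have "real_hyp2F1 1 (1 - 2 / \<eta>) ((1 - 2 / \<eta>) + 1) (- q) = integral {0..1} (\<lambda>u. 1 / (1 + q * u powr (1 / (1 - 2 / \<eta>))))"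
    using assms by (intro real_hyp2F1_integral exponent_pos[OF lam_pos eta]) auto
  moreover have "(1 - 2 / \<eta>) + 1 = 2 - 2 / \<eta>" by simp
  ultimately show ?thesis
    using interference_exponent_eq_hypergeometric_integral[OF lam_pos eta assms] by simp
qed

text \<open>With \<open>s = T * r powr \<eta> / P\<close> the product \<open>s * P\<close> loses
  \<open>P\<close>. The condition \<open>k \<notin> J\<close> keeps the serving gain independent of
  the interference.\<close>

lemma (in faded_network) emeasure_coverage_single:
  assumes J0: "J0 \<subseteq> {..k}" "J0 \<subseteq> J" and tail: "{k<..} \<subseteq> J" and k: "k \<notin> J" and N: "0 \<le> N" and T: "0 < T"
    and h: "distributed M lborel (h (Suc k)) (exponential_density 1)"
    and ind: "indep_vars (\<lambda>_. borel_product UNIV) (source_value \<Phi> h g) (insert (Gain (Suc k)) (insert Process (Gain ` Suc ` J)))"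
  shows "emeasure M {\<omega> \<in> space M. T <
      power_at k \<omega> / ((\<Sum>i\<in>J0. power_at i \<omega>) + interference_from P \<eta> \<Phi> h (k + 2) \<omega> + N)} =
    (\<integral>\<^sup>+\<omega>. ennreal (exp (- (T * dist_seq \<omega> k powr \<eta> / P * N))) *
      (\<Prod>i\<in>J0. ennreal (1 / (1 + T * dist_seq \<omega> k powr \<eta> * dist_seq \<omega> i powr (- \<eta>)))) *
      ennreal (exp (- interference_exponent lam \<eta> (T * dist_seq \<omega> k powr \<eta>) (dist_seq \<omega> k))) \<partial>M)"
proof -
  let ?S = "borel_product UNIV :: (nat \<Rightarrow> real) measure"
  let ?A = "insert Process (Gain ` Suc ` J)"
  let ?Y = "\<lambda>\<omega>. restrict (\<lambda>i. source_value \<Phi> h g i \<omega>) {Gain (Suc k)}"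
  let ?sig = "\<lambda>x v. P * v (Gain (Suc k)) 0 * x k powr (- \<eta>)"
  let ?s = "\<lambda>x. T * x k powr \<eta> / P"
  have "emeasure M {\<omega> \<in> space M. T <
      ?sig (dist_seq \<omega>) (?Y \<omega>) / ((\<Sum>i\<in>J0. power_at i \<omega>) + interference_from P \<eta> \<Phi> h (k + 2) \<omega> + N)} =
    (\<integral>\<^sup>+\<omega>. ennreal (exp (- (?s (nearest k \<omega>) * N))) *
      (\<Prod>i\<in>J0. ennreal (1 / (1 + ?s (nearest k \<omega>) * P * dist_seq \<omega> i powr (- \<eta>)))) *
      ennreal (exp (- interference_exponent lam \<eta> (?s (nearest k \<omega>) * P) (dist_seq \<omega> k))) \<partial>M)"
  proof (rule emeasure_coverage[where sig = ?sig and Y = ?Y and s = ?s and S = "PiM {Gain (Suc k)} (\<lambda>_. ?S)", OF J0 tail N])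
    show "?s \<in> borel_measurable (borel_product {..k})" by measurable
    show "0 \<le> ?s x" for x using T P_pos by simp
    show "(\<lambda>(x, v). ?sig x v) \<in> borel_measurable (?S \<Otimes>\<^sub>M PiM {Gain (Suc k)} (\<lambda>_. ?S))"
    proof -
      have "(\<lambda>z. snd z (Gain (Suc k))) \<in> measurable (?S \<Otimes>\<^sub>M PiM {Gain (Suc k)} (\<lambda>_. ?S)) ?S"
        by (rule measurable_compose[OF measurable_snd measurable_component_singleton]) simp
      from measurable_compose[OF this, of "\<lambda>x. x 0" borel]
      have [measurable]: "(\<lambda>z. snd z (Gain (Suc k)) 0) \<in> borel_measurable (?S \<Otimes>\<^sub>M PiM {Gain (Suc k)} (\<lambda>_. ?S))" by simp
      show ?thesis unfolding split_beta' by measurable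
    qed
    show "indep_var (PiM ?A (\<lambda>_. ?S)) (\<lambda>\<omega>. restrict (\<lambda>i. source_value \<Phi> h g i \<omega>) ?A) (PiM {Gain (Suc k)} (\<lambda>_. ?S)) ?Y"
      using k by (intro indep_var_restrict[OF ind]) auto
    fix x :: "nat \<Rightarrow> real" and c :: real assume "\<And>i. 0 < x i" "0 \<le> c"
    then show "emeasure M {\<omega> \<in> space M. T * c < ?sig x (?Y \<omega>)} = ennreal (exp (- (?s (restrict x {..k}) * c)))"
      using emeasure_exponential_signal_gt[OF h P_pos, of T "x k" c \<eta>] T by simp
  qed
  then show ?thesis
    using P_pos by (simp add: received_power_def)
qed

text \<open>The instance \<open>k = 0\<close> without nearer interferers. Only the density of the
  smallest distance enters, and the exponent is \<open>x\<^sup>2\<close> times a constant.\<close>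

lemma (in faded_network) coverage_best_connected_formula:
  assumes J: "J = {0<..}" and N: "0 \<le> N" and T: "0 < T"
    and h: "distributed M lborel (h 1) (exponential_density 1)"
    and ind: "indep_vars (\<lambda>_. borel_product UNIV) (source_value \<Phi> h g) (insert Process (Gain ` {1..}))"
  shows "coverage_best_connected M \<Phi> h P \<eta> N T =
    2 * pi * lam * (LBINT x:{0<..}. x * exp (- (T * N * x powr \<eta> / P) -
      pi * lam * x\<^sup>2 * (1 + T powr (2 / \<eta>) * (LBINT w:{T powr (- 2 / \<eta>)<..}. 1 / (1 + w powr (\<eta> / 2))))))"
proof -
  have img: "insert (Gain (Suc 0)) (insert Process (Gain ` Suc ` J)) = insert Process (Gain ` {1..})"
  proof -
    have "{1..} = insert (Suc 0) (Suc ` J)"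
    proof (intro equalityI subsetI)
      fix n :: nat assume "n \<in> {1..}"
      then obtain m where "n = Suc m" by (auto dest: Suc_le_D)
      moreover have "m = 0 \<or> m \<in> J" by (auto simp: J)
      ultimately show "n \<in> insert (Suc 0) (Suc ` J)" by auto
    qed auto
    then show ?thesis by auto
  qed
  let ?K = "T powr (2 / \<eta>) * (LBINT w:{T powr (- 2 / \<eta>)<..}. 1 / (1 + w powr (\<eta> / 2)))"
  define f where "f x = ennreal (exp (- (T * x powr \<eta> / P * N))) * ennreal (exp (- interference_exponent lam \<eta> (T * x powr \<eta>) x))" for x
  note [measurable] = borel_measurable_interference_exponent[OF lam_pos eta]
  have f_meas [measurable]: "f \<in> borel_measurable borel" unfolding f_def[abs_def] by measurable
  have "emeasure M {\<omega> \<in> space M. T < power_at 0 \<omega> / ((\<Sum>i\<in>{}. power_at i \<omega>) + interference_from P \<eta> \<Phi> h (0 + 2) \<omega> + N)} =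
    (\<integral>\<^sup>+\<omega>. ennreal (exp (- (T * dist_seq \<omega> 0 powr \<eta> / P * N))) *
      (\<Prod>i\<in>{}. ennreal (1 / (1 + T * dist_seq \<omega> 0 powr \<eta> * dist_seq \<omega> i powr (- \<eta>)))) *
      ennreal (exp (- interference_exponent lam \<eta> (T * dist_seq \<omega> 0 powr \<eta>) (dist_seq \<omega> 0))) \<partial>M)"
    using h ind img J by (intro emeasure_coverage_single N T) auto
  then have "emeasure M {\<omega> \<in> space M. T < received_power P \<eta> \<Phi> h 1 \<omega> / (interference_from P \<eta> \<Phi> h 2 \<omega> + N)} =
    (\<integral>\<^sup>+\<omega>. f (dist_seq \<omega> 0) \<partial>M)"
    by (simp add: f_def numeral_2_eq_2)
  also have "\<dots> = (\<integral>\<^sup>+x. (if 0 < x then ennreal (2 * pi * lam * x * exp (- (lam * pi * x\<^sup>2))) else 0) * f x \<partial>lborel)"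
    by (rule nn_integral_dist1) measurable
  finally have em: "emeasure M {\<omega> \<in> space M. T < received_power P \<eta> \<Phi> h 1 \<omega> / (interference_from P \<eta> \<Phi> h 2 \<omega> + N)} = \<dots>" .
  let ?g = "\<lambda>x. 2 * pi * lam * (indicator {0<..} x *\<^sub>R (x * exp (- (T * N * x powr \<eta> / P) - pi * lam * x\<^sup>2 * (1 + ?K))))"
  have "(LBINT x. ?g x) = enn2real (\<integral>\<^sup>+x. (if 0 < x then ennreal (2 * pi * lam * x * exp (- (lam * pi * x\<^sup>2))) else 0) * f x \<partial>lborel)"
  proof (rule integral_eq_enn2real)
    fix x :: real
    show "0 \<le> ?g x" using lam_pos by (simp split: split_indicator)
    show "(if 0 < x then ennreal (2 * pi * lam * x * exp (- (lam * pi * x\<^sup>2))) else 0) * f x = ennreal (?g x)"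
    proof (cases "0 < x")
      case True
      have "exp (- (lam * pi * x\<^sup>2)) * (exp (- (T * x powr \<eta> / P * N)) * exp (- (pi * lam * x\<^sup>2 * ?K))) =
        exp (- (T * N * x powr \<eta> / P) - pi * lam * x\<^sup>2 * (1 + ?K))"
        by (simp add: mult_exp_exp algebra_simps)
      then have "2 * pi * lam * x * exp (- (lam * pi * x\<^sup>2)) * (exp (- (T * x powr \<eta> / P * N)) * exp (- (pi * lam * x\<^sup>2 * ?K))) = ?g x"
        using True by (simp add: mult.assoc)
      then show ?thesis
        using True unfolding f_def interference_exponent_eq_power_tail[OF lam_pos eta T True]
        by (simp only: if_True ennreal_mult''[symmetric] exp_ge_zero mult_nonneg_nonneg)
    qed simp
  qed measurable
  then show ?thesis
    unfolding coverage_best_connected_def measure_def em set_lebesgue_integral_def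
    by (simp only: integral_mult_right_zero)
qed

text \<open>The instance \<open>k = 1\<close> with the nearest station as the one nearer interferer.
  The exponent depends on the server's distance \<open>y\<close> alone, so the order of integration
  is exchanged to make \<open>y\<close> the outer variable.\<close>

lemma (in faded_network) coverage_blackout_formula:
  assumes J: "J = {0} \<union> {1<..}" and N: "0 \<le> N" and T: "0 < T"
    and h: "distributed M lborel (h 2) (exponential_density 1)"
    and ind: "indep_vars (\<lambda>_. borel_product UNIV) (source_value \<Phi> h g) (insert Process (Gain ` {1..}))"
  shows "coverage_blackout M \<Phi> h P \<eta> N T =
    (2 * lam * pi)\<^sup>2 * (LBINT y:{0<..}. y * exp (- (T * N * y powr \<eta> / P) -
      lam * pi * y\<^sup>2 * (2 * T / (\<eta> - 2) * real_hyp2F1 1 (1 - 2 / \<eta>) (2 - 2 / \<eta>) (- T) + 1)) *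
      (LBINT x:{0<..<y}. x / (1 + T * y powr \<eta> * x powr (- \<eta>))))"
proof -
  have img: "insert (Gain (Suc 1)) (insert Process (Gain ` Suc ` J)) = insert Process (Gain ` {1..})"
  proof -
    have "{1..} = insert (Suc 1) (Suc ` J)"
    proof (intro equalityI subsetI)
      fix n :: nat assume "n \<in> {1..}"
      then obtain m where "n = Suc m" by (auto dest: Suc_le_D)
      moreover have "m = 1 \<or> m \<in> J" by (auto simp: J)
      ultimately show "n \<in> insert (Suc 1) (Suc ` J)" by auto
    qed auto
    then show ?thesis by auto
  qed
  let ?K = "2 * T / (\<eta> - 2) * real_hyp2F1 1 (1 - 2 / \<eta>) (2 - 2 / \<eta>) (- T)"
  define f where "f x y = ennreal (exp (- (T * y powr \<eta> / P * N))) * ennreal (1 / (1 + T * y powr \<eta> * x powr (- \<eta>))) *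
    ennreal (exp (- interference_exponent lam \<eta> (T * y powr \<eta>) y))" for x y
  note [measurable] = borel_measurable_interference_exponent[OF lam_pos eta]
  have f_meas [measurable]: "(\<lambda>(x, y). f x y) \<in> borel_measurable (borel \<Otimes>\<^sub>M borel)" unfolding f_def[abs_def] by measurable
  have "emeasure M {\<omega> \<in> space M. T < power_at 1 \<omega> / ((\<Sum>i\<in>{0}. power_at i \<omega>) + interference_from P \<eta> \<Phi> h (1 + 2) \<omega> + N)} =
    (\<integral>\<^sup>+\<omega>. ennreal (exp (- (T * dist_seq \<omega> 1 powr \<eta> / P * N))) *
      (\<Prod>i\<in>{0}. ennreal (1 / (1 + T * dist_seq \<omega> 1 powr \<eta> * dist_seq \<omega> i powr (- \<eta>)))) *
      ennreal (exp (- interference_exponent lam \<eta> (T * dist_seq \<omega> 1 powr \<eta>) (dist_seq \<omega> 1))) \<partial>M)"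
    using h ind img J by (intro emeasure_coverage_single N T) (auto simp: numeral_2_eq_2)
  then have "emeasure M {\<omega> \<in> space M. T < received_power P \<eta> \<Phi> h 2 \<omega> /
      (received_power P \<eta> \<Phi> h 1 \<omega> + interference_from P \<eta> \<Phi> h 3 \<omega> + N)} = (\<integral>\<^sup>+\<omega>. f (dist_seq \<omega> 0) (dist_seq \<omega> 1) \<partial>M)"
    by (simp add: f_def numeral_2_eq_2 numeral_3_eq_3)
  also have "\<dots> = (\<integral>\<^sup>+x. (\<integral>\<^sup>+y. (if 0 < x \<and> x < y then ennreal (2 * pi * lam * x * (2 * pi * lam * y) * exp (- (lam * pi * y\<^sup>2))) else 0)
      * f x y \<partial>lborel) \<partial>lborel)"
    by (rule nn_integral_dist2) measurable
  also have "\<dots> = (\<integral>\<^sup>+y. (\<integral>\<^sup>+x. (if 0 < x \<and> x < y then ennreal (2 * pi * lam * x * (2 * pi * lam * y) * exp (- (lam * pi * y\<^sup>2))) else 0)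
      * f x y \<partial>lborel) \<partial>lborel)"
    by (rule lborel_pair.Fubini'[symmetric]) (use f_meas in \<open>simp add: split_beta' cong: measurable_cong_sets\<close>)
  finally have em: "emeasure M {\<omega> \<in> space M. T < received_power P \<eta> \<Phi> h 2 \<omega> /
      (received_power P \<eta> \<Phi> h 1 \<omega> + interference_from P \<eta> \<Phi> h 3 \<omega> + N)} = \<dots>" .
  let ?E = "\<lambda>y. y * exp (- (T * N * y powr \<eta> / P) - lam * pi * y\<^sup>2 * (?K + 1))"
  let ?g = "\<lambda>y. (2 * lam * pi)\<^sup>2 * (indicator {0<..} y *\<^sub>R (?E y * nearest_factor \<eta> (T * y powr \<eta>) y))"
  have nf: "0 \<le> nearest_factor \<eta> (T * y powr \<eta>) y" for y using T by (intro nearest_factor_nonneg) simp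
  have "(LBINT y. ?g y) = enn2real (\<integral>\<^sup>+y. (\<integral>\<^sup>+x. (if 0 < x \<and> x < y then ennreal (2 * pi * lam * x * (2 * pi * lam * y) * exp (- (lam * pi * y\<^sup>2))) else 0)
      * f x y \<partial>lborel) \<partial>lborel)"
  proof (rule integral_eq_enn2real)
    fix y :: real
    show "0 \<le> ?g y" using nf[of y] by (simp split: split_indicator)
    show "(\<integral>\<^sup>+x. (if 0 < x \<and> x < y then ennreal (2 * pi * lam * x * (2 * pi * lam * y) * exp (- (lam * pi * y\<^sup>2))) else 0)
      * f x y \<partial>lborel) = ennreal (?g y)"
    proof (cases "0 < y")
      case True
      have e: "exp (- (lam * pi * y\<^sup>2)) * (exp (- (T * y powr \<eta> / P * N)) * exp (- (pi * lam * y\<^sup>2 * ?K))) =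
        exp (- (T * N * y powr \<eta> / P) - lam * pi * y\<^sup>2 * (?K + 1))"
        by (simp add: mult_exp_exp algebra_simps)
      have "(\<integral>\<^sup>+x. (if 0 < x \<and> x < y then ennreal (2 * pi * lam * x * (2 * pi * lam * y) * exp (- (lam * pi * y\<^sup>2))) else 0)
        * f x y \<partial>lborel) = (\<integral>\<^sup>+x. ennreal ((2 * lam * pi)\<^sup>2 * ?E y) * (if 0 < x \<and> x < y then ennreal (x / (1 + T * y powr \<eta> * x powr (- \<eta>))) else 0) \<partial>lborel)"
      proof (rule nn_integral_cong)
        fix x :: real
        have k: "0 \<le> 1 / (1 + T * y powr \<eta> * x powr (- \<eta>))" using T by simp
        have "2 * pi * lam * x * (2 * pi * lam * y) * exp (- (lam * pi * y\<^sup>2)) *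
          (exp (- (T * y powr \<eta> / P * N)) * (1 / (1 + T * y powr \<eta> * x powr (- \<eta>))) * exp (- (pi * lam * y\<^sup>2 * ?K))) =
          (2 * lam * pi)\<^sup>2 * (y * (exp (- (lam * pi * y\<^sup>2)) * (exp (- (T * y powr \<eta> / P * N)) * exp (- (pi * lam * y\<^sup>2 * ?K))))) *
          (x / (1 + T * y powr \<eta> * x powr (- \<eta>)))"
          by (simp add: power2_eq_square)
        also have "\<dots> = (2 * lam * pi)\<^sup>2 * ?E y * (x / (1 + T * y powr \<eta> * x powr (- \<eta>)))"
          unfolding e ..
        finally have r: "2 * pi * lam * x * (2 * pi * lam * y) * exp (- (lam * pi * y\<^sup>2)) *
          (exp (- (T * y powr \<eta> / P * N)) * (1 / (1 + T * y powr \<eta> * x powr (- \<eta>))) * exp (- (pi * lam * y\<^sup>2 * ?K))) =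
          (2 * lam * pi)\<^sup>2 * ?E y * (x / (1 + T * y powr \<eta> * x powr (- \<eta>)))" .
        have fr: "f x y = ennreal (exp (- (T * y powr \<eta> / P * N)) * (1 / (1 + T * y powr \<eta> * x powr (- \<eta>))) * exp (- (pi * lam * y\<^sup>2 * ?K)))"
          unfolding f_def interference_exponent_eq_hyp2F1[OF T True] using k
          by (simp only: ennreal_mult''[symmetric] exp_ge_zero)
        have nn: "0 \<le> (2 * lam * pi)\<^sup>2 * ?E y" using True by simp
        have nn2: "0 \<le> exp (- (T * y powr \<eta> / P * N)) * (1 / (1 + T * y powr \<eta> * x powr (- \<eta>))) * exp (- (pi * lam * y\<^sup>2 * ?K))"
          using k by (intro mult_nonneg_nonneg) auto
        show "(if 0 < x \<and> x < y then ennreal (2 * pi * lam * x * (2 * pi * lam * y) * exp (- (lam * pi * y\<^sup>2))) else 0) * f x y =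
          ennreal ((2 * lam * pi)\<^sup>2 * ?E y) * (if 0 < x \<and> x < y then ennreal (x / (1 + T * y powr \<eta> * x powr (- \<eta>))) else 0)"
        proof (cases "0 < x \<and> x < y")
          case True
          show ?thesis
            unfolding fr by (simp only: True if_True simp_thms ennreal_mult''[OF nn2, symmetric] ennreal_mult'[OF nn, symmetric] r)
        next
          case False
          show ?thesis by (simp only: False if_False mult_zero_left mult_zero_right)
        qed
      qed
      also have "\<dots> = ennreal ((2 * lam * pi)\<^sup>2 * ?E y) * ennreal (nearest_factor \<eta> (T * y powr \<eta>) y)"
        using T by (subst nn_integral_cmult) (auto simp: nearest_factor)
      finally show ?thesis
        using True by (simp add: ennreal_mult'' nf mult.assoc flip: ennreal_mult'')
    next
      case False
      then have zero: "(if 0 < x \<and> x < y then ennreal (2 * pi * lam * x * (2 * pi * lam * y) * exp (- (lam * pi * y\<^sup>2))) else 0) * f x y = 0" for x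
        by auto
      show ?thesis unfolding zero using False by simp
    qed
    show "(\<lambda>y. \<integral>\<^sup>+x. (if 0 < x \<and> x < y then ennreal (2 * pi * lam * x * (2 * pi * lam * y) * exp (- (lam * pi * y\<^sup>2))) else 0)
      * f x y \<partial>lborel) \<in> borel_measurable lborel"
    proof (rule lborel.borel_measurable_nn_integral)
      have "(\<lambda>w. f (snd w) (fst w)) \<in> borel_measurable (borel \<Otimes>\<^sub>M borel)"
        using measurable_compose[OF measurable_pair_swap' f_meas] by (simp add: split_beta')
      then show "(\<lambda>(y, x). (if 0 < x \<and> x < y then ennreal (2 * pi * lam * x * (2 * pi * lam * y) * exp (- (lam * pi * y\<^sup>2))) else 0)
        * f x y) \<in> borel_measurable (lborel \<Otimes>\<^sub>M lborel)"
        by (simp add: split_beta' cong: measurable_cong_sets)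
    qed
  qed
  then show ?thesis
    unfolding coverage_blackout_def measure_def em set_lebesgue_integral_def nearest_factor_def
    by (simp only: integral_mult_right_zero)
qed

text \<open>The instance \<open>k = 2\<close>: zero-based distances 1 and 2 belong to the servers
  and 0 to the nearer interferer. The superposed signal has mean power
  \<open>P * (r2 powr (- \<eta>) + r3 powr (- \<eta>))\<close>, which is the origin of
  \<open>s\<close>.\<close>

lemma (in faded_network) coverage_blackout_coop_formula:
  assumes J: "J = {0} \<union> {2<..}" and N: "0 \<le> N" and T: "0 < T"
    and g: "std_complex_gaussian M (g 2)" "std_complex_gaussian M (g 3)"
    and ind: "indep_vars (\<lambda>_. borel_product UNIV) (source_value \<Phi> h g)
      ({Process, Coeff 2, Coeff 3, Gain 1} \<union> Gain ` {4..})"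
  defines "s \<equiv> (\<lambda>r2 r3. T / (P * (r2 powr (- \<eta>) + r3 powr (- \<eta>))))"
  shows "coverage_blackout_coop M \<Phi> h g P \<eta> N T =
    8 * (pi * lam) ^ 3 * (LBINT r2:{0<..}. (LBINT r3:{r2<..}.
      r2 * r3 * exp (- (s r2 r3 * N) - pi * lam * r3\<^sup>2 * (1 + 2 * s r2 r3 * P * r3 powr (- \<eta>) / (\<eta> - 2) *
        real_hyp2F1 1 (1 - 2 / \<eta>) (2 - 2 / \<eta>) (- (s r2 r3 * P * r3 powr (- \<eta>))))) *
      (LBINT r1:{0<..<r2}. r1 / (1 + s r2 r3 * P * r1 powr (- \<eta>)))))"
proof -
  let ?S = "borel_product UNIV :: (nat \<Rightarrow> real) measure"
  let ?A = "insert Process (Gain ` Suc ` J)"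
  let ?Q = "{Coeff 2, Coeff 3}"
  let ?V = "source_value \<Phi> h g"
  let ?Y = "\<lambda>\<omega>. restrict (\<lambda>i. ?V i \<omega>) ?Q"
  \<comment> \<open>Real part (index 0) and imaginary part (index \<open>Suc 0\<close>) of the
    superposed amplitude, in the encoding of \<open>source_value\<close>.\<close>
  let ?part = "\<lambda>i (x :: nat \<Rightarrow> real) (v :: source \<Rightarrow> nat \<Rightarrow> real). sqrt P * v (Coeff 2) i * x 1 powr (- \<eta> / 2) + sqrt P * v (Coeff 3) i * x 2 powr (- \<eta> / 2)"
  let ?sig = "\<lambda>(x :: nat \<Rightarrow> real) (v :: source \<Rightarrow> nat \<Rightarrow> real). (?part 0 x v)\<^sup>2 + (?part (Suc 0) x v)\<^sup>2"
  let ?s = "\<lambda>x :: nat \<Rightarrow> real. s (x 1) (x 2)"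
  have img: "Gain ` Suc ` J = insert (Gain 1) (Gain ` {4..})"
  proof -
    have "Suc ` J = insert 1 {4..}"
    proof (intro equalityI subsetI)
      fix n :: nat assume n: "n \<in> insert 1 {4..}"
      then obtain m where "n = Suc m" by (cases n) auto
      moreover have "m \<in> J" using n \<open>n = Suc m\<close> by (auto simp: J)
      ultimately show "n \<in> Suc ` J" by auto
    qed (auto simp: J)
    then show ?thesis by auto
  qed
  have ind': "indep_vars (\<lambda>_. ?S) ?V (?A \<union> ?Q)"
  proof -
    have "?A \<union> ?Q = {Process, Coeff 2, Coeff 3, Gain 1} \<union> Gain ` {4..}" unfolding img by auto
    then show ?thesis using ind by simp
  qed
  have s0: "0 \<le> s a b" for a b using T P_pos by (simp add: s_def)
  have s_meas [measurable (raw)]: "(\<lambda>w. s (a w) (b w)) \<in> borel_measurable K"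
    if "a \<in> borel_measurable K" "b \<in> borel_measurable K" for a b and K :: "'k measure"
    using that unfolding s_def by measurable
  have indg: "indep_var borel (g 2) borel (g 3)"
  proof -
    have "indep_var (PiM {Coeff 2} (\<lambda>_. ?S)) (\<lambda>\<omega>. restrict (\<lambda>i. ?V i \<omega>) {Coeff 2}) (PiM {Coeff 3} (\<lambda>_. ?S)) (\<lambda>\<omega>. restrict (\<lambda>i. ?V i \<omega>) {Coeff 3})"
      by (intro indep_var_restrict[OF ind']) auto
    then have "indep_var borel ((\<lambda>f. of_real (f (Coeff 2) 0) + \<i> * of_real (f (Coeff 2) (Suc 0))) \<circ> (\<lambda>\<omega>. restrict (\<lambda>i. ?V i \<omega>) {Coeff 2}))
      borel ((\<lambda>f. of_real (f (Coeff 3) 0) + \<i> * of_real (f (Coeff 3) (Suc 0))) \<circ> (\<lambda>\<omega>. restrict (\<lambda>i. ?V i \<omega>) {Coeff 3}))"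
    proof (rule indep_var_compose)
      have coord: "(\<lambda>f. f (Coeff n) i) \<in> borel_measurable (PiM {Coeff n} (\<lambda>_. ?S))" for n i
      proof -
        have "(\<lambda>f. f (Coeff n)) \<in> measurable (PiM {Coeff n} (\<lambda>_. ?S)) ?S"
          by (rule measurable_component_singleton) simp
        from measurable_compose[OF this, of "\<lambda>x. x i" borel] show ?thesis by simp
      qed
      show "(\<lambda>f. complex_of_real (f (Coeff 2) 0) + \<i> * complex_of_real (f (Coeff 2) (Suc 0))) \<in> borel_measurable (PiM {Coeff 2} (\<lambda>_. ?S))"
        using coord by measurable
      show "(\<lambda>f. complex_of_real (f (Coeff 3) 0) + \<i> * complex_of_real (f (Coeff 3) (Suc 0))) \<in> borel_measurable (PiM {Coeff 3} (\<lambda>_. ?S))"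
        using coord by measurable
    qed
    then show ?thesis by (simp add: o_def complex_eq[symmetric])
  qed
  define f where "f x y z = ennreal (exp (- (s y z * N))) * ennreal (1 / (1 + s y z * P * x powr (- \<eta>))) *
    ennreal (exp (- interference_exponent lam \<eta> (s y z * P) z))" for x y z
  note [measurable] = borel_measurable_interference_exponent[OF lam_pos eta]
  have f_meas: "(\<lambda>(x, y, z). f x y z) \<in> borel_measurable (borel \<Otimes>\<^sub>M borel \<Otimes>\<^sub>M borel)"
    unfolding f_def[abs_def] split_beta' by measurable
  have "emeasure M {\<omega> \<in> space M. T <
      ?sig (dist_seq \<omega>) (?Y \<omega>) / ((\<Sum>i\<in>{0}. power_at i \<omega>) + interference_from P \<eta> \<Phi> h (2 + 2) \<omega> + N)} =
    (\<integral>\<^sup>+\<omega>. ennreal (exp (- (?s (nearest 2 \<omega>) * N))) *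
      (\<Prod>i\<in>{0}. ennreal (1 / (1 + ?s (nearest 2 \<omega>) * P * dist_seq \<omega> i powr (- \<eta>)))) *
      ennreal (exp (- interference_exponent lam \<eta> (?s (nearest 2 \<omega>) * P) (dist_seq \<omega> 2))) \<partial>M)"
  proof (rule emeasure_coverage[where sig = ?sig and Y = ?Y and s = ?s and S = "PiM ?Q (\<lambda>_. ?S)"])
    show "?s \<in> borel_measurable (PiM {..2} (\<lambda>_. borel))"
      by (intro s_meas measurable_component_singleton) auto
    show "0 \<le> ?s x" for x by (rule s0)
    show "(\<lambda>(x, v). ?sig x v) \<in> borel_measurable (?S \<Otimes>\<^sub>M PiM ?Q (\<lambda>_. ?S))"
    proof -
      have coord: "(\<lambda>w. snd w q i) \<in> borel_measurable (?S \<Otimes>\<^sub>M PiM ?Q (\<lambda>_. ?S))" if "q \<in> ?Q" for q i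
      proof -
        have "(\<lambda>w. snd w q) \<in> measurable (?S \<Otimes>\<^sub>M PiM ?Q (\<lambda>_. ?S)) ?S"
          using that by (intro measurable_compose[OF measurable_snd measurable_component_singleton])
        from measurable_compose[OF this, of "\<lambda>x. x i" borel] show ?thesis by simp
      qed
      have [measurable]: "(\<lambda>w. snd w (Coeff 2) i) \<in> borel_measurable (?S \<Otimes>\<^sub>M PiM ?Q (\<lambda>_. ?S))"
        "(\<lambda>w. snd w (Coeff 3) i) \<in> borel_measurable (?S \<Otimes>\<^sub>M PiM ?Q (\<lambda>_. ?S))" for i
        by (rule coord; simp)+
      show ?thesis unfolding split_beta' by measurable
    qed
    show "indep_var (PiM ?A (\<lambda>_. ?S)) (\<lambda>\<omega>. restrict (\<lambda>i. ?V i \<omega>) ?A) (PiM ?Q (\<lambda>_. ?S)) ?Y"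
      by (intro indep_var_restrict[OF ind']) auto
    fix x :: "nat \<Rightarrow> real" and c :: real assume x: "\<And>i. 0 < x i" and c: "0 \<le> c"
    let ?\<alpha> = "sqrt P * x 1 powr (- \<eta> / 2)" and ?\<beta> = "sqrt P * x 2 powr (- \<eta> / 2)"
    have pos: "0 < ?\<alpha>" "0 < ?\<beta>" using P_pos x[of 1] x[of 2] by simp_all
    have sq: "(r powr (- \<eta> / 2))\<^sup>2 = r powr (- \<eta>)" for r :: real
      by (simp add: power2_eq_square powr_add[symmetric])
    have sum: "?\<alpha>\<^sup>2 + ?\<beta>\<^sup>2 = P * (x 1 powr (- \<eta>) + x 2 powr (- \<eta>))"
      unfolding power_mult_distrib sq using P_pos by (simp add: algebra_simps)
    have "?sig x (?Y \<omega>) = (cmod (of_real ?\<alpha> * g 2 \<omega> + of_real ?\<beta> * g 3 \<omega>))\<^sup>2" for \<omega>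
      by (simp add: cmod_power2 mult_ac)
    then show "emeasure M {\<omega> \<in> space M. T * c < ?sig x (?Y \<omega>)} = ennreal (exp (- (?s (restrict x {..2}) * c)))"
      using emeasure_complex_gaussian_combination_gt[OF indg g pos, of "T * c"] T c
      by (simp only: sum) (simp add: s_def)
  qed (use N J in auto)
  moreover have "?sig (dist_seq \<omega>) (?Y \<omega>) =
    (cmod (of_real (sqrt P) * g 2 \<omega> * of_real (ordered_dist (\<Phi> \<omega>) 2 powr (- \<eta> / 2)) +
           of_real (sqrt P) * g 3 \<omega> * of_real (ordered_dist (\<Phi> \<omega>) 3 powr (- \<eta> / 2))))\<^sup>2" for \<omega>
    by (simp only: cmod_power2) (simp add: numeral_2_eq_2 numeral_3_eq_3)
  ultimately have "emeasure M {\<omega> \<in> space M. T <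
      (cmod (of_real (sqrt P) * g 2 \<omega> * of_real (ordered_dist (\<Phi> \<omega>) 2 powr (- \<eta> / 2)) +
           of_real (sqrt P) * g 3 \<omega> * of_real (ordered_dist (\<Phi> \<omega>) 3 powr (- \<eta> / 2))))\<^sup>2 /
      (received_power P \<eta> \<Phi> h 1 \<omega> + interference_from P \<eta> \<Phi> h 4 \<omega> + N)} =
    (\<integral>\<^sup>+\<omega>. f (dist_seq \<omega> 0) (dist_seq \<omega> 1) (dist_seq \<omega> 2) \<partial>M)"
    by (simp add: f_def)
  also have "\<dots> = (\<integral>\<^sup>+x. (\<integral>\<^sup>+y. (\<integral>\<^sup>+z. (if 0 < x \<and> x < y \<and> y < z
        then ennreal (2 * pi * lam * x * (2 * pi * lam * y) * (2 * pi * lam * z) * exp (- (lam * pi * z\<^sup>2))) else 0)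
      * f x y z \<partial>lborel) \<partial>lborel) \<partial>lborel)"
    by (rule nn_integral_dist3[OF f_meas])
  finally have em0: "emeasure M {\<omega> \<in> space M. T <
      (cmod (of_real (sqrt P) * g 2 \<omega> * of_real (ordered_dist (\<Phi> \<omega>) 2 powr (- \<eta> / 2)) +
           of_real (sqrt P) * g 3 \<omega> * of_real (ordered_dist (\<Phi> \<omega>) 3 powr (- \<eta> / 2))))\<^sup>2 /
      (received_power P \<eta> \<Phi> h 1 \<omega> + interference_from P \<eta> \<Phi> h 4 \<omega> + N)} = \<dots>" .
  let ?F = "\<lambda>x y z. (if 0 < x \<and> x < y \<and> y < z
        then ennreal (2 * pi * lam * x * (2 * pi * lam * y) * (2 * pi * lam * z) * exp (- (lam * pi * z\<^sup>2))) else 0)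
      * f x y z"
  have F: "(\<lambda>(x, y, z). ?F x y z) \<in> borel_measurable (borel \<Otimes>\<^sub>M borel \<Otimes>\<^sub>M borel)"
  proof -
    have [measurable]: "(\<lambda>w. f (fst w) (fst (snd w)) (snd (snd w))) \<in> borel_measurable (borel \<Otimes>\<^sub>M borel \<Otimes>\<^sub>M borel)"
      using f_meas by (simp add: split_beta')
    show ?thesis unfolding split_beta' by measurable
  qed
  note em = em0[unfolded nn_integral_rotate(1)[OF F]]
  let ?E = "\<lambda>y z. y * z * exp (- (s y z * N) - pi * lam * z\<^sup>2 * (1 + 2 * s y z * P * z powr (- \<eta>) / (\<eta> - 2) *
        real_hyp2F1 1 (1 - 2 / \<eta>) (2 - 2 / \<eta>) (- (s y z * P * z powr (- \<eta>)))))"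
  let ?g = "\<lambda>y z. 8 * (pi * lam) ^ 3 * (indicator {0<..} y *\<^sub>R (indicator {y<..} z *\<^sub>R (?E y z * nearest_factor \<eta> (s y z * P) y)))"
  have sP: "0 \<le> s y z * P" for y z using s0 P_pos by simp
  have nf: "0 \<le> nearest_factor \<eta> (s y z * P) y" for y z
    by (intro nearest_factor_nonneg sP)
  have "(LBINT y. (LBINT z. ?g y z)) = enn2real (\<integral>\<^sup>+y. (\<integral>\<^sup>+z. (\<integral>\<^sup>+x. ?F x y z \<partial>lborel) \<partial>lborel) \<partial>lborel)"
  proof (rule iterated_integral_eq_enn2real)
    show "(\<lambda>(y, z). \<integral>\<^sup>+x. ?F x y z \<partial>lborel) \<in> borel_measurable (lborel \<Otimes>\<^sub>M lborel)"
      by (rule nn_integral_rotate(2)[OF F])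
    \<comment> \<open>The value is a probability.\<close>
    show "(\<integral>\<^sup>+y. (\<integral>\<^sup>+z. (\<integral>\<^sup>+x. ?F x y z \<partial>lborel) \<partial>lborel) \<partial>lborel) \<noteq> \<infinity>"
      unfolding em[symmetric] by (simp add: emeasure_eq_measure)
    fix y z :: real
    show "0 \<le> ?g y z" using nf[of y z] lam_pos by (auto split: split_indicator)
    show "(\<integral>\<^sup>+x. ?F x y z \<partial>lborel) = ennreal (?g y z)"
    proof (cases "0 < y \<and> y < z")
      case True
      then have y: "0 < y" and z: "0 < z" by auto
      \<comment> \<open>Chosen so that \<open>q * z powr \<eta> = s y z * P\<close>, the form in
        which the exponent at radius \<open>z\<close> is hypergeometric.\<close>
      define q where "q = s y z * P * z powr (- \<eta>)"
      have "0 < y powr (- \<eta>) + z powr (- \<eta>)" using y z by (intro add_pos_pos) auto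
      then have q: "0 < q" using T P_pos y z by (simp add: q_def s_def)
      have qz: "q * z powr \<eta> = s y z * P"
        using z by (simp add: q_def mult.assoc powr_add[symmetric])
      let ?L = "2 * q / (\<eta> - 2) * real_hyp2F1 1 (1 - 2 / \<eta>) (2 - 2 / \<eta>) (- q)"
      have D: "interference_exponent lam \<eta> (s y z * P) z = pi * lam * z\<^sup>2 * ?L"
        using interference_exponent_eq_hyp2F1[OF q z] unfolding qz .
      have E: "?E y z = y * z * exp (- (s y z * N) - pi * lam * z\<^sup>2 * (1 + ?L))"
        by (simp add: q_def mult.assoc)
      have e: "exp (- (lam * pi * z\<^sup>2)) * (exp (- (s y z * N)) * exp (- (pi * lam * z\<^sup>2 * ?L))) =
        exp (- (s y z * N) - pi * lam * z\<^sup>2 * (1 + ?L))"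
        by (simp add: mult_exp_exp algebra_simps)
      have rearrange: "2 * a * b * x * (2 * a * b * y) * (2 * a * b * z) * u * (v * k * w) =
        8 * (a * b) ^ 3 * (y * z * (u * (v * w))) * (x * k)" for a b x u v w k :: real
        by (simp add: power3_eq_cube)
      have nn: "0 \<le> 8 * (pi * lam) ^ 3 * ?E y z" using y z lam_pos by simp
      have "(\<integral>\<^sup>+x. ?F x y z \<partial>lborel) = (\<integral>\<^sup>+x. ennreal (8 * (pi * lam) ^ 3 * ?E y z) *
        (if 0 < x \<and> x < y then ennreal (x / (1 + s y z * P * x powr (- \<eta>))) else 0) \<partial>lborel)"
      proof (rule nn_integral_cong)
        fix x :: real
        have k: "0 \<le> 1 / (1 + s y z * P * x powr (- \<eta>))" using sP[of y z] by simp
        let ?k = "1 / (1 + s y z * P * x powr (- \<eta>))"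
        have "2 * pi * lam * x * (2 * pi * lam * y) * (2 * pi * lam * z) * exp (- (lam * pi * z\<^sup>2)) *
          (exp (- (s y z * N)) * ?k * exp (- (pi * lam * z\<^sup>2 * ?L))) =
          8 * (pi * lam) ^ 3 * (y * z * (exp (- (lam * pi * z\<^sup>2)) * (exp (- (s y z * N)) * exp (- (pi * lam * z\<^sup>2 * ?L))))) * (x * ?k)"
          by (rule rearrange)
        also have "\<dots> = 8 * (pi * lam) ^ 3 * ?E y z * (x / (1 + s y z * P * x powr (- \<eta>)))"
          unfolding e E by simp
        finally have r: "2 * pi * lam * x * (2 * pi * lam * y) * (2 * pi * lam * z) * exp (- (lam * pi * z\<^sup>2)) *
          (exp (- (s y z * N)) * ?k * exp (- (pi * lam * z\<^sup>2 * ?L))) =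
          8 * (pi * lam) ^ 3 * ?E y z * (x / (1 + s y z * P * x powr (- \<eta>)))" .
        have fr: "f x y z = ennreal (exp (- (s y z * N)) * ?k * exp (- (pi * lam * z\<^sup>2 * ?L)))"
          unfolding f_def D using k by (simp only: ennreal_mult''[symmetric] exp_ge_zero)
        have nn2: "0 \<le> exp (- (s y z * N)) * ?k * exp (- (pi * lam * z\<^sup>2 * ?L))"
          using k by (intro mult_nonneg_nonneg) auto
        show "?F x y z = ennreal (8 * (pi * lam) ^ 3 * ?E y z) *
          (if 0 < x \<and> x < y then ennreal (x / (1 + s y z * P * x powr (- \<eta>))) else 0)"
        proof (cases "0 < x \<and> x < y")
          case c: True
          then have c': "0 < x \<and> x < y \<and> y < z" using True by simp
          show ?thesis
            unfolding fr by (simp only: c c' if_True simp_thms ennreal_mult''[OF nn2, symmetric] ennreal_mult'[OF nn, symmetric] r)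
        next
          case False
          then show ?thesis by auto
        qed
      qed
      also have "\<dots> = ennreal (8 * (pi * lam) ^ 3 * ?E y z) * ennreal (nearest_factor \<eta> (s y z * P) y)"
        by (subst nn_integral_cmult) (auto simp: nearest_factor[OF sP])
      also have "\<dots> = ennreal (8 * (pi * lam) ^ 3 * ?E y z * nearest_factor \<eta> (s y z * P) y)"
        using nf by (rule ennreal_mult''[symmetric])
      finally show ?thesis using True by (simp add: mult.assoc)
    next
      case False
      then have zero: "?F x y z = 0" for x by auto
      show ?thesis unfolding zero using False by (auto split: split_indicator)
    qed
  qed
  then show ?thesis
    unfolding coverage_blackout_coop_def measure_def em set_lebesgue_integral_def nearest_factor_def
    by (simp only: integral_mult_right_zero real_scaleR_def)
qed

section \<open>Path loss exponent four\<close>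

lemma interference_exponent_4:
  assumes "0 < A" "0 < x"
  shows "interference_exponent lam 4 A x = pi * lam * (sqrt A * arctan (sqrt A / x\<^sup>2))"
proof -
  have "A powr (1 / 2) * x powr (- 2) = sqrt A / x\<^sup>2"
    using assms by (simp add: powr_half_sqrt powr_minus powr_numeral field_simps)
  moreover have "0 \<le> sqrt A / x\<^sup>2" using assms by simp
  ultimately show ?thesis
    using assms by (simp add: interference_exponent_def power_kernel_arctan powr_half_sqrt)
qed

text \<open>Constants leave a Bochner integral unconditionally, so agreement of the integrands on
  the domain suffices, without any integrability.\<close>

lemma mult_iterated_integral_cong:
  fixes A B :: "real \<Rightarrow> real \<Rightarrow> real"
  assumes "\<And>y z. 0 < y \<Longrightarrow> y < z \<Longrightarrow> c * A y z = B y z"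
  shows "c * (LBINT y:{0<..}. (LBINT z:{y<..}. A y z)) = (LBINT y:{0<..}. (LBINT z:{y<..}. B y z))"
proof -
  have "c * (LBINT y:{0<..}. (LBINT z:{y<..}. A y z)) =
    (LBINT y. indicator {0<..} y * (LBINT z. indicator {y<..} z * (c * A y z)))"
    unfolding set_lebesgue_integral_def real_scaleR_def
    by (simp only: integral_mult_right_zero[symmetric] mult.left_commute[of c])
  also have "\<dots> = (LBINT y. indicator {0<..} y * (LBINT z. indicator {y<..} z * B y z))"
  proof (rule Bochner_Integration.integral_cong[OF refl])
    fix y :: real
    show "indicator {0<..} y * (LBINT z. indicator {y<..} z * (c * A y z)) =
      indicator {0<..} y * (LBINT z. indicator {y<..} z * B y z)"
    proof (cases "0 < y")
      case True
      then have "indicator {y<..} z * (c * A y z) = indicator {y<..} z * B y z" for z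
        using assms by (simp split: split_indicator)
      then show ?thesis by (simp only:)
    qed simp
  qed
  finally show ?thesis by (simp add: set_lebesgue_integral_def)
qed

text \<open>\<open>L\<close> stands for the hypergeometric term. Hypothesis \<open>D\<close> ties it
  to the interference exponent, which is an arctangent at \<open>\<eta> = 4\<close>, so the Gauss
  function itself is never evaluated. \<open>A\<close> is \<open>s * P\<close>.\<close>

lemma coop_integrand_4:
  assumes pos: "0 < P" "0 < T" "0 < lam" and y: "0 < y" and z: "y < z"
  defines "A \<equiv> T / (P * (y powr (- 4) + z powr (- 4))) * P"
  assumes D: "interference_exponent lam 4 A z = pi * lam * z\<^sup>2 * L"
  shows "8 * (pi * lam) ^ 3 * (y * z * exp (- (pi * lam * z\<^sup>2 * (1 + L))) * nearest_factor 4 A y) =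
    4 * (pi * lam) ^ 3 * y ^ 3 * z *
    (1 - sqrt (T * z ^ 4 / (y ^ 4 + z ^ 4)) * arctan (sqrt ((y ^ 4 + z ^ 4) / (T * z ^ 4)))) *
    exp (- (pi * lam * (z\<^sup>2 + sqrt (T / (1 / y ^ 4 + 1 / z ^ 4)) * arctan (sqrt (T * y ^ 4 / (y ^ 4 + z ^ 4))))))"
proof -
  have z0: "0 < z" using y z by simp
  have sum: "0 < 1 / y ^ 4 + 1 / z ^ 4" "0 < y ^ 4 + z ^ 4" using y z0 by (simp_all add: add_pos_pos)
  have A: "A = T / (1 / y ^ 4 + 1 / z ^ 4)"
  proof -
    have "A = T / (y powr (- 4) + z powr (- 4))" using pos by (simp add: A_def)
    then show ?thesis using y z0 by (simp add: powr_minus powr_numeral inverse_eq_divide)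
  qed
  \<comment> \<open>Over this common denominator, division by \<open>z ^ 4\<close> or
    \<open>y ^ 4\<close> yields the radicands of the claim.\<close>
  have A': "A = T * (y ^ 4 * z ^ 4) / (y ^ 4 + z ^ 4)"
    unfolding A using y z0 sum by (simp add: field_simps)
  have A0: "0 < A" unfolding A using sum pos by simp
  have sqrt4: "sqrt (r ^ 4) = r\<^sup>2" for r :: real
    using real_sqrt_unique[of "r\<^sup>2" "r ^ 4"] by simp
  have 1: "sqrt A / z\<^sup>2 = sqrt (T * y ^ 4 / (y ^ 4 + z ^ 4))"
    unfolding sqrt4[symmetric] real_sqrt_divide[symmetric] A' using z0 by simp
  have 2: "sqrt A / y\<^sup>2 = sqrt (T * z ^ 4 / (y ^ 4 + z ^ 4))"
    unfolding sqrt4[symmetric] real_sqrt_divide[symmetric] A' using y by simp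
  have 3: "y\<^sup>2 / sqrt A = sqrt ((y ^ 4 + z ^ 4) / (T * z ^ 4))"
    unfolding sqrt4[symmetric] real_sqrt_divide[symmetric] A' using y by simp
  have "pi * lam * z\<^sup>2 * (1 + L) = pi * lam * z\<^sup>2 + interference_exponent lam 4 A z"
    unfolding D by (simp add: algebra_simps)
  also have "\<dots> = pi * lam * (z\<^sup>2 + sqrt A * arctan (sqrt (T * y ^ 4 / (y ^ 4 + z ^ 4))))"
    unfolding interference_exponent_4[OF A0 z0] 1 by (simp add: algebra_simps)
  finally have ex: "pi * lam * z\<^sup>2 * (1 + L) =
    pi * lam * (z\<^sup>2 + sqrt (T / (1 / y ^ 4 + 1 / z ^ 4)) * arctan (sqrt (T * y ^ 4 / (y ^ 4 + z ^ 4))))"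
    unfolding A .
  show ?thesis
    unfolding ex nearest_factor_4[OF A0 y] 2 3 by (simp add: power2_eq_square power3_eq_cube)
qed

theorem theorem1:
  fixes M :: "'w measure"
    and \<Phi> :: "'w \<Rightarrow> (real^2) set"
    and h :: "nat \<Rightarrow> 'w \<Rightarrow> real"
    and g :: "nat \<Rightarrow> 'w \<Rightarrow> complex"
    and lam P T \<sigma>2 \<eta> :: real
  assumes "prob_space M"
    and "lam > 0" and "P > 0" and "T > 0" and "\<sigma>2 \<ge> 0" and "\<eta> > 2"
    and "poisson_process M lam \<Phi>"
    and "\<And>i. i \<ge> 1 \<Longrightarrow> distributed M lborel (h i) (exponential_density 1)"
    and "\<And>i. i \<in> {2, 3} \<Longrightarrow> std_complex_gaussian M (g i)"
    and "prob_space.indep_sets M (generated_events M \<Phi> h g) (insert Process (Gain ` {1..}))"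
    and "prob_space.indep_sets M (generated_events M \<Phi> h g)
           ({Process, Coeff 2, Coeff 3, Gain 1} \<union> Gain ` {4..})"
  defines "s \<equiv> (\<lambda>r2 r3. T / (P * (r2 powr (- \<eta>) + r3 powr (- \<eta>))))"
  shows "coverage_best_connected M \<Phi> h P \<eta> \<sigma>2 T =
           2 * pi * lam * (LBINT x:{0<..}. x * exp (- (T * \<sigma>2 * x powr \<eta> / P) -
             pi * lam * x\<^sup>2 * (1 + T powr (2 / \<eta>) *
               (LBINT w:{T powr (- 2 / \<eta>)<..}. 1 / (1 + w powr (\<eta> / 2))))))
       \<and> coverage_blackout M \<Phi> h P \<eta> \<sigma>2 T =
           (2 * lam * pi)\<^sup>2 * (LBINT y:{0<..}. y * exp (- (T * \<sigma>2 * y powr \<eta> / P) -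
             lam * pi * y\<^sup>2 * (2 * T / (\<eta> - 2) * real_hyp2F1 1 (1 - 2 / \<eta>) (2 - 2 / \<eta>) (- T) + 1)) *
             (LBINT x:{0<..<y}. x / (1 + T * y powr \<eta> * x powr (- \<eta>))))
       \<and> coverage_blackout_coop M \<Phi> h g P \<eta> \<sigma>2 T =
           8 * (pi * lam) ^ 3 * (LBINT r2:{0<..}. (LBINT r3:{r2<..}.
             r2 * r3 * exp (- (s r2 r3 * \<sigma>2) -
               pi * lam * r3\<^sup>2 * (1 + 2 * s r2 r3 * P * r3 powr (- \<eta>) / (\<eta> - 2) *
                 real_hyp2F1 1 (1 - 2 / \<eta>) (2 - 2 / \<eta>) (- (s r2 r3 * P * r3 powr (- \<eta>))))) *
             (LBINT r1:{0<..<r2}. r1 / (1 + s r2 r3 * P * r1 powr (- \<eta>)))))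
       \<and> (\<sigma>2 = 0 \<and> \<eta> = 4 \<longrightarrow>
           coverage_blackout_coop M \<Phi> h g P \<eta> \<sigma>2 T =
             (LBINT r2:{0<..}. (LBINT r3:{r2<..}.
               4 * (pi * lam) ^ 3 * r2 ^ 3 * r3 *
               (1 - sqrt (T * r3 ^ 4 / (r2 ^ 4 + r3 ^ 4)) *
                  arctan (sqrt ((r2 ^ 4 + r3 ^ 4) / (T * r3 ^ 4)))) *
               exp (- (pi * lam * (r3\<^sup>2 + sqrt (T / (1 / r2 ^ 4 + 1 / r3 ^ 4)) *
                  arctan (sqrt (T * r2 ^ 4 / (r2 ^ 4 + r3 ^ 4)))))))))"
proof -
  note M = assms(1) and lam = assms(2) and P = assms(3) and T = assms(4) and N = assms(5) and eta = assms(6)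
    and poisson = assms(7) and h = assms(8) and g = assms(9)
  interpret prob_space M by fact
  interpret poisson_network M \<Phi> lam
    using lam poisson by unfold_locales
  have h_meas: "h i \<in> borel_measurable M" if "1 \<le> i" for i
    using distributed_measurable[OF h[OF that]] by simp
  have g_meas: "g i \<in> borel_measurable M" if "i \<in> {2, 3}" for i
  proof -
    have [measurable]: "(\<lambda>\<omega>. Re (g i \<omega>)) \<in> borel_measurable M" "(\<lambda>\<omega>. Im (g i \<omega>)) \<in> borel_measurable M"
      using g[OF that] by (auto simp: std_complex_gaussian_def dest: distributed_measurable)
    have "(\<lambda>\<omega>. of_real (Re (g i \<omega>)) + \<i> * of_real (Im (g i \<omega>))) \<in> borel_measurable M" by measurable
    then show ?thesis by (simp add: complex_eq[symmetric])
  qed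
  \<comment> \<open>The two independence hypotheses give separate families: all gains with the
    process, and the coefficients of the two servers with the process and the remaining
    gains.\<close>
  have ind1: "indep_vars (\<lambda>_. borel_product UNIV) (source_value \<Phi> h g) (insert Process (Gain ` {1..}))"
    by (rule indep_vars_source_value[OF assms(10)]) (auto intro: h_meas)
  have ind2: "indep_vars (\<lambda>_. borel_product UNIV) (source_value \<Phi> h g)
      ({Process, Coeff 2, Coeff 3, Gain 1} \<union> Gain ` {4..})"
    by (rule indep_vars_source_value[OF assms(11)]) (auto intro: h_meas g_meas)
  \<comment> \<open>Zero-based, the three index sets are all stations except the servers.\<close>
  interpret best: faded_network M \<Phi> lam h g "{0<..}" P \<eta>
    using P eta h by unfold_locales (auto intro!: indep_vars_subset[OF ind1])
  interpret blackout: faded_network M \<Phi> lam h g "{0} \<union> {1<..}" P \<eta>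
    using P eta h by unfold_locales (auto intro!: indep_vars_subset[OF ind1])
  interpret coop: faded_network M \<Phi> lam h g "{0} \<union> {2<..}" P \<eta>
    using P eta h by unfold_locales (auto intro!: indep_vars_subset[OF ind2])
  have coop_formula: "coverage_blackout_coop M \<Phi> h g P \<eta> \<sigma>2 T =
    8 * (pi * lam) ^ 3 * (LBINT r2:{0<..}. (LBINT r3:{r2<..}.
      r2 * r3 * exp (- (s r2 r3 * \<sigma>2) - pi * lam * r3\<^sup>2 * (1 + 2 * s r2 r3 * P * r3 powr (- \<eta>) / (\<eta> - 2) *
        real_hyp2F1 1 (1 - 2 / \<eta>) (2 - 2 / \<eta>) (- (s r2 r3 * P * r3 powr (- \<eta>))))) *
      (LBINT r1:{0<..<r2}. r1 / (1 + s r2 r3 * P * r1 powr (- \<eta>)))))"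
    unfolding s_def by (rule coop.coverage_blackout_coop_formula[OF refl N T g g ind2]) auto
  have coop_4: "coverage_blackout_coop M \<Phi> h g P \<eta> \<sigma>2 T =
             (LBINT r2:{0<..}. (LBINT r3:{r2<..}.
               4 * (pi * lam) ^ 3 * r2 ^ 3 * r3 *
               (1 - sqrt (T * r3 ^ 4 / (r2 ^ 4 + r3 ^ 4)) *
                  arctan (sqrt ((r2 ^ 4 + r3 ^ 4) / (T * r3 ^ 4)))) *
               exp (- (pi * lam * (r3\<^sup>2 + sqrt (T / (1 / r2 ^ 4 + 1 / r3 ^ 4)) *
                  arctan (sqrt (T * r2 ^ 4 / (r2 ^ 4 + r3 ^ 4))))))))"
    if special: "\<sigma>2 = 0" "\<eta> = 4"
    unfolding coop_formula
  proof (rule mult_iterated_integral_cong)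
    fix y z :: real assume y: "0 < y" and z: "y < z"
    then have z0: "0 < z" by simp
    let ?q = "s y z * P * z powr (- \<eta>)"
    have "0 < y powr (- \<eta>) + z powr (- \<eta>)" using y z0 by (intro add_pos_pos) auto
    then have q: "0 < ?q" using T P y z0 by (simp add: s_def)
    have qz: "?q * z powr \<eta> = s y z * P"
      using z0 by (simp add: mult.assoc powr_add[symmetric])
    have "interference_exponent lam \<eta> (s y z * P) z =
      pi * lam * z\<^sup>2 * (2 * ?q / (\<eta> - 2) * real_hyp2F1 1 (1 - 2 / \<eta>) (2 - 2 / \<eta>) (- ?q))"
      \<comment> \<open>The identity does not involve the set of interferers, so any of the three
        interpretations supplies it.\<close>
      using best.interference_exponent_eq_hyp2F1[OF q z0] unfolding qz .
    then have "interference_exponent lam \<eta> (s y z * P) z =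
      pi * lam * z\<^sup>2 * (2 * s y z * P * z powr (- \<eta>) / (\<eta> - 2) * real_hyp2F1 1 (1 - 2 / \<eta>) (2 - 2 / \<eta>) (- ?q))"
      by (simp only: mult.assoc)
    note D = this[unfolded s_def special(2)]
    have noise: "- (s y z * \<sigma>2) - u = - u" for u using special by simp
    show "8 * (pi * lam) ^ 3 * (y * z * exp (- (s y z * \<sigma>2) - pi * lam * z\<^sup>2 * (1 + 2 * s y z * P * z powr (- \<eta>) / (\<eta> - 2) *
        real_hyp2F1 1 (1 - 2 / \<eta>) (2 - 2 / \<eta>) (- ?q))) *
      (LBINT r1:{0<..<y}. r1 / (1 + s y z * P * r1 powr (- \<eta>)))) =
      4 * (pi * lam) ^ 3 * y ^ 3 * z *
      (1 - sqrt (T * z ^ 4 / (y ^ 4 + z ^ 4)) * arctan (sqrt ((y ^ 4 + z ^ 4) / (T * z ^ 4)))) *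
      exp (- (pi * lam * (z\<^sup>2 + sqrt (T / (1 / y ^ 4 + 1 / z ^ 4)) * arctan (sqrt (T * y ^ 4 / (y ^ 4 + z ^ 4))))))"
      using coop_integrand_4[OF P T lam y z D]
      unfolding noise unfolding s_def special(2) nearest_factor_def .
  qed
  show ?thesis
    using best.coverage_best_connected_formula[OF refl N T h ind1]
      blackout.coverage_blackout_formula[OF refl N T h ind1] coop_formula coop_4
    by simp
qed

end
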